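(* Let $L>0$, $\xi>0$, $M\ge 0$, $\delta>1$ be constants with $\xi=L\delta$, and let $x_0\in\mathbb{R}^n$. Let $f\in C(I\times\mathbb{R}^n\times\mathbb{R}^n,\mathbb{R}^n)$ and let $k(t,s,u)\in\mathbb{R}^n$ be continuous for $a\le s\le t<\infty$, $u\in\mathbb{R}^n$. Suppose that $$\|f(t,u,v)-f(t,\bar u,\bar v)\|\le M\big(\|u-\bar u\|+\|v-\bar v\|\big),$$ $$\|k(t,s,u)-k(t,s,\bar u)\|\le L\|u-\bar u\|,$$ and, with $f_0(s)=f\left(s,0,\frac{1}{\Gamma(\alpha)}\int_a^s N_\psi^\alpha(s,\sigma)k(s,\sigma,0)\,d\sigma\right)$, $$d_2=\sup_{t>a}\frac{1}{\mathbb{E}_\alpha[\xi(\psi(t)-\psi(a))^\alpha]}\left\|\Psi^\gamma(t,a)x_0+I_{a^+}^{\alpha,\psi}f_0(t)\right\|<\infty .$$ If $\frac{M}{\xi}\left(1+\frac1\delta\right)<1$, then the nonlinear integrodifferential problem $${}^H\mathbb{D}_{a^+}^{\alpha,\beta,\psi}x(t)=f\left(t,x(t),\frac{1}{\Gamma(\alpha)}\int_a^t N_\psi^\alpha(t,s)k(t,s,x(s))\,ds\right),\qquad I_{a^+}^{1-\gamma,\psi}x(a)=x_0,$$ has a unique solution $x\in C_\xi(I,\mathbb{R}^n)$.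
   Context: Let $a\in\mathbb{R}$, $I=[a,\infty)$, $0<\alpha\le 1$, $0\le\beta\le1$, $\gamma=\alpha+\beta(1-\alpha)$, and let $\|\cdot\|$ be a norm on $\mathbb{R}^n$. The function $\psi:I\to\mathbb{R}$ is increasing, positive on $(a,\infty)$, with continuous derivative $\psi'$ on $I$ and $\psi'(t)\ne 0$ for all $t$. Put $N_\psi^\alpha(t,s)=\psi'(s)(\psi(t)-\psi(s))^{\alpha-1}$ and $\Psi^\gamma(t,a)=(\psi(t)-\psi(a))^{\gamma-1}/\Gamma(\gamma)$ for $t>a$. $\mathbb{E}_\alpha(z)=\sum_{k=0}^\infty z^k/\Gamma(\alpha k+1)$ is the one-parameter Mittag-Leffler function. The $\psi$-Riemann-Liouville integral is $I_{a^+}^{\alpha,\psi}g(t)=\frac{1}{\Gamma(\alpha)}\int_a^t N_\psi^\alpha(t,s)g(s)\,ds$ (with $I^{0,\psi}_{a^+}g=g$), and the $\psi$-Hilfer derivative is ${}^H\mathbb{D}_{a^+}^{\alpha,\beta,\psi}x(t)=I_{a^+}^{\beta(1-\alpha),\psi}\left(\frac{1}{\psi'(t)}\frac{d}{dt}\right)I_{a^+}^{(1-\beta)(1-\alpha),\psi}x(t)$, taken componentwise. $C_\xi(I,\mathbb{R}^n)$ is the set of continuous $x:I\to\mathbb{R}^n$ with $\sup_{t\in I}\|x(t)\|/\mathbb{E}_\alpha[\xi(\psi(t)-\psi(a))^\alpha]<\infty$.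
   Formalization: The ψ-Hilfer derivative in the equation is taken in the closure of the displayed operator's graph under locally uniform convergence: for α<1, β>0 a solution with the pointwise d/dt need not exist (α=1/2, β=1, ψ(t)=t, k=0, f=max(0,t−1)^{1/4}). I^{1−γ,ψ}x(a) is the limit t→a+. *)

theory Defs
  imports "HOL-Analysis.Analysis"
begin

text \<open>
  Throughout, \<open>\<psi>'\<close> is passed explicitly next to \<open>\<psi>\<close>: it is the derivative of \<open>\<psi>\<close> on
  \<open>[a,\<infinity>)\<close>, one-sided at \<open>a\<close>, where \<^const>\<open>deriv\<close> says nothing.
\<close>

definition is_norm :: "('a::real_vector \<Rightarrow> real) \<Rightarrow> bool" where
  "is_norm N \<longleftrightarrow> (\<forall>x. N x = 0 \<longleftrightarrow> x = 0) \<and> (\<forall>c x. N (c *\<^sub>R x) = \<bar>c\<bar> * N x)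
     \<and> (\<forall>x y. N (x + y) \<le> N x + N y)"

definition mittag_leffler :: "real \<Rightarrow> real \<Rightarrow> real" where
  "mittag_leffler \<alpha> z = (\<Sum>k. z ^ k / Gamma (\<alpha> * real k + 1))"

definition psi_kernel :: "(real \<Rightarrow> real) \<Rightarrow> (real \<Rightarrow> real) \<Rightarrow> real \<Rightarrow> real \<Rightarrow> real \<Rightarrow> real" where
  "psi_kernel \<psi> \<psi>' \<alpha> t s = \<psi>' s * (\<psi> t - \<psi> s) powr (\<alpha> - 1)"

definition psi_RL_integral ::
  "real \<Rightarrow> real \<Rightarrow> (real \<Rightarrow> real) \<Rightarrow> (real \<Rightarrow> real) \<Rightarrow> (real \<Rightarrow> real ^ 'n::finite) \<Rightarrow> real \<Rightarrow> real ^ 'n" where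
  "psi_RL_integral a \<alpha> \<psi> \<psi>' g t =
     (if \<alpha> = 0 then g t
      else (1 / Gamma \<alpha>) *\<^sub>R (LINT s:{a..t}|lborel. psi_kernel \<psi> \<psi>' \<alpha> t s *\<^sub>R g s))"

definition psi_RL_exists ::
  "real \<Rightarrow> real \<Rightarrow> (real \<Rightarrow> real) \<Rightarrow> (real \<Rightarrow> real) \<Rightarrow> (real \<Rightarrow> real ^ 'n::finite) \<Rightarrow> real \<Rightarrow> bool" where
  "psi_RL_exists a \<alpha> \<psi> \<psi>' g t \<longleftrightarrow>
     \<alpha> = 0 \<or> set_integrable lborel {a..t} (\<lambda>s. psi_kernel \<psi> \<psi>' \<alpha> t s *\<^sub>R g s)"

definition psi_diff ::
  "(real \<Rightarrow> real) \<Rightarrow> (real \<Rightarrow> real ^ 'n::finite) \<Rightarrow> real \<Rightarrow> real ^ 'n" where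
  "psi_diff \<psi>' h t = (1 / \<psi>' t) *\<^sub>R vector_derivative h (at t)"

definition psi_Hilfer ::
  "real \<Rightarrow> real \<Rightarrow> real \<Rightarrow> (real \<Rightarrow> real) \<Rightarrow> (real \<Rightarrow> real) \<Rightarrow> (real \<Rightarrow> real ^ 'n::finite) \<Rightarrow> real \<Rightarrow> real ^ 'n" where
  "psi_Hilfer a \<alpha> \<beta> \<psi> \<psi>' x =
     psi_RL_integral a (\<beta> * (1 - \<alpha>)) \<psi> \<psi>'
       (psi_diff \<psi>' (psi_RL_integral a ((1 - \<beta>) * (1 - \<alpha>)) \<psi> \<psi>' x))"

text \<open>All three stages of the formula for \<^const>\<open>psi_Hilfer\<close> make sense on \<open>(a,\<infinity>)\<close>.\<close>

definition psi_Hilfer_exists ::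
  "real \<Rightarrow> real \<Rightarrow> real \<Rightarrow> (real \<Rightarrow> real) \<Rightarrow> (real \<Rightarrow> real) \<Rightarrow> (real \<Rightarrow> real ^ 'n::finite) \<Rightarrow> bool" where
  "psi_Hilfer_exists a \<alpha> \<beta> \<psi> \<psi>' x \<longleftrightarrow>
     (\<forall>t>a. psi_RL_exists a ((1 - \<beta>) * (1 - \<alpha>)) \<psi> \<psi>' x t
          \<and> psi_RL_integral a ((1 - \<beta>) * (1 - \<alpha>)) \<psi> \<psi>' x differentiable (at t)
          \<and> psi_RL_exists a (\<beta> * (1 - \<alpha>)) \<psi> \<psi>'
              (psi_diff \<psi>' (psi_RL_integral a ((1 - \<beta>) * (1 - \<alpha>)) \<psi> \<psi>' x)) t)"

text \<open>
  The operator \<^const>\<open>psi_Hilfer\<close> on \<open>C([a,\<infinity>))\<close>, with the domain \<^const>\<open>psi_Hilfer_exists\<close>, is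
  not closed when \<open>\<alpha> < 1\<close> and \<open>\<beta> > 0\<close>: for continuous \<open>g\<close> the fractional integral
  \<open>x = I\<^sup>\<alpha> g\<close> need not lie in the domain, although \<open>g\<close> should be its fractional derivative.
  (For \<open>\<beta> = 1\<close> the formula asks for \<open>x\<close> itself to be differentiable, but \<open>I\<^sup>\<alpha> g\<close> can be nowhere
  differentiable.)  As usual for differential equations with merely continuous right-hand side,
  the derivative is therefore taken in the sense of the closure of its graph under locally
  uniform convergence.  Lemma \<open>has_psi_Hilfer_if_exists\<close> says that this extends the pointwise
  notion, and lemma \<open>psi_Hilfer_if_has_psi_Hilfer\<close> that nothing is added when
  \<open>\<alpha> = 1\<close> or \<open>\<beta> = 0\<close>.
\<close>

definition has_psi_Hilfer ::
  "real \<Rightarrow> real \<Rightarrow> real \<Rightarrow> (real \<Rightarrow> real) \<Rightarrow> (real \<Rightarrow> real) \<Rightarrow>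
   (real \<Rightarrow> real ^ 'n::finite) \<Rightarrow> (real \<Rightarrow> real ^ 'n) \<Rightarrow> bool" where
  "has_psi_Hilfer a \<alpha> \<beta> \<psi> \<psi>' x g \<longleftrightarrow>
     (\<exists>X :: nat \<Rightarrow> real \<Rightarrow> real ^ 'n.
        (\<forall>m. continuous_on {a..} (X m) \<and> psi_Hilfer_exists a \<alpha> \<beta> \<psi> \<psi>' (X m)) \<and>
        (\<forall>T>a. uniform_limit {a..T} X x sequentially) \<and>
        (\<forall>T>a. uniform_limit {a<..T} (\<lambda>m. psi_Hilfer a \<alpha> \<beta> \<psi> \<psi>' (X m)) g sequentially))"

lemma has_psi_Hilfer_if_exists:
  assumes "continuous_on {a..} x" "psi_Hilfer_exists a \<alpha> \<beta> \<psi> \<psi>' x"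
    and "\<And>t. t > a \<Longrightarrow> psi_Hilfer a \<alpha> \<beta> \<psi> \<psi>' x t = g t"
  shows "has_psi_Hilfer a \<alpha> \<beta> \<psi> \<psi>' x g"
  unfolding has_psi_Hilfer_def
  using assms by (intro exI[of _ "\<lambda>_. x"]) (auto simp: uniform_limit_iff)

lemma psi_deriv_pos:
  assumes mono: "mono_on {a..} \<psi>"
    and der: "\<And>t. t \<ge> a \<Longrightarrow> (\<psi> has_real_derivative \<psi>' t) (at t within {a..})"
    and nz: "\<And>t. t \<ge> a \<Longrightarrow> \<psi>' t \<noteq> 0"
    and "t > a"
  shows "(\<psi> has_real_derivative \<psi>' t) (at t)" "\<psi>' t > 0"
proof -
  have "at t within {a..} = at t"
    using \<open>t > a\<close> by (intro at_within_interior) simp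
  then show D: "(\<psi> has_real_derivative \<psi>' t) (at t)"
    using der[of t] \<open>t > a\<close> by simp
  have "\<psi>' t \<ge> 0"
  proof (rule ccontr)
    assume "\<not> \<psi>' t \<ge> 0"
    then obtain d where d: "d > 0" "\<And>h. h > 0 \<Longrightarrow> h < d \<Longrightarrow> \<psi> (t + h) < \<psi> t"
      using DERIV_neg_dec_right[OF D] by auto
    have "\<psi> (t + d/2) < \<psi> t" using d by simp
    moreover have "\<psi> t \<le> \<psi> (t + d/2)"
      using mono \<open>t > a\<close> d by (auto simp: mono_on_def)
    ultimately show False by simp
  qed
  then show "\<psi>' t > 0" using nz[of t] \<open>t > a\<close> by simp
qed

lemma psi_kernel_integrable:
  assumes mono: "mono_on {a..} \<psi>"
    and der: "\<And>t. t \<ge> a \<Longrightarrow> (\<psi> has_real_derivative \<psi>' t) (at t within {a..})"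
    and cont: "continuous_on {a..} \<psi>'"
    and nz: "\<And>t. t \<ge> a \<Longrightarrow> \<psi>' t \<noteq> 0"
    and "t > a" "\<mu> > 0"
  shows "set_integrable lborel {a..t} (psi_kernel \<psi> \<psi>' \<mu> t)"
proof -
  have P: "(\<psi> has_real_derivative \<psi>' s) (at s)" "\<psi>' s > 0" if "a < s" for s
    using psi_deriv_pos[OF mono der nz that] by blast+
  have contpsi: "continuous_on {a..} \<psi>"
    using der by (intro DERIV_continuous_on) auto
  have less: "\<psi> s < \<psi> t" if "a < s" "s < t" for s
  proof (rule DERIV_pos_imp_increasing[OF \<open>s < t\<close>])
    fix x assume "s \<le> x" "x \<le> t"
    then show "\<exists>y. (\<psi> has_real_derivative y) (at x) \<and> 0 < y"
      using P[of x] that by auto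
  qed
  let ?F = "\<lambda>s. - ((\<psi> t - \<psi> s) powr \<mu>) / \<mu>"
  have contF: "continuous_on {a..t} ?F"
    using \<open>\<mu> > 0\<close> mono
    by (intro continuous_intros continuous_on_powr' continuous_on_subset[OF contpsi])
       (auto simp: mono_on_def)
  have "set_integrable lborel (einterval (ereal a) (ereal t)) (psi_kernel \<psi> \<psi>' \<mu> t)"
  proof (rule interval_integral_FTC_nonneg(1)[where F = ?F and A = "?F a" and B = "?F t"])
    fix s assume "ereal a < ereal s" "ereal s < ereal t"
    then have s: "a < s" "s < t" by auto
    show "DERIV ?F s :> psi_kernel \<psi> \<psi>' \<mu> t s"
      unfolding psi_kernel_def
      using \<open>\<mu> > 0\<close> less[OF s] P(1)[OF s(1)]
      by (auto intro!: derivative_eq_intros)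
    have "continuous (at s) \<psi>'"
      using cont s continuous_on_interior[of "{a..}"] by auto
    moreover have "continuous (at s) \<psi>"
      using P(1)[OF s(1)] by (rule DERIV_isCont)
    ultimately show "isCont (psi_kernel \<psi> \<psi>' \<mu> t) s"
      unfolding psi_kernel_def using less[OF s]
      by (intro continuous_intros) auto
  next
    show "AE x in lborel. ereal a < ereal x \<longrightarrow> ereal x < ereal t \<longrightarrow> 0 \<le> psi_kernel \<psi> \<psi>' \<mu> t x"
      using P(2) by (auto simp: psi_kernel_def less_imp_le)
  next
    show "((?F \<circ> real_of_ereal) \<longlongrightarrow> ?F a) (at_right (ereal a))"
      unfolding ereal_tendsto_simps1
      using continuous_on_Icc_at_rightD[OF contF] \<open>t > a\<close> by simp
    show "((?F \<circ> real_of_ereal) \<longlongrightarrow> ?F t) (at_left (ereal t))"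
      unfolding ereal_tendsto_simps1
      using continuous_on_Icc_at_leftD[OF contF] \<open>t > a\<close> by simp
  qed (use \<open>t > a\<close> in auto)
  then have "set_integrable lborel {a<..<t} (psi_kernel \<psi> \<psi>' \<mu> t)"
    by (simp add: einterval_eq_Icc)
  moreover have "set_borel_measurable lborel {a..t} (psi_kernel \<psi> \<psi>' \<mu> t)"
  proof -
    have meas: "(\<lambda>s. indicator {a..t} s * y s) \<in> borel_measurable borel"
      if "continuous_on {a..} y" for y :: "real \<Rightarrow> real"
      using borel_measurable_continuous_on_indicator[OF _ continuous_on_subset[OF that], of "{a..t}"]
      by simp
    note [measurable] = meas[OF cont] meas[OF contpsi]
    have "(\<lambda>s. (indicator {a..t} s * \<psi>' s) * (\<psi> t - indicator {a..t} s * \<psi> s) powr (\<mu> - 1))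
        \<in> borel_measurable borel" by measurable
    also have "(\<lambda>s. (indicator {a..t} s * \<psi>' s) * (\<psi> t - indicator {a..t} s * \<psi> s) powr (\<mu> - 1))
       = (\<lambda>s. indicator {a..t} s *\<^sub>R psi_kernel \<psi> \<psi>' \<mu> t s)"
      by (auto simp: psi_kernel_def indicator_def)
    finally show ?thesis by (simp add: set_borel_measurable_def)
  qed
  moreover have "AE s in lborel. (s \<in> {a<..<t}) = (s \<in> {a..t})"
    using AE_lborel_singleton[of a] AE_lborel_singleton[of t] by eventually_elim auto
  ultimately show ?thesis
    unfolding set_integrable_def set_borel_measurable_def
    by (elim integrable_cong_AE_imp) (auto simp: indicator_def)
qed

lemma psi_RL_integral_LIMSEQ:
  fixes x :: "real \<Rightarrow> real ^ 'n::finite"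
  assumes psi: "mono_on {a..} \<psi>"
      "\<And>t. t \<ge> a \<Longrightarrow> (\<psi> has_real_derivative \<psi>' t) (at t within {a..})"
      "continuous_on {a..} \<psi>'" "\<And>t. t \<ge> a \<Longrightarrow> \<psi>' t \<noteq> 0"
    and "t > a" "\<mu> \<ge> 0"
    and X: "\<And>m. continuous_on {a..} (X m)" and x: "continuous_on {a..} x"
    and lim: "uniform_limit {a..t} X x sequentially"
  shows "psi_RL_exists a \<mu> \<psi> \<psi>' x t"
    and "(\<lambda>m. psi_RL_integral a \<mu> \<psi> \<psi>' (X m) t) \<longlonglongrightarrow> psi_RL_integral a \<mu> \<psi> \<psi>' x t"
proof -
  have pt: "(\<lambda>m. X m s) \<longlonglongrightarrow> x s" if "s \<in> {a..t}" for s
    using lim that by (rule tendsto_uniform_limitI)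
  have *: "psi_RL_exists a \<mu> \<psi> \<psi>' x t \<and>
     (\<lambda>m. psi_RL_integral a \<mu> \<psi> \<psi>' (X m) t) \<longlonglongrightarrow> psi_RL_integral a \<mu> \<psi> \<psi>' x t" if "\<mu> > 0"
  proof -
    let ?K = "psi_kernel \<psi> \<psi>' \<mu> t"
    have K: "integrable lborel (\<lambda>s. indicator {a..t} s *\<^sub>R ?K s)"
      using psi_kernel_integrable[OF psi \<open>t > a\<close> that] by (simp add: set_integrable_def)
    have "compact (x ` {a..t})"
      by (intro compact_continuous_image continuous_on_subset[OF x]) auto
    then obtain B where B: "\<And>s. s \<in> {a..t} \<Longrightarrow> norm (x s) \<le> B"
      by (meson bounded_iff compact_imp_bounded imageI)
    have "\<forall>\<^sub>F m in sequentially. \<forall>s\<in>{a..t}. dist (X m s) (x s) < 1"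
      using lim by (auto simp: uniform_limit_iff)
    then obtain m0 where m0: "\<And>m s. m \<ge> m0 \<Longrightarrow> s \<in> {a..t} \<Longrightarrow> dist (X m s) (x s) < 1"
      unfolding eventually_sequentially by blast
    have meas: "(\<lambda>s. indicator {a..t} s *\<^sub>R ?K s *\<^sub>R y s) \<in> borel_measurable lborel"
      if "continuous_on {a..} y" for y :: "real \<Rightarrow> real ^ 'n"
    proof -
      have [measurable]: "(\<lambda>s. indicator {a..t} s *\<^sub>R y s) \<in> borel_measurable borel"
        by (intro borel_measurable_continuous_on_indicator continuous_on_subset[OF that]) auto
      have [measurable]: "(\<lambda>s. indicator {a..t} s *\<^sub>R ?K s) \<in> borel_measurable borel"
        using borel_measurable_integrable[OF K] by simp
      have "(\<lambda>s. (indicator {a..t} s *\<^sub>R ?K s) *\<^sub>R (indicator {a..t} s *\<^sub>R y s)) \<in> borel_measurable borel"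
        by measurable
      also have "(\<lambda>s. (indicator {a..t} s *\<^sub>R ?K s) *\<^sub>R (indicator {a..t} s *\<^sub>R y s)) =
         (\<lambda>s. indicator {a..t} s *\<^sub>R ?K s *\<^sub>R y s)" by (auto simp: indicator_def)
      finally show ?thesis by simp
    qed
    let ?G = "\<lambda>m s. indicator {a..t} s *\<^sub>R ?K s *\<^sub>R X (m + m0) s"
    let ?g = "\<lambda>s. indicator {a..t} s *\<^sub>R ?K s *\<^sub>R x s"
    have W: "integrable lborel (\<lambda>s. norm (indicator {a..t} s *\<^sub>R ?K s) * (B + 1))"
      using K by (intro integrable_mult_left integrable_norm)
    have L: "AE s in lborel. (\<lambda>m. ?G m s) \<longlonglongrightarrow> ?g s"
    proof (intro AE_I2)
      fix s
      have "(\<lambda>m. X (m + m0) s) \<longlonglongrightarrow> x s" if "s \<in> {a..t}"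
        using pt[OF that] by (rule LIMSEQ_ignore_initial_segment)
      then show "(\<lambda>m. ?G m s) \<longlonglongrightarrow> ?g s"
        by (cases "s \<in> {a..t}") (auto intro!: tendsto_intros)
    qed
    have D: "AE s in lborel. norm (?G m s) \<le> norm (indicator {a..t} s *\<^sub>R ?K s) * (B + 1)" for m
    proof (intro AE_I2)
      fix s
      have "norm (X (m + m0) s) \<le> B + 1" if "s \<in> {a..t}"
        using B[OF that] m0[OF _ that, of "m + m0"] norm_triangle_sub[of "X (m + m0) s" "x s"]
        by (simp add: dist_norm)
      then show "norm (?G m s) \<le> norm (indicator {a..t} s *\<^sub>R ?K s) * (B + 1)"
        by (cases "s \<in> {a..t}") (auto intro!: mult_left_mono)
    qed
    have "integrable lborel ?g"
      by (rule integrable_dominated_convergence[OF meas[OF x] meas[OF X] W L D])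
    moreover have "(\<lambda>m. integral\<^sup>L lborel (?G m)) \<longlonglongrightarrow> integral\<^sup>L lborel ?g"
      by (rule integral_dominated_convergence[OF meas[OF x] meas[OF X] W L D])
    then have "(\<lambda>m. integral\<^sup>L lborel (\<lambda>s. indicator {a..t} s *\<^sub>R ?K s *\<^sub>R X m s)) \<longlonglongrightarrow> integral\<^sup>L lborel ?g"
      by (rule LIMSEQ_offset)
    ultimately show ?thesis
      using that unfolding psi_RL_exists_def psi_RL_integral_def set_integrable_def
        set_lebesgue_integral_def
      by (auto intro!: tendsto_intros)
  qed
  show "psi_RL_exists a \<mu> \<psi> \<psi>' x t"
    using * \<open>\<mu> \<ge> 0\<close> by (cases "\<mu> = 0") (auto simp: psi_RL_exists_def)
  show "(\<lambda>m. psi_RL_integral a \<mu> \<psi> \<psi>' (X m) t) \<longlonglongrightarrow> psi_RL_integral a \<mu> \<psi> \<psi>' x t"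
    using * \<open>\<mu> \<ge> 0\<close> pt[of t] \<open>t > a\<close> by (cases "\<mu> = 0") (auto simp: psi_RL_integral_def)
qed

lemma psi_Hilfer_if_has_psi_Hilfer:
  fixes x :: "real \<Rightarrow> real ^ 'n::finite"
  assumes psi: "mono_on {a..} \<psi>"
      "\<And>t. t \<ge> a \<Longrightarrow> (\<psi> has_real_derivative \<psi>' t) (at t within {a..})"
      "continuous_on {a..} \<psi>'" "\<And>t. t \<ge> a \<Longrightarrow> \<psi>' t \<noteq> 0"
    and "\<alpha> \<le> 1" "\<beta> \<le> 1" "\<alpha> = 1 \<or> \<beta> = 0"
    and x: "continuous_on {a..} x"
    and H: "has_psi_Hilfer a \<alpha> \<beta> \<psi> \<psi>' x g"
  shows "psi_Hilfer_exists a \<alpha> \<beta> \<psi> \<psi>' x"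
    and "t > a \<Longrightarrow> psi_Hilfer a \<alpha> \<beta> \<psi> \<psi>' x t = g t"
proof -
  define \<mu> where "\<mu> = (1 - \<beta>) * (1 - \<alpha>)"
  have mu: "\<mu> \<ge> 0" and nu: "\<beta> * (1 - \<alpha>) = 0"
    using assms by (auto simp: \<mu>_def)
  let ?h = "\<lambda>y. psi_RL_integral a \<mu> \<psi> \<psi>' y"
  have Heq: "psi_Hilfer a \<alpha> \<beta> \<psi> \<psi>' y = psi_diff \<psi>' (?h y)" for y :: "real \<Rightarrow> real ^ 'n"
    by (auto simp: psi_Hilfer_def psi_RL_integral_def nu \<mu>_def)
  from H obtain X where
    X: "\<And>m. continuous_on {a..} (X m)" "\<And>m. psi_Hilfer_exists a \<alpha> \<beta> \<psi> \<psi>' (X m)"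
    and U: "\<And>T. T > a \<Longrightarrow> uniform_limit {a..T} X x sequentially"
    and V: "\<And>T. T > a \<Longrightarrow> uniform_limit {a<..T} (\<lambda>m. psi_diff \<psi>' (?h (X m))) g sequentially"
    unfolding has_psi_Hilfer_def Heq by blast
  have lim: "(\<lambda>m. ?h (X m) t) \<longlonglongrightarrow> ?h x t" and ex: "psi_RL_exists a \<mu> \<psi> \<psi>' x t" if "t > a" for t
    using psi_RL_integral_LIMSEQ[OF psi that mu X(1) x U[OF that]] by auto
  have dm: "(?h (X m) has_vector_derivative (\<psi>' t *\<^sub>R psi_diff \<psi>' (?h (X m)) t)) (at t)"
    if "t > a" for m t
    using X(2)[of m] that psi(4)[of t]
    by (auto simp: psi_Hilfer_exists_def psi_diff_def \<mu>_def vector_derivative_works)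
  have d: "(?h x has_vector_derivative (\<psi>' t *\<^sub>R g t)) (at t)" if "t > a" for t
  proof -
    define S where "S = {a<..<t+1}"
    have "continuous_on {a..t+1} \<psi>'" using psi(3) by (rule continuous_on_subset) auto
    then have "bounded (\<psi>' ` {a..t+1})"
      by (intro compact_imp_bounded compact_continuous_image compact_Icc)
    then obtain B where B: "\<And>s. s \<in> {a..t+1} \<Longrightarrow> norm (\<psi>' s) \<le> B"
      unfolding bounded_iff by blast
    have B0: "B \<ge> 0" using order_trans[OF norm_ge_zero B[of t]] that by simp
    have "\<exists>y. \<forall>s\<in>S. (\<lambda>m. ?h (X m) s) \<longlonglongrightarrow> y s \<and>
        (y has_derivative (\<lambda>r. r *\<^sub>R \<psi>' s *\<^sub>R g s)) (at s within S)"
    proof (rule has_derivative_sequence[where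
          f' = "\<lambda>m s r. r *\<^sub>R \<psi>' s *\<^sub>R psi_diff \<psi>' (?h (X m)) s"])
      show "convex S" by (simp add: S_def)
      show "t \<in> S" using that by (simp add: S_def)
      show "(\<lambda>m. ?h (X m) t) \<longlonglongrightarrow> ?h x t" using lim that .
      show "(?h (X m) has_derivative (\<lambda>r. r *\<^sub>R \<psi>' s *\<^sub>R psi_diff \<psi>' (?h (X m)) s)) (at s within S)"
        if "s \<in> S" for m s
        using dm[of s m] that
        by (auto simp: S_def has_vector_derivative_def intro: has_derivative_at_withinI)
      fix e :: real assume "e > 0"
      have "\<forall>\<^sub>F m in sequentially. \<forall>s\<in>{a<..t+1}. dist (psi_diff \<psi>' (?h (X m)) s) (g s) < e / (B + 1)"
        using V[of "t+1"] that \<open>e > 0\<close> B0 by (simp add: uniform_limit_iff)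
      then show "\<forall>\<^sub>F m in sequentially. \<forall>s\<in>S. \<forall>r.
          norm (r *\<^sub>R \<psi>' s *\<^sub>R psi_diff \<psi>' (?h (X m)) s - r *\<^sub>R \<psi>' s *\<^sub>R g s) \<le> e * norm r"
      proof eventually_elim
        case (elim m)
        show ?case
        proof (intro ballI allI)
          fix s r assume s: "s \<in> S"
          let ?D = "psi_diff \<psi>' (?h (X m)) s - g s"
          have "norm ?D \<le> e / (B + 1)" "norm (\<psi>' s) \<le> B + 1"
            using elim s B[of s] by (auto simp: S_def dist_norm less_imp_le)
          then have "norm (\<psi>' s) * norm ?D \<le> (B + 1) * (e / (B + 1))"
            using B0 \<open>e > 0\<close> by (intro mult_mono) auto
          then have "norm (\<psi>' s) * norm ?D \<le> e" using B0 by simp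
          then have "\<bar>r\<bar> * (norm (\<psi>' s) * norm ?D) \<le> \<bar>r\<bar> * e"
            by (intro mult_left_mono) auto
          moreover have "r *\<^sub>R \<psi>' s *\<^sub>R psi_diff \<psi>' (?h (X m)) s - r *\<^sub>R \<psi>' s *\<^sub>R g s = r *\<^sub>R \<psi>' s *\<^sub>R ?D"
            by (simp add: scaleR_diff_right)
          ultimately show "norm (r *\<^sub>R \<psi>' s *\<^sub>R psi_diff \<psi>' (?h (X m)) s - r *\<^sub>R \<psi>' s *\<^sub>R g s) \<le> e * norm r"
            by (simp add: abs_mult mult.assoc mult.commute[of e])
        qed
      qed
    qed
    then obtain y where y: "\<And>s. s \<in> S \<Longrightarrow> (\<lambda>m. ?h (X m) s) \<longlonglongrightarrow> y s"
      "\<And>s. s \<in> S \<Longrightarrow> (y has_derivative (\<lambda>r. r *\<^sub>R \<psi>' s *\<^sub>R g s)) (at s within S)" by blast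
    have tS: "t \<in> S" "open S" using that by (auto simp: S_def)
    have eq: "y s = ?h x s" if "s \<in> S" for s
      using y(1)[OF that] lim[of s] that by (auto simp: S_def intro: LIMSEQ_unique)
    have "(y has_derivative (\<lambda>r. r *\<^sub>R \<psi>' t *\<^sub>R g t)) (at t)"
      using y(2)[OF tS(1)] at_within_open[OF tS] by simp
    then show ?thesis
      unfolding has_vector_derivative_def
      by (rule has_derivative_transform_within_open[OF _ tS(2,1)]) (use eq in auto)
  qed
  show "psi_Hilfer_exists a \<alpha> \<beta> \<psi> \<psi>' x"
    unfolding psi_Hilfer_exists_def nu \<mu>_def[symmetric]
    using ex differentiableI_vector[OF d] by (auto simp: psi_RL_exists_def)
  show "psi_Hilfer a \<alpha> \<beta> \<psi> \<psi>' x t = g t" if "t > a"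
    using vector_derivative_at[OF d[OF that]] psi(4)[of t] that
    by (simp add: Heq psi_diff_def)
qed

text \<open>
  Functions on \<open>[a,\<infinity>)\<close> are represented by functions on \<open>\<real>\<close> with the fixed value
  \<^const>\<open>undefined\<close> off \<open>[a,\<infinity>)\<close>, so that equality is equality on \<open>[a,\<infinity>)\<close>.
\<close>

definition C_xi ::
  "(real ^ 'n::finite \<Rightarrow> real) \<Rightarrow> real \<Rightarrow> real \<Rightarrow> (real \<Rightarrow> real) \<Rightarrow> real \<Rightarrow> (real \<Rightarrow> real ^ 'n) set" where
  "C_xi N a \<alpha> \<psi> \<xi> = {x \<in> extensional {a..}. continuous_on {a..} x \<and>
     bdd_above ((\<lambda>t. N (x t) / mittag_leffler \<alpha> (\<xi> * (\<psi> t - \<psi> a) powr \<alpha>)) ` {a..})}"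

text \<open>
  The initial value \<open>I\<^sup>1\<^sup>-\<^sup>\<gamma> x(a)\<close> is the limit at \<open>a\<close> from the right, since the integral over
  \<open>[a,a]\<close> is \<open>0\<close> for trivial reasons.
\<close>

definition integrodiff_solution ::
  "real \<Rightarrow> real \<Rightarrow> real \<Rightarrow> (real \<Rightarrow> real) \<Rightarrow> (real \<Rightarrow> real) \<Rightarrow>
   (real \<Rightarrow> real ^ 'n::finite \<Rightarrow> real ^ 'n \<Rightarrow> real ^ 'n) \<Rightarrow>
   (real \<Rightarrow> real \<Rightarrow> real ^ 'n \<Rightarrow> real ^ 'n) \<Rightarrow> real ^ 'n \<Rightarrow> (real \<Rightarrow> real ^ 'n) \<Rightarrow> bool" where
  "integrodiff_solution a \<alpha> \<beta> \<psi> \<psi>' f k x0 x \<longleftrightarrow>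
     has_psi_Hilfer a \<alpha> \<beta> \<psi> \<psi>' x
       (\<lambda>t. f t (x t) (psi_RL_integral a \<alpha> \<psi> \<psi>' (\<lambda>s. k t s (x s)) t)) \<and>
     (psi_RL_integral a (1 - (\<alpha> + \<beta> * (1 - \<alpha>))) \<psi> \<psi>' x \<longlongrightarrow> x0) (at_right a)"

end

theory Submission
  imports Defs
begin

text \<open>
  A continuous \<open>x\<close> solves the problem if and only if \<open>x = x\<^sub>0 + I\<^sup>\<alpha> F(x)\<close> on \<open>[a,\<infinity>)\<close>, where
  \<open>F(x)(t)\<close> is the right-hand side of the equation; here \<open>x\<^sub>0 = 0\<close> unless \<open>\<gamma> = 1\<close>, because
  \<open>\<Psi>\<^sup>\<gamma>(t,a)\<close> blows up at \<open>a\<close> when \<open>\<gamma> < 1\<close> and \<open>d\<^sub>2\<close> is finite.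
  From the equation to the integral equation: if \<open>x\<close> is in the domain of the pointwise
  derivative, \<open>h = I\<^sup>1\<^sup>-\<^sup>\<gamma> x\<close> and \<open>\<phi> = h'/\<psi>'\<close>, then \<open>h - h(a) = I\<^sup>1 \<phi>\<close>, and applying \<open>I\<^sup>\<gamma>\<close> gives
  \<open>I\<^sup>1 x - I\<^sup>\<gamma> h(a) = I\<^sup>1\<^sup>+\<^sup>\<gamma> \<phi> = I\<^sup>1\<^sup>+\<^sup>\<alpha> (D x)\<close>, an identity that survives locally uniform limits.
  Conversely, \<open>I\<^sup>\<alpha> g\<close> is approximated by \<open>I\<^sup>\<alpha> p\<close> for polynomials \<open>p\<close> in \<open>\<psi> - \<psi>(a)\<close>, on which all
  operators are explicit.

  The weight \<open>w(t) = E\<^sub>\<alpha>(\<xi> (\<psi>(t) - \<psi>(a))\<^sup>\<alpha>)\<close> satisfies \<open>I\<^sup>\<alpha> w = (w - 1)/\<xi>\<close>, so the integral operator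
  contracts the \<open>w\<close>-weighted supremum norm with factor \<open>M/\<xi> (1 + L/\<xi>) = M/\<xi> (1 + 1/\<delta>)\<close>.
\<close>


subsection \<open>The kernel\<close>

text \<open>The approximants in the closed derivative converge together with their derivatives D X,
  but the inner functions \<phi> behind D X are known only to be integrable against \<psi>'. An
  identity that passes to the limit may therefore contain nothing but x and D x. The direct
  candidate x = c + I^\<alpha> (D x) would need I^\<alpha> I^\<eta> \<phi> = I^\<gamma> \<phi>, with
  \<eta> = \<beta>(1 - \<alpha>), at every point, whereas for a kernel of order below 1 and a merely
  integrable \<phi> such an identity is to be expected only almost everywhere. One more integration
  raises every total order to at least 1; there the kernel is bounded and the exchange of integrals
  is valid at each t. The surplus I^1 is cancelled at the end, since it is injective on continuous
  functions. If \<eta> = 0, the existence of the outer integral carries no information on \<phi>,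
  and \<open>psi_Hilfer_if_has_psi_Hilfer\<close> takes the place of the limit passage.

  The norm N is arbitrary, so integrals are estimated through a supporting linear functional, and
  uniform convergence through the comparison of N with the Euclidean norm.\<close>

locale psi_setup =
  fixes a :: real and \<psi> \<psi>' :: "real \<Rightarrow> real"
  assumes mono: "mono_on {a..} \<psi>"
    and der: "\<And>t. t \<ge> a \<Longrightarrow> (\<psi> has_real_derivative \<psi>' t) (at t within {a..})"
    and cont': "continuous_on {a..} \<psi>'"
    and nz: "\<And>t. t \<ge> a \<Longrightarrow> \<psi>' t \<noteq> 0"
begin

lemmas psi_facts = mono der cont' nz

lemma cont: "continuous_on {a..} \<psi>"
  using der by (intro DERIV_continuous_on) auto

text \<open>Moving the base point turns the results on [a, t] into results on [s, t]; the inner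
  integral over \<tau> in \<open>kernel_semigroup\<close> is of that kind.\<close>

lemma psi_setup_from: "a \<le> b \<Longrightarrow> psi_setup b \<psi> \<psi>'"
  using mono nz
  by unfold_locales
    (auto simp: mono_on_def intro: has_field_derivative_subset[OF der] continuous_on_subset[OF cont'])

text \<open>At \<open>a\<close> the derivative is one-sided and \<open>psi_deriv_pos\<close> is
  silent; there the sign is inherited by continuity of \<psi>' from the right, and \<open>nz\<close>
  makes it strict.\<close>

lemma deriv_pos: "t \<ge> a \<Longrightarrow> \<psi>' t > 0"
proof -
  assume "t \<ge> a"
  have "\<psi>' x \<ge> 0" if "x \<in> {a<..}" for x
    using psi_deriv_pos(2)[OF mono der nz] that by (simp add: less_imp_le)
  then have "\<psi>' t \<ge> 0"
    using \<open>t \<ge> a\<close> cont' by (intro continuous_ge_on_closure[of "{a<..}" \<psi>' t 0]) auto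
  then show ?thesis using nz[OF \<open>t \<ge> a\<close>] by simp
qed

lemma der_at: "t > a \<Longrightarrow> (\<psi> has_real_derivative \<psi>' t) (at t)"
  using psi_deriv_pos(1)[OF mono der nz] .

lemma psi_less: "a \<le> s \<Longrightarrow> s < t \<Longrightarrow> \<psi> s < \<psi> t"
proof (rule DERIV_pos_imp_increasing_open[of s t \<psi>])
  fix x assume "a \<le> s" "s < x" "x < t"
  then show "\<exists>y. (\<psi> has_real_derivative y) (at x) \<and> 0 < y"
    using der_at[of x] deriv_pos[of x] by auto
qed (auto intro: continuous_on_subset[OF cont])

lemma psi_less_iff: "a \<le> s \<Longrightarrow> a \<le> t \<Longrightarrow> \<psi> s < \<psi> t \<longleftrightarrow> s < t"
  using psi_less[of s t] psi_less[of t s] by (metis less_asym linorder_neqE)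

lemma psi_le_iff: "a \<le> s \<Longrightarrow> a \<le> t \<Longrightarrow> \<psi> s \<le> \<psi> t \<longleftrightarrow> s \<le> t"
  using psi_less_iff[of t s] by auto

lemma inj_psi: "inj_on \<psi> {a..}"
  by (rule inj_onI) (metis atLeast_iff order_antisym order_refl psi_le_iff)

lemma psi_image: "a \<le> t \<Longrightarrow> \<psi> ` {a..t} = {\<psi> a..\<psi> t}"
proof (intro equalityI subsetI)
  fix y assume "a \<le> t" "y \<in> {\<psi> a..\<psi> t}"
  then obtain x where "a \<le> x" "x \<le> t" "\<psi> x = y"
    using IVT'[of \<psi> a y t] continuous_on_subset[OF cont, of "{a..t}"] by auto
  then show "y \<in> \<psi> ` {a..t}" by auto
qed (auto simp: psi_le_iff)

lemma kernel_nonneg: "a \<le> s \<Longrightarrow> 0 \<le> psi_kernel \<psi> \<psi>' \<mu> t s"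
  using deriv_pos[of s] by (simp add: psi_kernel_def)

lemma kernel_integrable:
  assumes "\<mu> > 0"
  shows "set_integrable lborel {a..t} (psi_kernel \<psi> \<psi>' \<mu> t)"
proof -
  consider "t < a" | "t = a" | "t > a" by linarith
  then show ?thesis
    using assms psi_kernel_integrable[OF psi_facts, of t \<mu>] by cases auto
qed

lemma kernel_mult_integrable:
  fixes g :: "real \<Rightarrow> 'b::{banach,second_countable_topology}"
  assumes "\<mu> > 0" and g: "set_borel_measurable borel {a..t} g" and b: "\<And>s. s \<in> {a..t} \<Longrightarrow> norm (g s) \<le> B"
  shows "set_integrable lborel {a..t} (\<lambda>s. psi_kernel \<psi> \<psi>' \<mu> t s *\<^sub>R g s)"
proof (rule set_integrable_bound)
  show "set_integrable lborel {a..t} (\<lambda>s. B * psi_kernel \<psi> \<psi>' \<mu> t s)"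
    using kernel_integrable[OF assms(1)] by auto
  have [measurable]: "(\<lambda>s. indicator {a..t} s *\<^sub>R psi_kernel \<psi> \<psi>' \<mu> t s) \<in> borel_measurable borel"
    using borel_measurable_integrable[OF kernel_integrable[OF assms(1), of t, unfolded set_integrable_def]] by simp
  have [measurable]: "(\<lambda>s. indicator {a..t} s *\<^sub>R g s) \<in> borel_measurable borel"
    using g by (simp add: set_borel_measurable_def)
  \<comment> \<open>Kernel and g are measurable only after being cut off at [a, t], so each factor
    carries its own indicator.\<close>
  have "(\<lambda>s. (indicator {a..t} s *\<^sub>R psi_kernel \<psi> \<psi>' \<mu> t s) *\<^sub>R (indicator {a..t} s *\<^sub>R g s)) \<in> borel_measurable borel"
    by measurable
  also have "(\<lambda>s. (indicator {a..t} s *\<^sub>R psi_kernel \<psi> \<psi>' \<mu> t s) *\<^sub>R (indicator {a..t} s *\<^sub>R g s))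
     = (\<lambda>s. indicator {a..t} s *\<^sub>R psi_kernel \<psi> \<psi>' \<mu> t s *\<^sub>R g s)"
    by (auto simp: indicator_def)
  finally show "set_borel_measurable lborel {a..t} (\<lambda>s. psi_kernel \<psi> \<psi>' \<mu> t s *\<^sub>R g s)"
    by (simp add: set_borel_measurable_def)
  show "AE s in lborel. s \<in> {a..t} \<longrightarrow>
      norm (psi_kernel \<psi> \<psi>' \<mu> t s *\<^sub>R g s) \<le> norm (B * psi_kernel \<psi> \<psi>' \<mu> t s)"
  proof (intro AE_I2 impI)
    fix s assume s: "s \<in> {a..t}"
    have "\<bar>psi_kernel \<psi> \<psi>' \<mu> t s\<bar> * norm (g s) \<le> \<bar>psi_kernel \<psi> \<psi>' \<mu> t s\<bar> * \<bar>B\<bar>"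
      using b[OF s] by (intro mult_left_mono) auto
    then show "norm (psi_kernel \<psi> \<psi>' \<mu> t s *\<^sub>R g s) \<le> norm (B * psi_kernel \<psi> \<psi>' \<mu> t s)"
      by (simp add: abs_mult mult.commute)
  qed
qed

lemma kernel_cont_integrable:
  fixes g :: "real \<Rightarrow> 'b::{banach,second_countable_topology}"
  assumes "\<mu> > 0" "continuous_on {a..t} g"
  shows "set_integrable lborel {a..t} (\<lambda>s. psi_kernel \<psi> \<psi>' \<mu> t s *\<^sub>R g s)"
proof -
  have "bounded (g ` {a..t})"
    by (intro compact_imp_bounded compact_continuous_image compact_Icc assms)
  then obtain B where "\<And>s. s \<in> {a..t} \<Longrightarrow> norm (g s) \<le> B"
    unfolding bounded_iff by blast
  moreover have "set_borel_measurable borel {a..t} g"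
    by (rule set_measurable_continuous_on) (use assms in auto)
  ultimately show ?thesis using kernel_mult_integrable[OF assms(1)] by blast
qed

text \<open>The unit variable r = (\<psi> s - \<psi> a) / (\<psi> t - \<psi> a) maps [a, t]
  bijectively onto [0, 1]. The equivalence serves both ways: Beta integrals are pulled back to
  [a, t], and kernel integrals are pushed forward to [0, 1].\<close>

lemma unit_substitution:
  fixes f :: "real \<Rightarrow> 'b::euclidean_space"
  assumes "t > a"
  defines "\<phi> \<equiv> \<lambda>s. (\<psi> s - \<psi> a) / (\<psi> t - \<psi> a)"
  shows "(\<lambda>s. (\<psi>' s / (\<psi> t - \<psi> a)) *\<^sub>R f (\<phi> s)) absolutely_integrable_on {a..t} \<and>
      integral {a..t} (\<lambda>s. (\<psi>' s / (\<psi> t - \<psi> a)) *\<^sub>R f (\<phi> s)) = b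
    \<longleftrightarrow> f absolutely_integrable_on {0..1} \<and> integral {0..1} f = b"
proof -
  have D: "\<psi> t - \<psi> a > 0" using psi_less assms by simp
  have "\<phi> ` {a..t} = (\<lambda>y. (y - \<psi> a) / (\<psi> t - \<psi> a)) ` \<psi> ` {a..t}"
    by (auto simp: \<phi>_def)
  also have "\<dots> = {0..1}"
  proof (intro equalityI subsetI)
    fix r :: real assume "r \<in> {0..1}"
    then have "r * (\<psi> t - \<psi> a) \<le> 1 * (\<psi> t - \<psi> a)" "0 \<le> r * (\<psi> t - \<psi> a)"
      using D by (auto intro!: mult_right_mono)
    then have "\<psi> a + r * (\<psi> t - \<psi> a) \<in> {\<psi> a..\<psi> t}" by simp
    then show "r \<in> (\<lambda>y. (y - \<psi> a) / (\<psi> t - \<psi> a)) ` \<psi> ` {a..t}"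
      using D assms unfolding psi_image[OF less_imp_le[OF assms(1)]]
      by (intro image_eqI[of _ _ "\<psi> a + r * (\<psi> t - \<psi> a)"]) auto
  qed (use D assms in \<open>auto simp: psi_image divide_simps\<close>)
  finally have im: "\<phi> ` {a..t} = {0..1}" .
  have abs: "\<psi>' s / (\<psi> t - \<psi> a) = \<bar>\<psi>' s / (\<psi> t - \<psi> a)\<bar>" if "s \<in> {a..t}" for s
    using D deriv_pos[of s] that by simp
  have "(\<lambda>s. \<bar>\<psi>' s / (\<psi> t - \<psi> a)\<bar> *\<^sub>R f (\<phi> s)) absolutely_integrable_on {a..t} \<and>
      integral {a..t} (\<lambda>s. \<bar>\<psi>' s / (\<psi> t - \<psi> a)\<bar> *\<^sub>R f (\<phi> s)) = b
    \<longleftrightarrow> f absolutely_integrable_on (\<phi> ` {a..t}) \<and> integral (\<phi> ` {a..t}) f = b"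
  proof (rule has_absolute_integral_change_of_variables_real)
    show "(\<phi> has_real_derivative \<psi>' s / (\<psi> t - \<psi> a)) (at s within {a..t})" if "s \<in> {a..t}" for s
      unfolding \<phi>_def using D that
      by (auto intro!: derivative_eq_intros has_field_derivative_subset[OF der[of s]])
    show "inj_on \<phi> {a..t}"
      using inj_psi D by (auto simp: \<phi>_def inj_on_def)
  qed auto
  moreover have "integral {a..t} (\<lambda>s. \<bar>\<psi>' s / (\<psi> t - \<psi> a)\<bar> *\<^sub>R f (\<phi> s))
      = integral {a..t} (\<lambda>s. (\<psi>' s / (\<psi> t - \<psi> a)) *\<^sub>R f (\<phi> s))"
    by (rule integral_cong) (metis abs)
  moreover have "(\<lambda>s. \<bar>\<psi>' s / (\<psi> t - \<psi> a)\<bar> *\<^sub>R f (\<phi> s)) absolutely_integrable_on {a..t} \<longleftrightarrow>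
      (\<lambda>s. (\<psi>' s / (\<psi> t - \<psi> a)) *\<^sub>R f (\<phi> s)) absolutely_integrable_on {a..t}"
    by (rule set_integrable_cong) (simp_all only: abs[symmetric])
  ultimately show ?thesis by (simp add: im)
qed

text \<open>With r as unit variable, \<psi> t - \<psi> s = D (1 - r). The power of D splits off and
  leaves the Jacobian \<open>\<psi>' s / D\<close>.\<close>

lemma kernel_unit:
  assumes "t > a" "s \<in> {a..t}" "D = \<psi> t - \<psi> a"
  shows "psi_kernel \<psi> \<psi>' \<mu> t s = D powr \<mu> * (\<psi>' s / D * (1 - (\<psi> s - \<psi> a) / D) powr (\<mu> - 1))"
proof -
  have D: "D > 0" using psi_less assms by simp
  have "1 - (\<psi> s - \<psi> a) / D = (\<psi> t - \<psi> s) / D" "\<psi> s \<le> \<psi> t"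
    using D assms by (auto simp: field_simps psi_le_iff)
  moreover have "D powr (\<mu> - 1) = D powr \<mu> / D" using D by (simp add: powr_diff)
  ultimately show ?thesis
    using D by (simp add: psi_kernel_def powr_divide)
qed

text \<open>In the unit variable the integrand becomes r^(q-1) (1-r)^(\<mu>-1), the Beta density,
  times a power of \<psi> t - \<psi> a.\<close>

lemma kernel_power_integral:
  assumes "t \<ge> a" "\<mu> > 0" "q > 0"
  shows "set_integrable lborel {a..t} (\<lambda>s. psi_kernel \<psi> \<psi>' \<mu> t s * (\<psi> s - \<psi> a) powr (q - 1))" (is ?A)
    and "(LINT s:{a..t}|lborel. psi_kernel \<psi> \<psi>' \<mu> t s * (\<psi> s - \<psi> a) powr (q - 1))
       = Beta q \<mu> * (\<psi> t - \<psi> a) powr (\<mu> + q - 1)" (is ?B)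
proof -
  have "?A \<and> ?B"
  proof (cases "t = a")
    case True
    \<comment> \<open>At \<open>t = a\<close> the right-hand side vanishes as well, because
      \<open>0 powr\<close> is 0 for every exponent.\<close>
    have "(LINT s:{a}|lborel. f s) = 0" for f :: "real \<Rightarrow> real"
      using set_borel_integral_eq_integral(2)[of "{a}" f] by simp
    then show ?thesis using True by simp
  next
    case False
    then have t: "t > a" using assms by simp
    define D where "D = \<psi> t - \<psi> a"
    have D: "D > 0" using psi_less t by (simp add: D_def)
    define f where "f = (\<lambda>r::real. r powr (q - 1) * (1 - r) powr (\<mu> - 1))"
    define F where "F = (\<lambda>s. (\<psi>' s / D) *\<^sub>R f ((\<psi> s - \<psi> a) / D))"
    have f: "(f has_integral Beta q \<mu>) {0..1}"
      unfolding f_def by (rule has_integral_Beta_real) (use assms in auto)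
    then have "f absolutely_integrable_on {0..1}"
      by (intro nonnegative_absolutely_integrable_1) (auto simp: f_def)
    then have F: "F absolutely_integrable_on {a..t}" "integral {a..t} F = Beta q \<mu>"
      using unit_substitution[OF t, of f "Beta q \<mu>"] f by (auto simp: F_def D_def integral_unique)
    let ?k = "\<lambda>s. psi_kernel \<psi> \<psi>' \<mu> t s * (\<psi> s - \<psi> a) powr (q - 1)"
    have eq: "?k s = D powr (\<mu> + q - 1) * F s" if "s \<in> {a..t}" for s
    proof -
      have "\<psi> s - \<psi> a \<ge> 0" using that by (simp add: psi_le_iff)
      then have "((\<psi> s - \<psi> a) / D) powr (q - 1) = (\<psi> s - \<psi> a) powr (q - 1) / D powr (q - 1)"
        using D by (simp add: powr_divide)
      moreover have "D powr (\<mu> + q - 1) = D powr \<mu> * D powr (q - 1)"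
        by (simp add: add_diff_eq flip: powr_add)
      ultimately show ?thesis
        using D unfolding kernel_unit[OF t that D_def] F_def f_def by simp
    qed
    have "(\<lambda>s. D powr (\<mu> + q - 1) * F s) absolutely_integrable_on {a..t}"
      using F(1) by auto
    then have k: "?k absolutely_integrable_on {a..t}"
      by (subst set_integrable_cong[OF refl refl eq]) auto
    \<comment> \<open>The change of variables speaks of the completed measure; Borel measurability
      brings integrability back to \<open>lborel\<close>.\<close>
    have meas: "(\<lambda>s. indicator {a..t} s *\<^sub>R ?k s) \<in> borel_measurable borel"
    proof -
      have [measurable]: "(\<lambda>s. indicator {a..t} s *\<^sub>R psi_kernel \<psi> \<psi>' \<mu> t s) \<in> borel_measurable borel"
        using borel_measurable_integrable[OF kernel_integrable[OF assms(2), of t, unfolded set_integrable_def]] by simp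
      have [measurable]: "(\<lambda>s. indicator {a..t} s *\<^sub>R \<psi> s) \<in> borel_measurable borel"
        using set_measurable_continuous_on[of "{a..t}" \<psi>] continuous_on_subset[OF cont, of "{a..t}"]
        by (auto simp: set_borel_measurable_def)
      have "(\<lambda>s. (indicator {a..t} s *\<^sub>R psi_kernel \<psi> \<psi>' \<mu> t s) * (indicator {a..t} s *\<^sub>R \<psi> s - \<psi> a) powr (q - 1)) \<in> borel_measurable borel"
        by measurable
      also have "(\<lambda>s. (indicator {a..t} s *\<^sub>R psi_kernel \<psi> \<psi>' \<mu> t s) * (indicator {a..t} s *\<^sub>R \<psi> s - \<psi> a) powr (q - 1)) =
         (\<lambda>s. indicator {a..t} s *\<^sub>R ?k s)" by (auto simp: indicator_def)
      finally show ?thesis .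
    qed
    have A: ?A
      using k meas unfolding set_integrable_def by (subst (asm) integrable_completion) auto
    have "(LINT s:{a..t}|lborel. ?k s) = integral {a..t} ?k"
      using A by (rule set_borel_integral_eq_integral)
    also have "\<dots> = integral {a..t} (\<lambda>s. D powr (\<mu> + q - 1) * F s)"
      by (rule integral_cong) (rule eq)
    also have "\<dots> = Beta q \<mu> * D powr (\<mu> + q - 1)"
      using F by simp
    finally show ?thesis using A by (simp add: D_def)
  qed
  then show ?A ?B by auto
qed


text \<open>After the substitution \<open>\<psi>(s) = \<psi>(a) + r (\<psi>(t) - \<psi>(a))\<close> the domain and the singularity no
  longer depend on \<open>t\<close>, so dominated convergence applies.\<close>

lemma kernel_integral_continuous:
  fixes G :: "real \<Rightarrow> real \<Rightarrow> 'b::euclidean_space"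
  assumes "\<mu> > 0" and G: "continuous_on {(t, s). a \<le> s \<and> s \<le> t} (\<lambda>(t, s). G t s)"
  shows "continuous_on {a..} (\<lambda>t. LINT s:{a..t}|lborel. psi_kernel \<psi> \<psi>' \<mu> t s *\<^sub>R G t s)"
proof -
  define g where "g = inv_into {a..} \<psi>"
  define D where "D = (\<lambda>t. \<psi> t - \<psi> a)"
  \<comment> \<open>The point of [a, t] whose unit variable is r.\<close>
  define \<sigma> where "\<sigma> = (\<lambda>t r. g (\<psi> a + r * D t))"
  define H where "H = (\<lambda>t r. (1 - r) powr (\<mu> - 1) *\<^sub>R G t (\<sigma> t r))"
  have D0: "D t \<ge> 0" if "t \<ge> a" for t using that by (simp add: D_def psi_le_iff)
  have g: "g (\<psi> s) = s" if "s \<ge> a" for s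
    unfolding g_def using inj_psi that by (intro inv_into_f_f) auto
  have mem: "\<psi> a + r * D t \<in> \<psi> ` {a..t}" if "t \<ge> a" "r \<in> {0..1}" for t r
    using D0[OF that(1)] that mult_right_mono[of r 1 "D t"] mult_nonneg_nonneg[of r "D t"]
    by (auto simp: psi_image D_def)
  have s_mem: "\<sigma> t r \<in> {a..t}" if "t \<ge> a" "r \<in> {0..1}" for t r
    using mem[OF that] g by (auto simp: \<sigma>_def)
  have G1: "continuous_on {a..t} (G t)" for t
  proof -
    have "continuous_on {a..t} ((\<lambda>(t, s). G t s) \<circ> (\<lambda>s. (t, s)))"
      by (intro continuous_on_compose continuous_intros continuous_on_subset[OF G]) auto
    then show ?thesis by (simp add: o_def)
  qed
  have main: "H t integrable_on {0..1} \<and>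
      (LINT s:{a..t}|lborel. psi_kernel \<psi> \<psi>' \<mu> t s *\<^sub>R G t s) = D t powr \<mu> *\<^sub>R integral {0..1} (H t)"
    if "t > a" for t
  proof -
    have Dp: "D t > 0" using psi_less that by (simp add: D_def)
    define F where "F = (\<lambda>s. (\<psi>' s / D t) *\<^sub>R H t ((\<psi> s - \<psi> a) / D t))"
    have eq: "psi_kernel \<psi> \<psi>' \<mu> t s *\<^sub>R G t s = D t powr \<mu> *\<^sub>R F s" if "s \<in> {a..t}" for s
      using that Dp unfolding kernel_unit[OF \<open>t > a\<close> that D_def[THEN fun_cong]] F_def H_def
      by (simp add: \<sigma>_def g mult_ac)
    have k: "set_integrable lborel {a..t} (\<lambda>s. psi_kernel \<psi> \<psi>' \<mu> t s *\<^sub>R G t s)"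
      by (rule kernel_cont_integrable[OF assms(1) G1])
    then have "set_integrable lborel {a..t} (\<lambda>s. D t powr \<mu> *\<^sub>R F s)"
      by (subst (asm) set_integrable_cong[OF refl refl eq]) auto
    then have "set_integrable lborel {a..t} F"
      using set_integrable_scaleR_right[of "1 / D t powr \<mu>" lborel "{a..t}" "\<lambda>s. D t powr \<mu> *\<^sub>R F s"] Dp by simp
    then have F: "F absolutely_integrable_on {a..t}"
      unfolding set_integrable_def by (subst integrable_completion) auto
    then have H: "H t absolutely_integrable_on {0..1}" "integral {0..1} (H t) = integral {a..t} F"
      using unit_substitution[OF that, of "H t" "integral {a..t} F"] by (auto simp: F_def D_def)
    have "(LINT s:{a..t}|lborel. psi_kernel \<psi> \<psi>' \<mu> t s *\<^sub>R G t s) = integral {a..t} (\<lambda>s. psi_kernel \<psi> \<psi>' \<mu> t s *\<^sub>R G t s)"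
      using k by (rule set_borel_integral_eq_integral)
    also have "\<dots> = integral {a..t} (\<lambda>s. D t powr \<mu> *\<^sub>R F s)"
      by (rule integral_cong) (rule eq)
    finally show ?thesis
      using H set_lebesgue_integral_eq_integral(1)[OF H(1)] by simp
  qed
  have P: "(\<lambda>r::real. (1 - r) powr (\<mu> - 1)) integrable_on {0..1}"
  proof -
    \<comment> \<open>(1-r)^(\<mu>-1) is itself a kernel, namely the one for the identity in place
      of \<psi>, on [0, 1].\<close>
    interpret u: psi_setup 0 "\<lambda>x. x" "\<lambda>_. 1"
      by unfold_locales (auto simp: mono_on_def)
    have "set_integrable lborel {0..1} (psi_kernel (\<lambda>x. x) (\<lambda>_. 1) \<mu> 1)"
      by (rule u.kernel_integrable[OF assms(1)])
    from set_borel_integral_eq_integral(1)[OF this] show ?thesis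
      by (simp add: psi_kernel_def[abs_def])
  qed
  have Hint: "H t integrable_on {0..1}" if "t \<ge> a" for t
  proof (cases "t = a")
    case True
    have "\<sigma> t r = a" for r using g[of a] by (simp add: \<sigma>_def True D_def)
    then have "H t = (\<lambda>r. (1 - r) powr (\<mu> - 1) *\<^sub>R G t a)" by (simp add: H_def fun_eq_iff)
    then show ?thesis using integrable_on_scaleR_left[OF P] by simp
  qed (use main that in auto)
  have lint: "(LINT s:{a..t}|lborel. psi_kernel \<psi> \<psi>' \<mu> t s *\<^sub>R G t s) = D t powr \<mu> *\<^sub>R integral {0..1} (H t)" if "t \<ge> a" for t
  proof (cases "t = a")
    case True
    have "set_integrable lborel {a..t} (\<lambda>s. psi_kernel \<psi> \<psi>' \<mu> t s *\<^sub>R G t s)"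
      by (rule kernel_cont_integrable[OF assms(1) G1])
    from set_borel_integral_eq_integral(2)[OF this] show ?thesis
      by (simp add: True D_def)
  qed (use main that in auto)
  have "continuous_on {a..} (\<lambda>t. integral {0..1} (H t))"
  proof (rule continuous_on_sequentiallyI)
    fix u t assume u: "\<forall>n. u n \<in> {a..}" "t \<in> {a..}" "u \<longlonglongrightarrow> t"
    then obtain T where T: "\<And>n. u n \<le> T"
      using convergent_imp_Bseq[of u] by (auto simp: convergent_def Bseq_def abs_le_iff)
    have tT: "t \<le> T" using LIMSEQ_le_const2[OF u(3)] T by auto
    \<comment> \<open>All pairs \<open>(u n, s)\<close> stay in this compact triangle, where G is
      bounded; the bound gives the dominating function.\<close>
    define S where "S = {(t, s). a \<le> s \<and> s \<le> t \<and> t \<le> T}"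
    have "S = ({a..T} \<times> {a..T}) \<inter> {z. snd z \<le> fst z}" by (auto simp: S_def)
    then have "compact S"
      by (auto intro!: compact_Int_closed compact_Times closed_Collect_le continuous_intros)
    then have "bounded ((\<lambda>(t, s). G t s) ` S)"
      by (intro compact_imp_bounded compact_continuous_image continuous_on_subset[OF G]) (auto simp: S_def)
    then obtain B where B: "\<And>t s. (t, s) \<in> S \<Longrightarrow> norm (G t s) \<le> B"
      unfolding bounded_iff by fast
    have gc: "continuous_on (\<psi> ` {a..T}) g"
      by (rule continuous_on_inv[OF continuous_on_subset[OF cont]]) (auto simp: g)
    show "(\<lambda>n. integral {0..1} (H (u n))) \<longlonglongrightarrow> integral {0..1} (H t)"
    proof (rule dominated_convergence)
      show "H (u n) integrable_on {0..1}" for n using Hint u by auto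
      show "(\<lambda>r. (1 - r) powr (\<mu> - 1) *\<^sub>R B) integrable_on {0..1}"
        using integrable_on_scaleR_left[OF P] .
      show "norm (H (u n) r) \<le> (1 - r) powr (\<mu> - 1) *\<^sub>R B" if "r \<in> {0..1}" for n r
        using B[of "u n" "\<sigma> (u n) r"] s_mem[of "u n" r] T[of n] u that
        by (auto simp: H_def S_def intro!: mult_left_mono)
      show "(\<lambda>n. H (u n) r) \<longlonglongrightarrow> H t r" if r: "r \<in> {0..1}" for r
      proof -
        have "\<psi> a + r * D t' \<in> \<psi> ` {a..T}" if "a \<le> t'" "t' \<le> T" for t'
          using mem[OF that(1) r] that by auto
        moreover have "(\<lambda>n. \<psi> (u n)) \<longlonglongrightarrow> \<psi> t"
          using continuous_on_tendsto_compose[OF cont u(3)] u by simp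
        ultimately have "(\<lambda>n. \<sigma> (u n) r) \<longlonglongrightarrow> \<sigma> t r"
          unfolding \<sigma>_def using u T tT
          by (intro continuous_on_tendsto_compose[OF gc]) (auto simp: D_def intro!: tendsto_intros always_eventually)
        then have "(\<lambda>n. (u n, \<sigma> (u n) r)) \<longlonglongrightarrow> (t, \<sigma> t r)"
          using u by (intro tendsto_Pair) auto
        from continuous_on_tendsto_compose[OF G this] show ?thesis
          unfolding H_def using u s_mem[OF _ r] by (auto intro!: tendsto_intros)
      qed
    qed
  qed
  then have "continuous_on {a..} (\<lambda>t. D t powr \<mu> *\<^sub>R integral {0..1} (H t))"
    using assms(1) D0 unfolding D_def by (intro continuous_intros continuous_on_powr' cont) auto
  then show ?thesis
    by (rule continuous_on_eq) (simp add: lint)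
qed

end

subsection \<open>The semigroup property\<close>

context psi_setup
begin

text \<open>Fubini on the triangle a \<le> s \<le> \<tau> \<le> t: for fixed s the integral over
  \<tau> is a Beta integral based at s. Since \<mu> + \<nu> \<ge> 1, the resulting power of \<psi> t
  - \<psi> s is bounded, so integrability of \<psi>' \<phi> alone justifies the exchange at every
  t.\<close>

lemma kernel_semigroup:
  fixes \<phi> :: "real \<Rightarrow> 'b::{banach,second_countable_topology}"
  assumes pos: "\<mu> > 0" "\<nu> > 0" "\<mu> + \<nu> \<ge> 1" and "t \<ge> a"
    and \<phi>: "set_integrable lborel {a..t} (\<lambda>s. \<psi>' s *\<^sub>R \<phi> s)"
  shows "set_integrable lborel {a..t} (\<lambda>s. psi_kernel \<psi> \<psi>' (\<mu> + \<nu>) t s *\<^sub>R \<phi> s)"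
    and "set_integrable lborel {a..t}
      (\<lambda>\<tau>. psi_kernel \<psi> \<psi>' \<mu> t \<tau> *\<^sub>R (LINT s:{a..\<tau>}|lborel. psi_kernel \<psi> \<psi>' \<nu> \<tau> s *\<^sub>R \<phi> s))"
    and "(LINT \<tau>:{a..t}|lborel. psi_kernel \<psi> \<psi>' \<mu> t \<tau> *\<^sub>R
        (LINT s:{a..\<tau>}|lborel. psi_kernel \<psi> \<psi>' \<nu> \<tau> s *\<^sub>R \<phi> s))
      = Beta \<mu> \<nu> *\<^sub>R (LINT s:{a..t}|lborel. psi_kernel \<psi> \<psi>' (\<mu> + \<nu>) t s *\<^sub>R \<phi> s)"
proof -
  define p where "p = (\<lambda>s. indicator {a..t} s *\<^sub>R \<psi>' s *\<^sub>R \<phi> s)"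
  \<comment> \<open>Constant extension to the left of \<open>a\<close> gives continuous functions on
    the whole line, which makes k jointly Borel measurable. The factor \<open>\<psi>' s\<close> sits
    in p, so k carries \<psi>' only at \<tau>.\<close>
  define \<psi>c where "\<psi>c = (\<lambda>s. \<psi> (max a s))"
  define dc where "dc = (\<lambda>s. \<psi>' (max a s))"
  define k where "k = (\<lambda>s \<tau>. if a \<le> s \<and> s \<le> \<tau> \<and> \<tau> \<le> t
    then dc \<tau> * (\<psi>c t - \<psi>c \<tau>) powr (\<mu> - 1) * (\<psi>c \<tau> - \<psi>c s) powr (\<nu> - 1) else 0)"
  define P where "P = (\<lambda>s. indicator {a..t} s * (\<psi> t - \<psi> s) powr (\<mu> + \<nu> - 1))"
  have p: "integrable lborel p"
    using \<phi> by (simp add: set_integrable_def p_def)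
  have [measurable]: "p \<in> borel_measurable borel"
    using borel_measurable_integrable[OF p] by simp
  have [measurable]: "\<psi>c \<in> borel_measurable borel" "dc \<in> borel_measurable borel"
    unfolding \<psi>c_def dc_def
    by (auto intro!: borel_measurable_continuous_onI continuous_on_compose2[OF cont]
        continuous_on_compose2[OF cont'] continuous_intros)
  have k_nn: "k s \<tau> \<ge> 0" for s \<tau>
    using deriv_pos[of \<tau>] by (auto simp: k_def dc_def)
  have k1: "integrable lborel (k s)" "integral\<^sup>L lborel (k s) = Beta \<nu> \<mu> * (\<psi> t - \<psi> s) powr (\<mu> + \<nu> - 1)"
    if s: "s \<in> {a..t}" for s
  proof -
    interpret s: psi_setup s \<psi> \<psi>' by (rule psi_setup_from) (use s in auto)
    have "k s = (\<lambda>\<tau>. indicator {s..t} \<tau> *\<^sub>R (psi_kernel \<psi> \<psi>' \<mu> t \<tau> * (\<psi> \<tau> - \<psi> s) powr (\<nu> - 1)))"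
      using s by (auto simp: fun_eq_iff k_def psi_kernel_def indicator_def \<psi>c_def dc_def max_def)
    then show "integrable lborel (k s)" "integral\<^sup>L lborel (k s) = Beta \<nu> \<mu> * (\<psi> t - \<psi> s) powr (\<mu> + \<nu> - 1)"
      using s.kernel_power_integral[of t \<mu> \<nu>] pos s
      by (simp_all add: set_integrable_def set_lebesgue_integral_def)
  qed
  have p0: "p s = 0" if "s \<notin> {a..t}" for s using that by (simp add: p_def)
  have int_kp: "(\<integral>\<tau>. k s \<tau> *\<^sub>R p s \<partial>lborel) = Beta \<nu> \<mu> *\<^sub>R P s *\<^sub>R p s" for s
    by (cases "s \<in> {a..t}") (use k1[of s] in \<open>auto simp: p0 P_def\<close>)
  have P_bd: "\<bar>P s\<bar> \<le> (\<psi> t - \<psi> a) powr (\<mu> + \<nu> - 1)" for s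
    using pos by (auto simp: P_def indicator_def psi_le_iff intro!: powr_mono2)
  have P_eq: "P = (\<lambda>s. if a \<le> s \<and> s \<le> t then (\<psi> t - \<psi>c s) powr (\<mu> + \<nu> - 1) else 0)"
    by (auto simp: P_def fun_eq_iff indicator_def \<psi>c_def max_def)
  have [measurable]: "P \<in> borel_measurable borel"
    unfolding P_eq by measurable
  have Pp: "integrable lborel (\<lambda>s. P s *\<^sub>R p s)"
  proof (rule Bochner_Integration.integrable_bound)
    show "integrable lborel (\<lambda>s. (\<psi> t - \<psi> a) powr (\<mu> + \<nu> - 1) *\<^sub>R p s)"
      using p by auto
    show "AE s in lborel. norm (P s *\<^sub>R p s) \<le> norm ((\<psi> t - \<psi> a) powr (\<mu> + \<nu> - 1) *\<^sub>R p s)"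
      using P_bd by (auto intro!: AE_I2 mult_right_mono)
  qed simp
  have P_p: "P s *\<^sub>R p s = indicator {a..t} s *\<^sub>R psi_kernel \<psi> \<psi>' (\<mu> + \<nu>) t s *\<^sub>R \<phi> s" for s
    by (auto simp: P_def p_def psi_kernel_def indicator_def)
  show I: "set_integrable lborel {a..t} (\<lambda>s. psi_kernel \<psi> \<psi>' (\<mu> + \<nu>) t s *\<^sub>R \<phi> s)"
    using Pp by (simp add: P_p set_integrable_def)
  have "integrable (lborel \<Otimes>\<^sub>M lborel) (\<lambda>(s, \<tau>). k s \<tau> *\<^sub>R p s)"
  proof (rule lborel_pair.Fubini_integrable)
    show "(\<lambda>(s, \<tau>). k s \<tau> *\<^sub>R p s) \<in> borel_measurable (lborel \<Otimes>\<^sub>M lborel)"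
      unfolding k_def by measurable
    have "(\<integral>\<tau>. norm (k s \<tau> *\<^sub>R p s) \<partial>lborel) = Beta \<nu> \<mu> *\<^sub>R norm (P s *\<^sub>R p s)" for s
    proof (cases "s \<in> {a..t}")
      case True
      have "(\<integral>\<tau>. norm (k s \<tau> *\<^sub>R p s) \<partial>lborel) = (\<integral>\<tau>. k s \<tau> * norm (p s) \<partial>lborel)"
        using k_nn by simp
      then show ?thesis using k1[OF True] True by (simp add: P_def)
    qed (simp add: p0)
    then show "integrable lborel (\<lambda>s. \<integral>\<tau>. norm (case (s, \<tau>) of (s, \<tau>) \<Rightarrow> k s \<tau> *\<^sub>R p s) \<partial>lborel)"
      using integrable_norm[OF Pp] by (simp only: prod.case) auto
    show "AE s in lborel. integrable lborel (\<lambda>\<tau>. case (s, \<tau>) of (s, \<tau>) \<Rightarrow> k s \<tau> *\<^sub>R p s)"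
    proof (intro AE_I2)
      show "integrable lborel (\<lambda>\<tau>. case (s, \<tau>) of (s, \<tau>) \<Rightarrow> k s \<tau> *\<^sub>R p s)" for s
        by (cases "s \<in> {a..t}") (use k1[of s] in \<open>auto simp: p0\<close>)
    qed
  qed
  note fubini = lborel_pair.integrable_snd[OF this] lborel_pair.Fubini_integral[OF this]
  have sec: "(\<integral>s. k s \<tau> *\<^sub>R p s \<partial>lborel) = indicator {a..t} \<tau> *\<^sub>R psi_kernel \<psi> \<psi>' \<mu> t \<tau> *\<^sub>R
        (LINT s:{a..\<tau>}|lborel. psi_kernel \<psi> \<psi>' \<nu> \<tau> s *\<^sub>R \<phi> s)" for \<tau>
  proof -
    let ?q = "\<lambda>s. indicator {a..\<tau>} s *\<^sub>R psi_kernel \<psi> \<psi>' \<nu> \<tau> s *\<^sub>R \<phi> s"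
    have "(\<lambda>s. k s \<tau> *\<^sub>R p s) = (\<lambda>s. (indicator {a..t} \<tau> * psi_kernel \<psi> \<psi>' \<mu> t \<tau>) *\<^sub>R ?q s)"
      by (auto simp: fun_eq_iff k_def p_def psi_kernel_def indicator_def \<psi>c_def dc_def max_def)
    then have "(\<integral>s. k s \<tau> *\<^sub>R p s \<partial>lborel) = (indicator {a..t} \<tau> * psi_kernel \<psi> \<psi>' \<mu> t \<tau>) *\<^sub>R integral\<^sup>L lborel ?q"
      by (simp only: integral_scaleR_right)
    then show ?thesis by (simp only: set_lebesgue_integral_def scaleR_scaleR)
  qed
  show "set_integrable lborel {a..t}
      (\<lambda>\<tau>. psi_kernel \<psi> \<psi>' \<mu> t \<tau> *\<^sub>R (LINT s:{a..\<tau>}|lborel. psi_kernel \<psi> \<psi>' \<nu> \<tau> s *\<^sub>R \<phi> s))"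
    using fubini(1) unfolding set_integrable_def sec .
  show "(LINT \<tau>:{a..t}|lborel. psi_kernel \<psi> \<psi>' \<mu> t \<tau> *\<^sub>R
        (LINT s:{a..\<tau>}|lborel. psi_kernel \<psi> \<psi>' \<nu> \<tau> s *\<^sub>R \<phi> s))
      = Beta \<mu> \<nu> *\<^sub>R (LINT s:{a..t}|lborel. psi_kernel \<psi> \<psi>' (\<mu> + \<nu>) t s *\<^sub>R \<phi> s)"
    using fubini(2) unfolding sec int_kp P_p integral_scaleR_right
    by (simp only: set_lebesgue_integral_def Beta_commute[of \<mu>])
qed

text \<open>The Beta factor of \<open>kernel_semigroup\<close> is exactly what the three Gamma
  normalisations absorb.\<close>

lemma RL_semigroup:
  fixes \<phi> :: "real \<Rightarrow> real ^ 'n::finite"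
  assumes pos: "\<mu> > 0" "\<nu> \<ge> 0" "\<mu> + \<nu> \<ge> 1" and "t \<ge> a"
    and \<phi>: "set_integrable lborel {a..t} (\<lambda>s. \<psi>' s *\<^sub>R \<phi> s)"
  shows "\<nu> > 0 \<or> \<mu> > 1 \<Longrightarrow> psi_RL_exists a \<mu> \<psi> \<psi>' (psi_RL_integral a \<nu> \<psi> \<psi>' \<phi>) t"
    and "psi_RL_integral a \<mu> \<psi> \<psi>' (psi_RL_integral a \<nu> \<psi> \<psi>' \<phi>) t = psi_RL_integral a (\<mu> + \<nu>) \<psi> \<psi>' \<phi> t"
proof -
  have eq: "psi_kernel \<psi> \<psi>' \<mu> t s *\<^sub>R psi_RL_integral a \<nu> \<psi> \<psi>' \<phi> s
        = (1 / Gamma \<nu>) *\<^sub>R (psi_kernel \<psi> \<psi>' \<mu> t s *\<^sub>R (LINT r:{a..s}|lborel. psi_kernel \<psi> \<psi>' \<nu> s r *\<^sub>R \<phi> r))" if "\<nu> \<noteq> 0" for s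
    using that by (simp add: psi_RL_integral_def)
  show "psi_RL_exists a \<mu> \<psi> \<psi>' (psi_RL_integral a \<nu> \<psi> \<psi>' \<phi>) t" if e: "\<nu> > 0 \<or> \<mu> > 1"
  proof (cases "\<nu> = 0")
    case True
    \<comment> \<open>For \<nu> = 0 there is no double integral; splitting the order as 1 + (\<mu> -
      1) gives existence by boundedness of the kernel.\<close>
    have "set_integrable lborel {a..t} (\<lambda>s. psi_kernel \<psi> \<psi>' \<mu> t s *\<^sub>R \<phi> s)"
      using kernel_semigroup(1)[of 1 "\<mu> - 1" t \<phi>] assms(4,5) e True by simp
    then show ?thesis by (simp add: psi_RL_exists_def psi_RL_integral_def True)
  next
    case False
    from False show ?thesis
      using set_integrable_scaleR_right[OF kernel_semigroup(2)[of \<mu> \<nu> t \<phi>], of "1 / Gamma \<nu>"] assms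
      unfolding psi_RL_exists_def eq[OF False] by simp
  qed
  show "psi_RL_integral a \<mu> \<psi> \<psi>' (psi_RL_integral a \<nu> \<psi> \<psi>' \<phi>) t = psi_RL_integral a (\<mu> + \<nu>) \<psi> \<psi>' \<phi> t"
  proof (cases "\<nu> = 0")
    case True
    then have "psi_RL_integral a \<nu> \<psi> \<psi>' \<phi> = \<phi>"
      by (simp add: psi_RL_integral_def fun_eq_iff)
    then show ?thesis by (simp add: True)
  next
    case False
    have "Gamma \<mu> \<noteq> 0" "Gamma \<nu> \<noteq> 0" "Gamma (\<mu> + \<nu>) \<noteq> 0"
      using pos False by (auto simp: Gamma_eq_zero_iff elim!: nonpos_Ints_cases)
    then show ?thesis
      using kernel_semigroup(3)[of \<mu> \<nu> t \<phi>] assms False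
      unfolding psi_RL_integral_def[of a \<mu>] eq[OF False] set_integral_scaleR_right
      by (simp add: psi_RL_integral_def Beta_def)
  qed
qed

end

subsection \<open>Fractional integrals\<close>

context psi_setup
begin

text \<open>The value at \<open>a\<close> is ignored because power functions such as \<open>(\<psi>(s) - \<psi>(a)) powr 0\<close> have
  the junk value \<open>0\<close> there.\<close>

lemma RL_cong:
  fixes g h :: "real \<Rightarrow> real ^ 'n::finite"
  assumes "\<And>s. a < s \<Longrightarrow> s \<le> t \<Longrightarrow> g s = h s" "t > a"
  shows "psi_RL_exists a \<mu> \<psi> \<psi>' g t \<longleftrightarrow> psi_RL_exists a \<mu> \<psi> \<psi>' h t"
    and "psi_RL_integral a \<mu> \<psi> \<psi>' g t = psi_RL_integral a \<mu> \<psi> \<psi>' h t"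
proof -
  let ?f = "\<lambda>y s. psi_kernel \<psi> \<psi>' \<mu> t s *\<^sub>R y s"
  have *: "indicator {a..t} s *\<^sub>R ?f g s = indicator {a..t} s *\<^sub>R ?f h s" if "s \<noteq> a" for s
    using assms that by (auto simp: indicator_def)
  have "integrable lborel (\<lambda>s. indicator {a..t} s *\<^sub>R ?f g s) \<longleftrightarrow> integrable lborel (\<lambda>s. indicator {a..t} s *\<^sub>R ?f h s)"
    by (rule integrable_discrete_difference[of "{a}"]) (use * in auto)
  then show "psi_RL_exists a \<mu> \<psi> \<psi>' g t \<longleftrightarrow> psi_RL_exists a \<mu> \<psi> \<psi>' h t"
    by (simp add: psi_RL_exists_def set_integrable_def)
  have "integral\<^sup>L lborel (\<lambda>s. indicator {a..t} s *\<^sub>R ?f g s) = integral\<^sup>L lborel (\<lambda>s. indicator {a..t} s *\<^sub>R ?f h s)"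
    by (rule integral_discrete_difference[of "{a}"]) (use * in auto)
  then show "psi_RL_integral a \<mu> \<psi> \<psi>' g t = psi_RL_integral a \<mu> \<psi> \<psi>' h t"
    using assms by (simp add: psi_RL_integral_def set_lebesgue_integral_def)
qed

lemma RL_add:
  assumes "psi_RL_exists a \<mu> \<psi> \<psi>' g t" "psi_RL_exists a \<mu> \<psi> \<psi>' h t"
  shows "psi_RL_exists a \<mu> \<psi> \<psi>' (\<lambda>s. g s + h s) t"
    and "psi_RL_integral a \<mu> \<psi> \<psi>' (\<lambda>s. g s + h s) t = psi_RL_integral a \<mu> \<psi> \<psi>' g t + psi_RL_integral a \<mu> \<psi> \<psi>' h t"
  using assms set_integral_add[of lborel "{a..t}" "\<lambda>s. psi_kernel \<psi> \<psi>' \<mu> t s *\<^sub>R g s" "\<lambda>s. psi_kernel \<psi> \<psi>' \<mu> t s *\<^sub>R h s"]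
  by (auto simp: psi_RL_exists_def psi_RL_integral_def scaleR_add_right)

lemma RL_diff:
  assumes "psi_RL_exists a \<mu> \<psi> \<psi>' g t" "psi_RL_exists a \<mu> \<psi> \<psi>' h t"
  shows "psi_RL_exists a \<mu> \<psi> \<psi>' (\<lambda>s. g s - h s) t"
    and "psi_RL_integral a \<mu> \<psi> \<psi>' (\<lambda>s. g s - h s) t = psi_RL_integral a \<mu> \<psi> \<psi>' g t - psi_RL_integral a \<mu> \<psi> \<psi>' h t"
  using assms set_integral_diff[of lborel "{a..t}" "\<lambda>s. psi_kernel \<psi> \<psi>' \<mu> t s *\<^sub>R g s" "\<lambda>s. psi_kernel \<psi> \<psi>' \<mu> t s *\<^sub>R h s"]
  by (auto simp: psi_RL_exists_def psi_RL_integral_def scaleR_diff_right)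

lemma RL_zero [simp]: "psi_RL_exists a \<mu> \<psi> \<psi>' (\<lambda>s. 0) t" "psi_RL_integral a \<mu> \<psi> \<psi>' (\<lambda>s. 0) t = 0"
  by (simp_all add: psi_RL_exists_def psi_RL_integral_def set_integrable_def)

lemma RL_exists_cont:
  "\<mu> \<ge> 0 \<Longrightarrow> continuous_on {a..} g \<Longrightarrow> psi_RL_exists a \<mu> \<psi> \<psi>' g t"
  using kernel_cont_integrable[of \<mu> t g] continuous_on_subset[of "{a..}" g "{a..t}"]
  by (cases "\<mu> = 0") (auto simp: psi_RL_exists_def)

lemma RL_continuous:
  fixes G :: "real \<Rightarrow> real \<Rightarrow> real ^ 'n::finite"
  assumes "\<mu> > 0" "continuous_on {(t, s). a \<le> s \<and> s \<le> t} (\<lambda>(t, s). G t s)"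
  shows "continuous_on {a..} (\<lambda>t. psi_RL_integral a \<mu> \<psi> \<psi>' (G t) t)"
  unfolding psi_RL_integral_def
  using assms(1) kernel_integral_continuous[OF assms] by (auto intro!: continuous_intros)

lemma RL_continuous1:
  fixes g :: "real \<Rightarrow> real ^ 'n::finite"
  assumes "\<mu> \<ge> 0" and g: "continuous_on {a..} g"
  shows "continuous_on {a..} (psi_RL_integral a \<mu> \<psi> \<psi>' g)"
proof (cases "\<mu> = 0")
  case True
  then show ?thesis using g by (simp add: psi_RL_integral_def[abs_def])
next
  case False
  have "continuous_on {(t, s). a \<le> s \<and> s \<le> t} (g \<circ> snd)"
    by (intro continuous_on_compose continuous_intros continuous_on_subset[OF g]) auto
  then show ?thesis
    using RL_continuous[of \<mu> "\<lambda>_. g"] False assms(1)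
    by (simp add: case_prod_unfold o_def)
qed

lemma RL_at_start:
  fixes g :: "real \<Rightarrow> real ^ 'n::finite"
  assumes "\<mu> > 0" shows "psi_RL_integral a \<mu> \<psi> \<psi>' g a = 0"
proof -
  have "AE s in lborel. indicator {a..a} s *\<^sub>R psi_kernel \<psi> \<psi>' \<mu> a s *\<^sub>R g s = 0"
    using AE_lborel_singleton[of a] by eventually_elim auto
  then have "(LINT s:{a..a}|lborel. psi_kernel \<psi> \<psi>' \<mu> a s *\<^sub>R g s) = 0"
    unfolding set_lebesgue_integral_def by (rule integral_eq_zero_AE)
  then show ?thesis using assms by (simp add: psi_RL_integral_def)
qed

text \<open>Writing the exponent as q - 1 with q > 0 admits powers that blow up at \<open>a\<close>;
  exponent -\<eta> occurs in \<open>Hilfer_RL_power_sum\<close>.\<close>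

lemma RL_power:
  fixes c :: "real ^ 'n::finite"
  assumes "\<mu> \<ge> 0" "q > 0" "t > a"
  shows "psi_RL_exists a \<mu> \<psi> \<psi>' (\<lambda>s. (\<psi> s - \<psi> a) powr (q - 1) *\<^sub>R c) t"
    and "psi_RL_integral a \<mu> \<psi> \<psi>' (\<lambda>s. (\<psi> s - \<psi> a) powr (q - 1) *\<^sub>R c) t
       = (Gamma q / Gamma (q + \<mu>) * (\<psi> t - \<psi> a) powr (q + \<mu> - 1)) *\<^sub>R c"
proof -
  have G: "Gamma q > 0" using assms by (auto intro: Gamma_real_pos)
  have "psi_RL_exists a \<mu> \<psi> \<psi>' (\<lambda>s. (\<psi> s - \<psi> a) powr (q - 1) *\<^sub>R c) t \<and>
      psi_RL_integral a \<mu> \<psi> \<psi>' (\<lambda>s. (\<psi> s - \<psi> a) powr (q - 1) *\<^sub>R c) t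
       = (Gamma q / Gamma (q + \<mu>) * (\<psi> t - \<psi> a) powr (q + \<mu> - 1)) *\<^sub>R c"
  proof (cases "\<mu> = 0")
    case True
    then show ?thesis using G by (simp add: psi_RL_exists_def psi_RL_integral_def)
  next
    case False
    then have mu: "\<mu> > 0" using assms by simp
    then have Gm: "Gamma \<mu> \<noteq> 0" using Gamma_real_pos less_imp_neq by metis
    note K = kernel_power_integral[OF less_imp_le[OF assms(3)] mu assms(2)]
    have "set_integrable lborel {a..t} (\<lambda>s. (psi_kernel \<psi> \<psi>' \<mu> t s * (\<psi> s - \<psi> a) powr (q - 1)) *\<^sub>R c)"
      using K(1) by (rule set_integrable_scaleR_left)
    moreover have "(LINT s:{a..t}|lborel. (psi_kernel \<psi> \<psi>' \<mu> t s * (\<psi> s - \<psi> a) powr (q - 1)) *\<^sub>R c)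
        = (Beta q \<mu> * (\<psi> t - \<psi> a) powr (\<mu> + q - 1)) *\<^sub>R c"
      using integral_scaleR_left[of c lborel "\<lambda>s. indicator {a..t} s *\<^sub>R (psi_kernel \<psi> \<psi>' \<mu> t s * (\<psi> s - \<psi> a) powr (q - 1))"] K
      unfolding set_lebesgue_integral_def set_integrable_def by simp
    ultimately show ?thesis
      using mu Gm unfolding psi_RL_exists_def psi_RL_integral_def scaleR_scaleR
      by (simp add: Beta_def add.commute)
  qed
  then show "psi_RL_exists a \<mu> \<psi> \<psi>' (\<lambda>s. (\<psi> s - \<psi> a) powr (q - 1) *\<^sub>R c) t"
    and "psi_RL_integral a \<mu> \<psi> \<psi>' (\<lambda>s. (\<psi> s - \<psi> a) powr (q - 1) *\<^sub>R c) t
       = (Gamma q / Gamma (q + \<mu>) * (\<psi> t - \<psi> a) powr (q + \<mu> - 1)) *\<^sub>R c" by auto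
qed

lemma RL_power_sum:
  fixes c :: "'i \<Rightarrow> real ^ 'n::finite"
  assumes "finite A" "\<mu> \<ge> 0" "\<And>i. i \<in> A \<Longrightarrow> q i > 0" "t > a"
  shows "psi_RL_exists a \<mu> \<psi> \<psi>' (\<lambda>s. \<Sum>i\<in>A. (\<psi> s - \<psi> a) powr (q i - 1) *\<^sub>R c i) t \<and>
    psi_RL_integral a \<mu> \<psi> \<psi>' (\<lambda>s. \<Sum>i\<in>A. (\<psi> s - \<psi> a) powr (q i - 1) *\<^sub>R c i) t
       = (\<Sum>i\<in>A. (Gamma (q i) / Gamma (q i + \<mu>) * (\<psi> t - \<psi> a) powr (q i + \<mu> - 1)) *\<^sub>R c i)"
  using assms(1,3)
proof (induction rule: finite_induct)
  case (insert i A)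
  then show ?case
    using RL_power[OF assms(2) _ assms(4), of "q i" "c i"]
      RL_add[of \<mu> "\<lambda>s. (\<psi> s - \<psi> a) powr (q i - 1) *\<^sub>R c i" t "\<lambda>s. \<Sum>i\<in>A. (\<psi> s - \<psi> a) powr (q i - 1) *\<^sub>R c i"]
    by simp
qed simp

text \<open>The factor is the fractional integral of the constant 1. The bound is asked for on (a,
  t] only, since that is where the derivatives of the approximants converge uniformly.\<close>

lemma RL_diff_bound:
  fixes g h :: "real \<Rightarrow> real ^ 'n::finite"
  assumes "\<mu> > 0" "t > a" and ex: "psi_RL_exists a \<mu> \<psi> \<psi>' g t" "psi_RL_exists a \<mu> \<psi> \<psi>' h t"
    and bound: "\<And>s. a < s \<Longrightarrow> s \<le> t \<Longrightarrow> norm (g s - h s) \<le> \<epsilon>"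
  shows "norm (psi_RL_integral a \<mu> \<psi> \<psi>' g t - psi_RL_integral a \<mu> \<psi> \<psi>' h t)
      \<le> \<epsilon> * ((\<psi> t - \<psi> a) powr \<mu> / Gamma (\<mu> + 1))"
proof -
  define F where "F = (\<lambda>s. indicator {a..t} s *\<^sub>R psi_kernel \<psi> \<psi>' \<mu> t s *\<^sub>R (g s - h s))"
  \<comment> \<open>The power with exponent 1 - 1 is the constant 1 in the form of
    \<open>kernel_power_integral\<close>; at s = a it is 0, a null set that is removed
    below.\<close>
  define k where "k = (\<lambda>s. indicator {a..t} s *\<^sub>R (psi_kernel \<psi> \<psi>' \<mu> t s * (\<psi> s - \<psi> a) powr (1 - 1)))"
  have Gm: "Gamma \<mu> > 0" using assms(1) by (rule Gamma_real_pos)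
  note K = kernel_power_integral[OF less_imp_le[OF assms(2)] assms(1) zero_less_one, unfolded set_integrable_def set_lebesgue_integral_def, folded k_def]
  have F: "integrable lborel F"
    using RL_diff(1)[OF ex] assms(1) by (auto simp: psi_RL_exists_def F_def set_integrable_def)
  have "norm (integral\<^sup>L lborel F) \<le> (\<integral>s. norm (F s) \<partial>lborel)" by (rule integral_norm_bound)
  also have "\<dots> \<le> (\<integral>s. \<epsilon> * k s \<partial>lborel)"
  proof (rule integral_mono_AE)
    show "AE s in lborel. norm (F s) \<le> \<epsilon> * k s"
      using AE_lborel_singleton[of a]
    proof eventually_elim
      case (elim s)
      show ?case
      proof (cases "s \<in> {a..t}")
        case True
        then have s: "a < s" "s \<le> t" using elim by auto
        have "psi_kernel \<psi> \<psi>' \<mu> t s * norm (g s - h s) \<le> psi_kernel \<psi> \<psi>' \<mu> t s * \<epsilon>"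
          using bound[OF s] kernel_nonneg[of s] s by (intro mult_left_mono) auto
        then show ?thesis
          using s psi_less[of a s] kernel_nonneg[of s \<mu> t] by (simp add: F_def k_def mult.commute)
      qed (simp add: F_def k_def)
    qed
  qed (use F K in auto)
  also have "\<dots> = \<epsilon> * (Beta 1 \<mu> * (\<psi> t - \<psi> a) powr \<mu>)" using K by simp
  finally have "norm (integral\<^sup>L lborel F) / Gamma \<mu> \<le> \<epsilon> * (Beta 1 \<mu> * (\<psi> t - \<psi> a) powr \<mu>) / Gamma \<mu>"
    using Gm by (intro divide_right_mono) auto
  also have "\<dots> = \<epsilon> * ((\<psi> t - \<psi> a) powr \<mu> / Gamma (\<mu> + 1))"
    using Gm by (simp add: Beta_def add.commute)
  also have "norm (integral\<^sup>L lborel F) / Gamma \<mu> = norm (psi_RL_integral a \<mu> \<psi> \<psi>' g t - psi_RL_integral a \<mu> \<psi> \<psi>' h t)"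
    unfolding RL_diff(2)[OF ex, symmetric]
    using assms(1) Gm by (simp add: psi_RL_integral_def F_def set_lebesgue_integral_def)
  finally show ?thesis .
qed

text \<open>The kernel of order 1 is \<psi>' except at s = t, where \<open>0 powr 0\<close> is 0;
  one point does not change the integral.\<close>

lemma RL_1:
  fixes g :: "real \<Rightarrow> real ^ 'n::finite"
  assumes "t \<ge> a"
  shows "psi_RL_integral a 1 \<psi> \<psi>' g t = (LINT s:{a..t}|lborel. \<psi>' s *\<^sub>R g s)"
proof -
  have "(LINT s:{a..t}|lborel. psi_kernel \<psi> \<psi>' 1 t s *\<^sub>R g s) = (LINT s:{a..t}|lborel. \<psi>' s *\<^sub>R g s)"
    unfolding set_lebesgue_integral_def
  proof (rule integral_discrete_difference[of "{t}"])
    fix s assume "s \<notin> {t}"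
    then show "indicator {a..t} s *\<^sub>R psi_kernel \<psi> \<psi>' 1 t s *\<^sub>R g s = indicator {a..t} s *\<^sub>R \<psi>' s *\<^sub>R g s"
      using psi_less[of s t] by (cases "s \<in> {a..t}") (auto simp: psi_kernel_def)
  qed auto
  then show ?thesis by (simp add: psi_RL_integral_def)
qed

lemma deriv_mult_integrable:
  fixes g :: "real \<Rightarrow> real ^ 'n::finite"
  assumes "continuous_on {a..} g"
  shows "set_integrable lborel {a..t} (\<lambda>s. \<psi>' s *\<^sub>R g s)"
  by (intro borel_integrable_atLeastAtMost' continuous_intros continuous_on_subset[OF assms]
      continuous_on_subset[OF cont']) auto

end

subsection \<open>Fractional integrals have a fractional derivative\<close>

lemma vector_polynomial_approximation:
  fixes g :: "real \<Rightarrow> real ^ 'n::finite"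
  assumes "compact S" "continuous_on S g" "e > 0"
  shows "\<exists>n d. \<forall>y\<in>S. norm (g y - (\<Sum>i\<le>n. y ^ i *\<^sub>R d i)) < (e::real)"
proof -
  obtain p where p: "polynomial_function p" "\<And>y. y \<in> S \<Longrightarrow> norm (g y - p y) < e"
    using Stone_Weierstrass_polynomial_function[OF assms] by blast
  have "\<exists>n c. \<forall>y. p y $ j = (\<Sum>i\<le>n. c i * y ^ i)" for j
  proof -
    have "real_polynomial_function ((\<lambda>v. v $ j) \<circ> p)"
      using p(1) bounded_linear_vec_nth unfolding polynomial_function_def by blast
    then show ?thesis by (auto simp: real_polynomial_function_iff_sum fun_eq_iff)
  qed
  then obtain n c where nc: "\<And>j y. p y $ j = (\<Sum>i\<le>n j. c j i * y ^ i)" by metis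
  \<comment> \<open>Each component has its own degree \<open>n j\<close>; its coefficients are
    padded with zeros up to the largest degree.\<close>
  define m where "m = Max (range n)"
  define d where "d = (\<lambda>i. \<chi> j. if i \<le> n j then c j i else 0)"
  have "p y = (\<Sum>i\<le>m. y ^ i *\<^sub>R d i)" for y
  proof (rule vec_eq_iff[THEN iffD2], rule allI)
    fix j
    have "n j \<le> m" by (simp add: m_def)
    then have "(\<Sum>i\<le>m. y ^ i * (if i \<le> n j then c j i else 0)) = (\<Sum>i\<le>n j. c j i * y ^ i)"
      by (intro sum.mono_neutral_cong_right) auto
    then show "p y $ j = (\<Sum>i\<le>m. y ^ i *\<^sub>R d i) $ j"
      by (simp add: nc d_def)
  qed
  then show ?thesis using p(2) by metis
qed


context psi_setup
begin

lemma psi_diff_power_sum: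
  fixes d :: "'i \<Rightarrow> real ^ 'n::finite" and c :: "real ^ 'n"
  assumes "t > a" and h: "\<And>s. s > a \<Longrightarrow> h s = c + (\<Sum>i\<in>A. (\<psi> s - \<psi> a) powr r i *\<^sub>R d i)"
  shows "h differentiable (at t)"
    and "psi_diff \<psi>' h t = (\<Sum>i\<in>A. (\<psi> t - \<psi> a) powr (r i - 1) *\<^sub>R (r i *\<^sub>R d i))"
proof -
  have p: "\<psi> t - \<psi> a > 0" using psi_less[of a t] assms by simp
  have "((\<lambda>s. (\<psi> s - \<psi> a) powr r i) has_real_derivative \<psi>' t * (r i * (\<psi> t - \<psi> a) powr (r i - 1))) (at t)" for i
    by (rule derivative_eq_intros der_at[OF assms(1)] p refl)+ (use p in \<open>auto simp: powr_diff field_simps\<close>)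
  then have "((\<lambda>s. (\<psi> s - \<psi> a) powr r i *\<^sub>R d i) has_vector_derivative
      (\<psi>' t * (r i * (\<psi> t - \<psi> a) powr (r i - 1))) *\<^sub>R d i) (at t)" for i
    unfolding has_real_derivative_iff_has_vector_derivative
    by (rule bounded_linear.has_vector_derivative[OF bounded_linear_scaleR_left])
  then have "((\<lambda>s. \<Sum>i\<in>A. (\<psi> s - \<psi> a) powr r i *\<^sub>R d i) has_vector_derivative
      (\<Sum>i\<in>A. (\<psi>' t * (r i * (\<psi> t - \<psi> a) powr (r i - 1))) *\<^sub>R d i)) (at t)"
    by (intro has_vector_derivative_sum) auto
  from has_vector_derivative_add[OF has_vector_derivative_const this]
  have "((\<lambda>s. c + (\<Sum>i\<in>A. (\<psi> s - \<psi> a) powr r i *\<^sub>R d i)) has_vector_derivative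
      (\<Sum>i\<in>A. (\<psi>' t * (r i * (\<psi> t - \<psi> a) powr (r i - 1))) *\<^sub>R d i)) (at t)"
    by simp
  then have "(h has_vector_derivative (\<Sum>i\<in>A. (\<psi>' t * (r i * (\<psi> t - \<psi> a) powr (r i - 1))) *\<^sub>R d i)) (at t)"
    by (rule has_vector_derivative_transform_within_open[of _ _ _ "{a<..}"]) (use assms in auto)
  then show "h differentiable (at t)" "psi_diff \<psi>' h t = (\<Sum>i\<in>A. (\<psi> t - \<psi> a) powr (r i - 1) *\<^sub>R (r i *\<^sub>R d i))"
    using nz[of t] assms(1)
    by (auto simp: differentiableI_vector psi_diff_def vector_derivative_at scaleR_sum_right mult_ac)
qed

text \<open>With \<theta> = (1 - \<beta>)(1 - \<alpha>) and \<eta> = \<beta>(1 - \<alpha>), the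
  exponent of \<psi> - \<psi>(a) runs from i through i + \<alpha>, i + \<alpha> + \<theta> = i + 1 -
  \<eta> and i - \<eta> back to i, and the Gamma quotients cancel. A nonzero c occurs only for
  \<theta> = 0, where the inner integral leaves it constant and the derivative removes it.\<close>

lemma Hilfer_RL_power_sum:
  fixes d :: "nat \<Rightarrow> real ^ 'n::finite" and c :: "real ^ 'n"  and n :: nat
  assumes "0 < \<alpha>" "\<alpha> \<le> 1" "0 \<le> \<beta>" "\<beta> \<le> 1"
    and c: "c = 0 \<or> (1 - \<beta>) * (1 - \<alpha>) = 0"
  defines "G \<equiv> \<lambda>s. \<Sum>i\<le>n. (\<psi> s - \<psi> a) ^ i *\<^sub>R d i"
  defines "X \<equiv> \<lambda>s. c + psi_RL_integral a \<alpha> \<psi> \<psi>' G s"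
  shows "continuous_on {a..} X" "psi_Hilfer_exists a \<alpha> \<beta> \<psi> \<psi>' X"
    and "t > a \<Longrightarrow> psi_Hilfer a \<alpha> \<beta> \<psi> \<psi>' X t = G t"
proof -
  define \<theta> where "\<theta> = (1 - \<beta>) * (1 - \<alpha>)"
  define \<eta> where "\<eta> = \<beta> * (1 - \<alpha>)"
  have sum1: "\<theta> + \<alpha> = 1 - \<eta>" by (simp add: \<theta>_def \<eta>_def algebra_simps)
  have \<theta>: "\<theta> \<ge> 0" and \<eta>: "\<eta> \<ge> 0" using assms(1-4) by (auto simp: \<theta>_def \<eta>_def)
  have \<eta>1: "\<eta> < 1" using sum1 \<theta> assms(1) by linarith
  define k where "k = (\<lambda>i::nat. Gamma (real i + 1) / Gamma (real i + 1 + \<alpha>))"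
  define m where "m = (\<lambda>i::nat. Gamma (real i + 1) / Gamma (real i + 1 - \<eta> + 1))"
  have G_cont: "continuous_on {a..} G"
    unfolding G_def by (intro continuous_intros cont)
  show X_cont: "continuous_on {a..} X"
    unfolding X_def by (intro continuous_intros RL_continuous1 G_cont) (use assms(1-4) in auto)
  have y: "\<psi> s - \<psi> a > 0" if "s > a" for s using psi_less[of a s] that by simp
  have G: "G s = (\<Sum>i\<le>n. (\<psi> s - \<psi> a) powr (real i + 1 - 1) *\<^sub>R d i)" if "s > a" for s
    using y[OF that] by (simp add: G_def powr_realpow)
  have X: "X s = c + (\<Sum>i\<le>n. (\<psi> s - \<psi> a) powr (real i + 1 + \<alpha> - 1) *\<^sub>R (k i *\<^sub>R d i))" if "s > a" for s
  proof -
    have "psi_RL_integral a \<alpha> \<psi> \<psi>' G s =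
        psi_RL_integral a \<alpha> \<psi> \<psi>' (\<lambda>s. \<Sum>i\<le>n. (\<psi> s - \<psi> a) powr (real i + 1 - 1) *\<^sub>R d i) s"
      by (rule RL_cong(2)[OF _ that]) (rule G)
    then show ?thesis
      using RL_power_sum[of "{..n}" \<alpha> "\<lambda>i. real i + 1" s d] assms(1-4) that
      by (simp add: X_def k_def mult.commute)
  qed
  define h where "h = psi_RL_integral a \<theta> \<psi> \<psi>' X"
  have h: "psi_RL_exists a \<theta> \<psi> \<psi>' X s" 
    "h s = c + (\<Sum>i\<le>n. (\<psi> s - \<psi> a) powr (real i + 1 - \<eta>) *\<^sub>R (m i *\<^sub>R d i))" if s: "s > a" for s
  proof -
    show ex: "psi_RL_exists a \<theta> \<psi> \<psi>' X s" by (rule RL_exists_cont[OF \<theta> X_cont])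
    let ?Y = "\<lambda>s. \<Sum>i\<le>n. (\<psi> s - \<psi> a) powr (real i + 1 + \<alpha> - 1) *\<^sub>R (k i *\<^sub>R d i)"
    have "h s = psi_RL_integral a \<theta> \<psi> \<psi>' (\<lambda>s. c + ?Y s) s"
      unfolding h_def by (rule RL_cong(2)[OF X s])
    also have "\<dots> = c + psi_RL_integral a \<theta> \<psi> \<psi>' ?Y s"
      using c by (auto simp: \<theta>_def psi_RL_integral_def)
    also have "psi_RL_integral a \<theta> \<psi> \<psi>' ?Y s = (\<Sum>i\<le>n. (Gamma (real i + 1 + \<alpha>) / Gamma (real i + 1 + \<alpha> + \<theta>)
        * (\<psi> s - \<psi> a) powr (real i + 1 + \<alpha> + \<theta> - 1)) *\<^sub>R (k i *\<^sub>R d i))"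
      using RL_power_sum[of "{..n}" \<theta> "\<lambda>i. real i + 1 + \<alpha>" s "\<lambda>i. k i *\<^sub>R d i"] \<theta> assms(1-4) s
      by (simp add: add_pos_pos add_nonneg_pos)
    also have "\<dots> = (\<Sum>i\<le>n. (\<psi> s - \<psi> a) powr (real i + 1 - \<eta>) *\<^sub>R (m i *\<^sub>R d i))"
    proof (rule sum.cong[OF refl])
      fix i
      have "Gamma (real i + 1 + \<alpha>) > 0" using assms(1-4) by (intro Gamma_real_pos) auto
      then have "Gamma (real i + 1 + \<alpha>) \<noteq> 0" by (rule less_imp_neq[THEN not_sym])
      moreover have e: "real i + 1 + \<alpha> + \<theta> = real i + 1 - \<eta> + 1" "real i + 1 + \<alpha> + \<theta> - 1 = real i + 1 - \<eta>"
        using sum1 by simp_all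
      ultimately show "(Gamma (real i + 1 + \<alpha>) / Gamma (real i + 1 + \<alpha> + \<theta>)
          * (\<psi> s - \<psi> a) powr (real i + 1 + \<alpha> + \<theta> - 1)) *\<^sub>R (k i *\<^sub>R d i)
          = (\<psi> s - \<psi> a) powr (real i + 1 - \<eta>) *\<^sub>R (m i *\<^sub>R d i)"
        unfolding e(2) unfolding e(1) k_def m_def scaleR_scaleR by simp
    qed
    finally show "h s = c + (\<Sum>i\<le>n. (\<psi> s - \<psi> a) powr (real i + 1 - \<eta>) *\<^sub>R (m i *\<^sub>R d i))" .
  qed
  have dh: "h differentiable (at s)"
    "psi_diff \<psi>' h s = (\<Sum>i\<le>n. (\<psi> s - \<psi> a) powr (real i + 1 - \<eta> - 1) *\<^sub>R ((real i + 1 - \<eta>) *\<^sub>R m i *\<^sub>R d i))"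
    if "s > a" for s
    using psi_diff_power_sum[OF that h(2)] by auto
  let ?P = "\<lambda>s. \<Sum>i\<le>n. (\<psi> s - \<psi> a) powr (real i + 1 - \<eta> - 1) *\<^sub>R ((real i + 1 - \<eta>) *\<^sub>R m i *\<^sub>R d i)"
  have q: "real i + 1 - \<eta> > 0" for i using \<eta>1 by linarith
  have P: "psi_RL_exists a \<eta> \<psi> \<psi>' ?P s" "psi_RL_integral a \<eta> \<psi> \<psi>' ?P s = G s" if s: "s > a" for s
  proof -
    note R = RL_power_sum[of "{..n}" \<eta> "\<lambda>i. real i + 1 - \<eta>" s "\<lambda>i. (real i + 1 - \<eta>) *\<^sub>R m i *\<^sub>R d i", OF _ \<eta> q s]
    show "psi_RL_exists a \<eta> \<psi> \<psi>' ?P s" using R by blast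
    have "psi_RL_integral a \<eta> \<psi> \<psi>' ?P s = (\<Sum>i\<le>n. (Gamma (real i + 1 - \<eta>) / Gamma (real i + 1 - \<eta> + \<eta>)
        * (\<psi> s - \<psi> a) powr (real i + 1 - \<eta> + \<eta> - 1)) *\<^sub>R ((real i + 1 - \<eta>) *\<^sub>R m i *\<^sub>R d i))" using R by blast
    also have "\<dots> = (\<Sum>i\<le>n. (\<psi> s - \<psi> a) powr (real i + 1 - 1) *\<^sub>R d i)"
    proof (rule sum.cong[OF refl])
      fix i
      have "Gamma (real i + 1 - \<eta> + 1) = (real i + 1 - \<eta>) * Gamma (real i + 1 - \<eta>)"
        using q[of i] by (intro Gamma_plus1) (auto elim!: nonpos_Ints_cases)
      moreover have "Gamma (real i + 1 - \<eta>) > 0" "Gamma (real i + 1) > 0"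
        using q[of i] by (auto intro!: Gamma_real_pos)
      then have "Gamma (real i + 1 - \<eta>) \<noteq> 0" "Gamma (real i + 1) \<noteq> 0"
        by (metis less_irrefl)+
      ultimately have "(Gamma (real i + 1 - \<eta>) / Gamma (real i + 1)) * ((real i + 1 - \<eta>) * m i) = 1"
        using q[of i] by (simp add: m_def)
      moreover have "(A * p) *\<^sub>R (B *\<^sub>R C *\<^sub>R v) = p *\<^sub>R v" if "A * (B * C) = 1" for A B C p :: real and v :: "real ^ 'n"
      proof -
        have "(A * p) *\<^sub>R (B *\<^sub>R C *\<^sub>R v) = (A * (B * C) * p) *\<^sub>R v" by (simp add: mult_ac)
        then show ?thesis using that by simp
      qed
      moreover have "real i + 1 - \<eta> + \<eta> = real i + 1" by simp
      ultimately show "(Gamma (real i + 1 - \<eta>) / Gamma (real i + 1 - \<eta> + \<eta>)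
          * (\<psi> s - \<psi> a) powr (real i + 1 - \<eta> + \<eta> - 1)) *\<^sub>R ((real i + 1 - \<eta>) *\<^sub>R m i *\<^sub>R d i)
          = (\<psi> s - \<psi> a) powr (real i + 1 - 1) *\<^sub>R d i"
        by metis
    qed
    finally show "psi_RL_integral a \<eta> \<psi> \<psi>' ?P s = G s" by (simp only: G[OF s])
  qed
  have D: "psi_RL_exists a \<eta> \<psi> \<psi>' (psi_diff \<psi>' h) s"
    "psi_RL_integral a \<eta> \<psi> \<psi>' (psi_diff \<psi>' h) s = G s" if s: "s > a" for s
    using RL_cong[of s "psi_diff \<psi>' h" ?P \<eta>] dh(2) P[OF s] s by simp_all
  show "psi_Hilfer_exists a \<alpha> \<beta> \<psi> \<psi>' X"
    unfolding psi_Hilfer_exists_def \<theta>_def[symmetric] \<eta>_def[symmetric] h_def[symmetric]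
    using h(1) dh(1) D(1) by blast
  show "psi_Hilfer a \<alpha> \<beta> \<psi> \<psi>' X t = G t" if "t > a"
    unfolding psi_Hilfer_def \<theta>_def[symmetric] \<eta>_def[symmetric] h_def[symmetric]
    using D(2)[OF that] .
qed

text \<open>\<psi> - \<psi>(a) is a homeomorphism of [a, T] onto a compact set, so g, read in this
  variable, is approximated by ordinary polynomials.\<close>

lemma psi_polynomial_approximation:
  fixes g :: "real \<Rightarrow> real ^ 'n::finite"
  assumes "continuous_on {a..} g" "e > 0"
  shows "\<exists>n d. \<forall>s\<in>{a..T}. norm ((\<Sum>i\<le>n. (\<psi> s - \<psi> a) ^ i *\<^sub>R d i) - g s) < (e::real)"
proof -
  define y where "y = (\<lambda>s. \<psi> s - \<psi> a)"
  define S where "S = y ` {a..T}"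
  define z where "z = inv_into {a..} y"
  have yc: "continuous_on {a..T} y"
    unfolding y_def by (intro continuous_intros continuous_on_subset[OF cont]) auto
  have "inj_on y {a..}" using inj_psi by (auto simp: y_def inj_on_def)
  then have z: "z (y s) = s" if "s \<ge> a" for s
    unfolding z_def using that by (intro inv_into_f_f) auto
  have "continuous_on S z"
    unfolding S_def by (rule continuous_on_inv[OF yc]) (auto simp: z)
  then have "continuous_on S (\<lambda>u. g (z u))"
    by (rule continuous_on_compose2[OF assms(1)]) (auto simp: S_def z)
  moreover have "compact S"
    unfolding S_def by (intro compact_continuous_image yc compact_Icc)
  ultimately obtain n d where "\<forall>u\<in>S. norm (g (z u) - (\<Sum>i\<le>n. u ^ i *\<^sub>R d i)) < e"
    using vector_polynomial_approximation[of S "\<lambda>u. g (z u)" e] assms(2) by blast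
  then have "\<forall>s\<in>{a..T}. norm ((\<Sum>i\<le>n. (\<psi> s - \<psi> a) ^ i *\<^sub>R d i) - g s) < e"
    using z by (auto simp: S_def norm_minus_commute) (auto simp: y_def)
  then show ?thesis by blast
qed

text \<open>Polynomials in \<open>\<psi> - \<psi>(a)\<close> lie in the domain of every operator involved and are dense,
  so they serve as the approximants that the closed derivative asks for.\<close>

lemma has_psi_Hilfer_RL:
  fixes g :: "real \<Rightarrow> real ^ 'n::finite" and c :: "real ^ 'n"
  assumes "0 < \<alpha>" "\<alpha> \<le> 1" "0 \<le> \<beta>" "\<beta> \<le> 1"
    and c: "c = 0 \<or> (1 - \<beta>) * (1 - \<alpha>) = 0"
    and g: "continuous_on {a..} g"
    and x: "\<And>t. t \<ge> a \<Longrightarrow> x t = c + psi_RL_integral a \<alpha> \<psi> \<psi>' g t"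
  shows "has_psi_Hilfer a \<alpha> \<beta> \<psi> \<psi>' x g"
proof -
  \<comment> \<open>Interval and accuracy both improve with m, so that a single sequence works for
    every T.\<close>
  have "\<forall>m. \<exists>n d. \<forall>s\<in>{a..a + real m}. norm ((\<Sum>i\<le>n. (\<psi> s - \<psi> a) ^ i *\<^sub>R d i) - g s) < 1 / Suc m"
    using psi_polynomial_approximation[OF g] by simp
  then obtain n d where nd: "\<And>m s. s \<in> {a..a + real m} \<Longrightarrow>
      norm ((\<Sum>i\<le>n m. (\<psi> s - \<psi> a) ^ i *\<^sub>R d m i) - g s) < 1 / Suc m"
    by metis
  define G where "G = (\<lambda>m s. \<Sum>i\<le>n m. (\<psi> s - \<psi> a) ^ i *\<^sub>R d m i)"
  define X where "X = (\<lambda>m s. c + psi_RL_integral a \<alpha> \<psi> \<psi>' (G m) s)"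
  have X: "continuous_on {a..} (X m)" "psi_Hilfer_exists a \<alpha> \<beta> \<psi> \<psi>' (X m)"
    "t > a \<Longrightarrow> psi_Hilfer a \<alpha> \<beta> \<psi> \<psi>' (X m) t = G m t" for m t
    unfolding X_def G_def by (rule Hilfer_RL_power_sum[OF assms(1-4) c]; assumption?)+
  have G_cont: "continuous_on {a..} (G m)" for m
    unfolding G_def by (intro continuous_intros cont)
  have G: "norm (G m s - g s) \<le> 1 / Suc m" if "s \<in> {a..a + real m}" for m s
    using nd[OF that] by (simp add: G_def less_imp_le)
  have ev: "\<forall>\<^sub>F m in sequentially. T \<le> a + real m \<and> 1 / Suc m < e" if "e > 0" for T e :: real
  proof (rule eventually_conj)
    show "\<forall>\<^sub>F m in sequentially. T \<le> a + real m"
      using eventually_ge_at_top[of "nat \<lceil>T - a\<rceil>"] by eventually_elim linarith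
    show "\<forall>\<^sub>F m in sequentially. 1 / Suc m < e"
      using LIMSEQ_inverse_real_of_nat order_tendstoD(2)[OF _ that] by (simp add: inverse_eq_divide)
  qed
  show ?thesis
    unfolding has_psi_Hilfer_def
  proof (intro exI[of _ X] conjI allI impI)
    fix T assume T: "T > a"
    show "uniform_limit {a<..T} (\<lambda>m. psi_Hilfer a \<alpha> \<beta> \<psi> \<psi>' (X m)) g sequentially"
    proof (rule uniform_limitI)
      fix e :: real assume "e > 0"
      from ev[OF this, of T] show "\<forall>\<^sub>F m in sequentially. \<forall>s\<in>{a<..T}. dist (psi_Hilfer a \<alpha> \<beta> \<psi> \<psi>' (X m) s) (g s) < e"
      proof eventually_elim
        case (elim m)
        show ?case
        proof
          fix s assume s: "s \<in> {a<..T}"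
          then have "norm (G m s - g s) < e" using G[of s m] elim by auto
          then show "dist (psi_Hilfer a \<alpha> \<beta> \<psi> \<psi>' (X m) s) (g s) < e" using s by (simp add: X(3) dist_norm)
        qed
      qed
    qed
    show "uniform_limit {a..T} X x sequentially"
    proof (rule uniform_limitI)
      fix e :: real assume e: "e > 0"
      \<comment> \<open>I^\<alpha> of the constant 1 at T, the factor by which a uniform error in G
        is magnified; Q + 1 makes the final inequality strict.\<close>
      define Q where "Q = (\<psi> T - \<psi> a) powr \<alpha> / Gamma (\<alpha> + 1)"
      have Gp: "Gamma (\<alpha> + 1) > 0" using assms(1) by (intro Gamma_real_pos) auto
      have Q: "Q \<ge> 0" using Gp by (simp add: Q_def)
      have "e / (Q + 1) > 0" using e Q by simp
      from ev[OF this, of T] show "\<forall>\<^sub>F m in sequentially. \<forall>s\<in>{a..T}. dist (X m s) (x s) < e"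
      proof eventually_elim
        case (elim m)
        show ?case
        proof
          fix s assume s: "s \<in> {a..T}"
          show "dist (X m s) (x s) < e"
          proof (cases "s = a")
            case True
            then show ?thesis using e x[of a] by (simp add: X_def RL_at_start[OF assms(1)])
          next
            case False
            have ex: "psi_RL_exists a \<alpha> \<psi> \<psi>' (G m) s" "psi_RL_exists a \<alpha> \<psi> \<psi>' g s"
              using RL_exists_cont[OF less_imp_le[OF assms(1)]] G_cont g by auto
            have "dist (X m s) (x s) = norm (psi_RL_integral a \<alpha> \<psi> \<psi>' (G m) s - psi_RL_integral a \<alpha> \<psi> \<psi>' g s)"
              using x[of s] s by (simp add: X_def dist_norm)
            also have "\<dots> \<le> 1 / Suc m * ((\<psi> s - \<psi> a) powr \<alpha> / Gamma (\<alpha> + 1))"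
              by (rule RL_diff_bound[OF assms(1) _ ex]) (use G[of _ m] False s elim in auto)
            also have "\<dots> \<le> 1 / Suc m * Q"
              unfolding Q_def using s Gp assms(1)
              by (intro mult_left_mono divide_right_mono powr_mono2) (auto simp: psi_le_iff)
            also have "\<dots> \<le> e / (Q + 1) * Q" using elim Q by (intro mult_right_mono) auto
            also have "\<dots> < e" using Q e by (simp add: field_simps)
            finally show ?thesis .
          qed
        qed
      qed
    qed
  qed (use X in auto)
qed

end

subsection \<open>The integral equation\<close>

context psi_setup
begin

text \<open>The delicate point is integrability of \<psi>' \<phi>. If \<beta>(1 - \<alpha>) > 0, it
  follows from existence of the outer integral; if the order is 0, that existence is vacuous and
  \<open>degenerate\<close> supplies a continuous representative. The constant c is h(a): for
  positive inner order the integral over a single point is 0, for order 0 it is x itself.\<close>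

lemma Hilfer_inversion:
  fixes x g :: "real \<Rightarrow> real ^ 'n::finite"
  assumes par: "0 < \<alpha>" "\<alpha> \<le> 1" "0 \<le> \<beta>" "\<beta> \<le> 1"
    and x: "continuous_on {a..} x" "psi_Hilfer_exists a \<alpha> \<beta> \<psi> \<psi>' x"
    and degenerate: "\<beta> * (1 - \<alpha>) = 0 \<Longrightarrow> continuous_on {a..} g \<and> (\<forall>t>a. psi_Hilfer a \<alpha> \<beta> \<psi> \<psi>' x t = g t)"
    and "t > a"
  defines "c \<equiv> if (1 - \<beta>) * (1 - \<alpha>) = 0 then x a else 0"
  shows "psi_RL_exists a (1 + \<alpha>) \<psi> \<psi>' (psi_Hilfer a \<alpha> \<beta> \<psi> \<psi>' x) t"
    and "psi_RL_integral a 1 \<psi> \<psi>' x t = psi_RL_integral a 1 \<psi> \<psi>' (\<lambda>_. c) t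
      + psi_RL_integral a (1 + \<alpha>) \<psi> \<psi>' (psi_Hilfer a \<alpha> \<beta> \<psi> \<psi>' x) t"
proof -
  define \<theta> where "\<theta> = (1 - \<beta>) * (1 - \<alpha>)"
  define \<eta> where "\<eta> = \<beta> * (1 - \<alpha>)"
  have sum1: "\<theta> + \<alpha> = 1 - \<eta>" by (simp add: \<theta>_def \<eta>_def algebra_simps)
  have \<theta>: "\<theta> \<ge> 0" and \<eta>: "\<eta> \<ge> 0" using par by (auto simp: \<theta>_def \<eta>_def)
  have \<theta>1: "\<theta> < 1" using sum1 \<eta> par(1) by linarith
  define h where "h = psi_RL_integral a \<theta> \<psi> \<psi>' x"
  define \<phi> where "\<phi> = psi_diff \<psi>' h"
  have H: "psi_Hilfer a \<alpha> \<beta> \<psi> \<psi>' x = psi_RL_integral a \<eta> \<psi> \<psi>' \<phi>"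
    by (simp add: psi_Hilfer_def \<phi>_def h_def \<theta>_def \<eta>_def)
  have hd: "(h has_vector_derivative \<psi>' s *\<^sub>R \<phi> s) (at s)" if "s > a" for s
    using x(2) nz[of s] that
    by (auto simp: psi_Hilfer_exists_def \<phi>_def psi_diff_def h_def \<theta>_def vector_derivative_works)
  have h_cont: "continuous_on {a..} h"
    unfolding h_def by (rule RL_continuous1[OF \<theta> x(1)])
  have ha: "h a = c"
    using \<theta> RL_at_start[of \<theta> x] by (auto simp: h_def c_def \<theta>_def[symmetric] psi_RL_integral_def[of a 0])
  have lint: "set_integrable lborel {a..s} (\<lambda>r. \<psi>' r *\<^sub>R \<phi> r)" if "s \<ge> a" for s
  proof (cases "\<eta> = 0")
    case True
    then have "\<phi> r = g r" if "r > a" for r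
      using degenerate that unfolding H by (auto simp: \<eta>_def psi_RL_integral_def)
    then have *: "indicator {a..s} r *\<^sub>R \<psi>' r *\<^sub>R \<phi> r = indicator {a..s} r *\<^sub>R \<psi>' r *\<^sub>R g r" if "r \<noteq> a" for r
      using that by (auto simp: indicator_def)
    have "set_integrable lborel {a..s} (\<lambda>r. \<psi>' r *\<^sub>R g r)"
      using deriv_mult_integrable degenerate True by (auto simp: \<eta>_def)
    then show ?thesis
      unfolding set_integrable_def
      by (subst integrable_discrete_difference[of "{a}" _ _ "\<lambda>r. indicator {a..s} r *\<^sub>R \<psi>' r *\<^sub>R g r"])
        (use * in auto)
  next
    case False
    \<comment> \<open>On \<open>[a,s]\<close> the kernel of order \<open>\<eta>\<close> at the later time \<open>s + 1\<close> is bounded below by a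
      multiple of \<open>\<psi>'\<close>.\<close>
    let ?s = "s + 1"
    have "set_integrable lborel {a..?s} (\<lambda>r. psi_kernel \<psi> \<psi>' \<eta> ?s r *\<^sub>R \<phi> r)"
      using x(2) False that by (auto simp: psi_Hilfer_exists_def psi_RL_exists_def \<phi>_def h_def \<theta>_def \<eta>_def)
    then have "set_integrable lborel {a..s} (\<lambda>r. psi_kernel \<psi> \<psi>' \<eta> ?s r *\<^sub>R \<phi> r)"
      by (rule set_integrable_subset) auto
    then have K: "integrable lborel (\<lambda>r. indicator {a..s} r *\<^sub>R psi_kernel \<psi> \<psi>' \<eta> ?s r *\<^sub>R \<phi> r)"
      by (simp only: set_integrable_def)
    define m where "m = (\<lambda>r. (\<psi> ?s - \<psi> r) powr (1 - \<eta>))"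
    have less: "\<psi> r < \<psi> ?s" if "r \<in> {a..s}" for r
      using psi_less[of r ?s] that by auto
    have "continuous_on {a..s} m"
      unfolding m_def using less by (intro continuous_intros continuous_on_subset[OF cont]) fastforce+
    then have m: "(\<lambda>r. indicator {a..s} r *\<^sub>R m r) \<in> borel_measurable lborel"
      using set_measurable_continuous_on[of "{a..s}" m] by (simp add: set_borel_measurable_def)
    have "integrable lborel (\<lambda>r. (indicator {a..s} r *\<^sub>R m r) *\<^sub>R (indicator {a..s} r *\<^sub>R psi_kernel \<psi> \<psi>' \<eta> ?s r *\<^sub>R \<phi> r))"
    proof (rule Bochner_Integration.integrable_bound)
      define B where "B = (\<psi> ?s - \<psi> a) powr (1 - \<eta>)"
      show "integrable lborel (\<lambda>r. B *\<^sub>R (indicator {a..s} r *\<^sub>R psi_kernel \<psi> \<psi>' \<eta> ?s r *\<^sub>R \<phi> r))"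
        by (intro integrable_scaleR_right) (rule K)
      show "AE r in lborel. norm ((indicator {a..s} r *\<^sub>R m r) *\<^sub>R (indicator {a..s} r *\<^sub>R psi_kernel \<psi> \<psi>' \<eta> ?s r *\<^sub>R \<phi> r))
          \<le> norm (B *\<^sub>R (indicator {a..s} r *\<^sub>R psi_kernel \<psi> \<psi>' \<eta> ?s r *\<^sub>R \<phi> r))"
      proof (intro AE_I2)
        fix r
        have "m r \<le> B" if "r \<in> {a..s}"
          unfolding m_def B_def using less[OF that] that sum1 \<theta> par(1) by (intro powr_mono2) (auto simp: psi_le_iff)
        moreover have "m r \<ge> 0" by (simp add: m_def)
        ultimately show "norm ((indicator {a..s} r *\<^sub>R m r) *\<^sub>R (indicator {a..s} r *\<^sub>R psi_kernel \<psi> \<psi>' \<eta> ?s r *\<^sub>R \<phi> r))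
          \<le> norm (B *\<^sub>R (indicator {a..s} r *\<^sub>R psi_kernel \<psi> \<psi>' \<eta> ?s r *\<^sub>R \<phi> r))"
          by (cases "r \<in> {a..s}") (auto simp: abs_mult intro!: mult_right_mono)
      qed
    qed (rule borel_measurable_scaleR[OF m borel_measurable_integrable[OF K]])
    also have "(\<lambda>r. (indicator {a..s} r *\<^sub>R m r) *\<^sub>R (indicator {a..s} r *\<^sub>R psi_kernel \<psi> \<psi>' \<eta> ?s r *\<^sub>R \<phi> r))
        = (\<lambda>r. indicator {a..s} r *\<^sub>R \<psi>' r *\<^sub>R \<phi> r)"
    proof
      fix r
      have "m r * psi_kernel \<psi> \<psi>' \<eta> ?s r = \<psi>' r" if "r \<in> {a..s}"
        using less[OF that] by (simp add: m_def psi_kernel_def mult.left_commute flip: powr_add)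
      then show "(indicator {a..s} r *\<^sub>R m r) *\<^sub>R (indicator {a..s} r *\<^sub>R psi_kernel \<psi> \<psi>' \<eta> ?s r *\<^sub>R \<phi> r)
          = indicator {a..s} r *\<^sub>R \<psi>' r *\<^sub>R \<phi> r"
        by (cases "r \<in> {a..s}") auto
    qed
    finally show ?thesis by (simp add: set_integrable_def)
  qed
  have I1: "psi_RL_integral a 1 \<psi> \<psi>' \<phi> s = h s - c" if "s \<ge> a" for s
  proof -
    \<comment> \<open>h is differentiable on the open half-line only and \<phi> may blow up at
      \<open>a\<close>, so the interior form with continuity of h at \<open>a\<close> is used. The
      gauge integral it yields is the Lebesgue integral by \<open>lint\<close>.\<close>
    have "((\<lambda>r. \<psi>' r *\<^sub>R \<phi> r) has_integral h s - h a) {a..s}"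
      by (rule fundamental_theorem_of_calculus_interior)
        (use that hd continuous_on_subset[OF h_cont, of "{a..s}"] in auto)
    then show ?thesis
      using set_borel_integral_eq_integral(2)[OF lint[OF that]] that
      by (simp add: RL_1 ha integral_unique)
  qed
  have t: "t \<ge> a" using \<open>t > a\<close> by simp
  have "psi_RL_integral a 1 \<psi> \<psi>' x t = psi_RL_integral a (1 - \<theta>) \<psi> \<psi>' h t"
    using RL_semigroup(2)[of "1 - \<theta>" \<theta> t x] \<theta> \<theta>1 t deriv_mult_integrable[OF x(1)] by (simp add: h_def)
  also have "\<dots> = psi_RL_integral a (1 - \<theta>) \<psi> \<psi>' (\<lambda>s. c + psi_RL_integral a 1 \<psi> \<psi>' \<phi> s) t"
    by (rule RL_cong(2)[OF _ \<open>t > a\<close>]) (simp add: I1)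
  also have "\<dots> = psi_RL_integral a (1 - \<theta>) \<psi> \<psi>' (\<lambda>s. c) t
      + psi_RL_integral a (1 - \<theta>) \<psi> \<psi>' (psi_RL_integral a 1 \<psi> \<psi>' \<phi>) t"
    by (rule RL_add(2))
      (use \<theta>1 RL_semigroup(1)[of "1 - \<theta>" 1 t \<phi>] lint[OF t] t in \<open>auto intro: RL_exists_cont\<close>)
  \<comment> \<open>Either \<theta> = 0 and the orders agree, or c = 0.\<close>
  also have "psi_RL_integral a (1 - \<theta>) \<psi> \<psi>' (\<lambda>s. c) t = psi_RL_integral a 1 \<psi> \<psi>' (\<lambda>_. c) t"
    by (simp add: c_def \<theta>_def[symmetric])
  also have "psi_RL_integral a (1 - \<theta>) \<psi> \<psi>' (psi_RL_integral a 1 \<psi> \<psi>' \<phi>) t = psi_RL_integral a (1 - \<theta> + 1) \<psi> \<psi>' \<phi> t"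
    using \<theta>1 lint[OF t] t by (intro RL_semigroup(2)) auto
  \<comment> \<open>As \<theta> + \<alpha> + \<eta> = 1, the order splits so that the inner factor
    I^\<eta> \<phi> is the derivative of x.\<close>
  also have "1 - \<theta> + 1 = (1 + \<alpha>) + \<eta>" using sum1 by simp
  also have "psi_RL_integral a ((1 + \<alpha>) + \<eta>) \<psi> \<psi>' \<phi> t = psi_RL_integral a (1 + \<alpha>) \<psi> \<psi>' (psi_Hilfer a \<alpha> \<beta> \<psi> \<psi>' x) t"
    unfolding H using \<eta> par(1) lint[OF t] t by (intro RL_semigroup(2)[symmetric]) auto
  finally show "psi_RL_integral a 1 \<psi> \<psi>' x t = psi_RL_integral a 1 \<psi> \<psi>' (\<lambda>_. c) t
      + psi_RL_integral a (1 + \<alpha>) \<psi> \<psi>' (psi_Hilfer a \<alpha> \<beta> \<psi> \<psi>' x) t" .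
  show "psi_RL_exists a (1 + \<alpha>) \<psi> \<psi>' (psi_Hilfer a \<alpha> \<beta> \<psi> \<psi>' x) t"
    unfolding H using \<eta> par(1) lint[OF t] t by (intro RL_semigroup(1)) auto
qed

text \<open>Injectivity of I^1 on continuous functions, by differentiating the integral; the value
  at \<open>a\<close> follows by continuity.\<close>

lemma zero_if_RL_1_zero:
  fixes y :: "real \<Rightarrow> real ^ 'n::finite"
  assumes y: "continuous_on {a..} y" and z: "\<And>t. t > a \<Longrightarrow> psi_RL_integral a 1 \<psi> \<psi>' y t = 0"
    and "t \<ge> a"
  shows "y t = 0"
proof -
  have pos: "y t = 0" if "t > a" for t
  proof -
    have c: "continuous_on {a..t + 1} (\<lambda>s. \<psi>' s *\<^sub>R y s)"
      by (intro continuous_intros continuous_on_subset[OF y] continuous_on_subset[OF cont']) auto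
    have int: "integral {a..u} (\<lambda>s. \<psi>' s *\<^sub>R y s) = 0" if "u > a" for u
      using z[OF that] that set_borel_integral_eq_integral(2)[OF deriv_mult_integrable[OF y], of u] by (simp add: RL_1)
    have "((\<lambda>u. integral {a..u} (\<lambda>s. \<psi>' s *\<^sub>R y s)) has_vector_derivative \<psi>' t *\<^sub>R y t) (at t within {a..t + 1})"
      by (rule integral_has_vector_derivative[OF c]) (use that in auto)
    then have "((\<lambda>u. integral {a..u} (\<lambda>s. \<psi>' s *\<^sub>R y s)) has_vector_derivative \<psi>' t *\<^sub>R y t) (at t)"
      using at_within_interior[of t "{a..t+1}"] that by simp
    then have "((\<lambda>u. 0) has_vector_derivative \<psi>' t *\<^sub>R y t) (at t)"
      by (rule has_vector_derivative_transform_within_open[of _ _ _ "{a<..}"]) (use that int in auto)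
    then have "\<psi>' t *\<^sub>R y t = 0"
      using vector_derivative_unique_at has_vector_derivative_const by blast
    then show ?thesis using nz[of t] that by simp
  qed
  show ?thesis
    by (rule continuous_constant_on_closure[of "{a<..}" y 0 t]) (use y pos assms(3) in auto)
qed

text \<open>If \<beta>(1 - \<alpha>) = 0, the derivatives of the approximants need not be
  integrable, but the closed derivative is then the pointwise one and the inversion applies to x
  itself. Otherwise the inversion is applied to the approximants and all three terms
  converge.\<close>

lemma Hilfer_integral_equation:
  fixes x g :: "real \<Rightarrow> real ^ 'n::finite"
  assumes par: "0 < \<alpha>" "\<alpha> \<le> 1" "0 \<le> \<beta>" "\<beta> \<le> 1"
    and x: "continuous_on {a..} x" and g: "continuous_on {a..} g"
    and H: "has_psi_Hilfer a \<alpha> \<beta> \<psi> \<psi>' x g"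
    and "t \<ge> a"
  shows "x t = (if (1 - \<beta>) * (1 - \<alpha>) = 0 then x a else 0) + psi_RL_integral a \<alpha> \<psi> \<psi>' g t"
proof -
  define c where "c = (\<lambda>x :: real \<Rightarrow> real ^ 'n. if (1 - \<beta>) * (1 - \<alpha>) = 0 then x a else 0)"
  have main: "psi_RL_integral a 1 \<psi> \<psi>' x t = psi_RL_integral a 1 \<psi> \<psi>' (\<lambda>_. c x) t
      + psi_RL_integral a (1 + \<alpha>) \<psi> \<psi>' g t" if t: "t > a" for t
  proof (cases "\<beta> * (1 - \<alpha>) = 0")
    case True
    then have "\<alpha> = 1 \<or> \<beta> = 0" by auto
    note P = psi_Hilfer_if_has_psi_Hilfer[OF mono der cont' nz par(2,4) this x H]
    have "psi_RL_integral a (1 + \<alpha>) \<psi> \<psi>' (psi_Hilfer a \<alpha> \<beta> \<psi> \<psi>' x) t = psi_RL_integral a (1 + \<alpha>) \<psi> \<psi>' g t"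
      by (rule RL_cong(2)[OF _ t]) (rule P(2))
    moreover have "continuous_on {a..} g \<and> (\<forall>t>a. psi_Hilfer a \<alpha> \<beta> \<psi> \<psi>' x t = g t)"
      using g P(2) by blast
    ultimately show ?thesis
      using Hilfer_inversion(2)[OF par x P(1) _ t, of g] by (simp add: c_def)
  next
    case False
    from H obtain X where
      X: "\<And>m. continuous_on {a..} (X m)" "\<And>m. psi_Hilfer_exists a \<alpha> \<beta> \<psi> \<psi>' (X m)"
      and U: "\<And>T. T > a \<Longrightarrow> uniform_limit {a..T} X x sequentially"
      and V: "\<And>T. T > a \<Longrightarrow> uniform_limit {a<..T} (\<lambda>m. psi_Hilfer a \<alpha> \<beta> \<psi> \<psi>' (X m)) g sequentially"
      unfolding has_psi_Hilfer_def by blast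
    have inv: "psi_RL_exists a (1 + \<alpha>) \<psi> \<psi>' (psi_Hilfer a \<alpha> \<beta> \<psi> \<psi>' (X m)) t"
      "psi_RL_integral a 1 \<psi> \<psi>' (X m) t = psi_RL_integral a 1 \<psi> \<psi>' (\<lambda>_. c (X m)) t
        + psi_RL_integral a (1 + \<alpha>) \<psi> \<psi>' (psi_Hilfer a \<alpha> \<beta> \<psi> \<psi>' (X m)) t" for m
      using Hilfer_inversion[OF par X(1)[of m] X(2)[of m] _ t] False unfolding c_def by blast+
    have "(\<lambda>m. X m a) \<longlonglongrightarrow> x a"
      by (rule tendsto_uniform_limitI[OF U[OF t]]) (use t in auto)
    then have cX: "(\<lambda>m. c (X m)) \<longlonglongrightarrow> c x" by (simp add: c_def)
    have one: "(0::real) \<le> 1" by simp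
    have L1: "(\<lambda>m. psi_RL_integral a 1 \<psi> \<psi>' (X m) t) \<longlonglongrightarrow> psi_RL_integral a 1 \<psi> \<psi>' x t"
      by (rule psi_RL_integral_LIMSEQ(2)[OF mono der cont' nz t one X(1) x U[OF t]])
    have "uniform_limit {a..t} (\<lambda>m _. c (X m)) (\<lambda>_. c x) sequentially"
      using cX by (auto simp: uniform_limit_iff tendsto_iff)
    then have L2: "(\<lambda>m. psi_RL_integral a 1 \<psi> \<psi>' (\<lambda>_. c (X m)) t) \<longlonglongrightarrow> psi_RL_integral a 1 \<psi> \<psi>' (\<lambda>_. c x) t"
      by (intro psi_RL_integral_LIMSEQ(2)[OF mono der cont' nz t one]) auto
    have L3: "(\<lambda>m. psi_RL_integral a (1 + \<alpha>) \<psi> \<psi>' (psi_Hilfer a \<alpha> \<beta> \<psi> \<psi>' (X m)) t)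
        \<longlonglongrightarrow> psi_RL_integral a (1 + \<alpha>) \<psi> \<psi>' g t"
    proof (rule tendstoI)
      fix e :: real assume e: "e > 0"
      define Q where "Q = (\<psi> t - \<psi> a) powr (1 + \<alpha>) / Gamma (1 + \<alpha> + 1)"
      have "Gamma (1 + \<alpha> + 1) > 0" using par(1) by (intro Gamma_real_pos) auto
      then have Q: "Q \<ge> 0" by (simp add: Q_def)
      have "e / (Q + 1) > 0" using e Q by simp
      then have "\<forall>\<^sub>F m in sequentially. \<forall>s\<in>{a<..t}. dist (psi_Hilfer a \<alpha> \<beta> \<psi> \<psi>' (X m) s) (g s) < e / (Q + 1)"
        using V[OF t] by (auto simp: uniform_limit_iff)
      then show "\<forall>\<^sub>F m in sequentially. dist (psi_RL_integral a (1 + \<alpha>) \<psi> \<psi>' (psi_Hilfer a \<alpha> \<beta> \<psi> \<psi>' (X m)) t)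
          (psi_RL_integral a (1 + \<alpha>) \<psi> \<psi>' g t) < e"
      proof eventually_elim
        case (elim m)
        have "dist (psi_RL_integral a (1 + \<alpha>) \<psi> \<psi>' (psi_Hilfer a \<alpha> \<beta> \<psi> \<psi>' (X m)) t)
          (psi_RL_integral a (1 + \<alpha>) \<psi> \<psi>' g t) \<le> e / (Q + 1) * Q"
          unfolding dist_norm Q_def[symmetric]
          by (rule RL_diff_bound[of "1 + \<alpha>" t, folded Q_def, OF _ t inv(1)])
            (use par g elim in \<open>auto simp: dist_norm less_imp_le intro!: RL_exists_cont\<close>)
        also have "\<dots> < e" using Q e by (simp add: field_simps)
        finally show ?case .
      qed
    qed
    show ?thesis
      using LIMSEQ_unique[OF L1] tendsto_add[OF L2 L3] unfolding inv(2) by blast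
  qed
  define I where "I = psi_RL_integral a \<alpha> \<psi> \<psi>' g"
  have I: "continuous_on {a..} I" unfolding I_def by (rule RL_continuous1) (use par g in auto)
  \<comment> \<open>As I^(1+\<alpha>) g = I^1 I^\<alpha> g, \<open>main\<close> says that I^1
    annihilates this continuous function.\<close>
  have "x t - c x - I t = 0"
  proof (rule zero_if_RL_1_zero[OF _ _ \<open>t \<ge> a\<close>])
    show "continuous_on {a..} (\<lambda>t. x t - c x - I t)" by (intro continuous_intros x I)
    fix t assume t: "t > a"
    have ex: "psi_RL_exists a 1 \<psi> \<psi>' y t" if "continuous_on {a..} y" for y :: "real \<Rightarrow> real ^ 'n"
      using RL_exists_cont[OF _ that] by simp
    have "psi_RL_integral a 1 \<psi> \<psi>' (\<lambda>t. x t - c x - I t) t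
      = psi_RL_integral a 1 \<psi> \<psi>' x t - psi_RL_integral a 1 \<psi> \<psi>' (\<lambda>_. c x) t - psi_RL_integral a 1 \<psi> \<psi>' I t"
      using RL_diff(2)[OF RL_diff(1)[OF ex[OF x] ex[of "\<lambda>_. c x"]] ex[OF I]]
        RL_diff(2)[OF ex[OF x] ex[of "\<lambda>_. c x"]] by simp
    also have "psi_RL_integral a 1 \<psi> \<psi>' I t = psi_RL_integral a (1 + \<alpha>) \<psi> \<psi>' g t"
      unfolding I_def using RL_semigroup(2)[of 1 \<alpha> t g] par t deriv_mult_integrable[OF g] by simp
    finally show "psi_RL_integral a 1 \<psi> \<psi>' (\<lambda>t. x t - c x - I t) t = 0"
      using main[OF t] by simp
  qed
  then show ?thesis by (simp add: c_def I_def algebra_simps)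
qed

end

subsection \<open>The weight and the norm\<close>

text \<open>y + 1 is the convex combination of y + \<alpha> and y + \<alpha> + 1 with weights
  \<alpha> and 1 - \<alpha>, so log-convexity of Gamma bounds y Gamma(y) by (y +
  \<alpha>)^(1-\<alpha>) Gamma(y + \<alpha>). The 2 comes from y + \<alpha> \<le> 2 y.\<close>

lemma Gamma_ratio_le:
  fixes y \<alpha> :: real
  assumes "y \<ge> 1" "0 < \<alpha>" "\<alpha> \<le> 1"
  shows "Gamma y / Gamma (y + \<alpha>) \<le> 2 * y powr (- \<alpha>)"
proof -
  have pos: "Gamma y > 0" "Gamma (y + \<alpha>) > 0"
    using assms by (auto intro: Gamma_real_pos)
  have "(ln \<circ> Gamma) ((1 - (1 - \<alpha>)) *\<^sub>R (y + \<alpha>) + (1 - \<alpha>) *\<^sub>R (y + \<alpha> + 1)) \<le>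
      (1 - (1 - \<alpha>)) * (ln \<circ> Gamma) (y + \<alpha>) + (1 - \<alpha>) * (ln \<circ> Gamma) (y + \<alpha> + 1)"
    by (rule convex_onD[OF log_convex_Gamma_real]) (use assms in auto)
  moreover have "(1 - (1 - \<alpha>)) *\<^sub>R (y + \<alpha>) + (1 - \<alpha>) *\<^sub>R (y + \<alpha> + 1) = y + 1"
    by (simp add: algebra_simps)
  moreover have "Gamma (y + \<alpha> + 1) = (y + \<alpha>) * Gamma (y + \<alpha>)" "Gamma (y + 1) = y * Gamma y"
    using assms by (auto intro!: Gamma_plus1 elim!: nonpos_Ints_cases)
  ultimately have "ln (y * Gamma y) \<le> \<alpha> * ln (Gamma (y + \<alpha>)) + (1 - \<alpha>) * ln ((y + \<alpha>) * Gamma (y + \<alpha>))"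
    by simp
  also have "ln ((y + \<alpha>) * Gamma (y + \<alpha>)) = ln (y + \<alpha>) + ln (Gamma (y + \<alpha>))"
    using assms pos by (intro ln_mult_pos) auto
  also have "\<alpha> * ln (Gamma (y + \<alpha>)) + (1 - \<alpha>) * (ln (y + \<alpha>) + ln (Gamma (y + \<alpha>)))
      = ln ((y + \<alpha>) powr (1 - \<alpha>)) + ln (Gamma (y + \<alpha>))"
    using assms by (simp add: ln_powr) (simp add: algebra_simps)
  also have "\<dots> = ln ((y + \<alpha>) powr (1 - \<alpha>) * Gamma (y + \<alpha>))"
    using assms pos by (intro ln_mult_pos[symmetric]) auto
  finally have "y * Gamma y \<le> (y + \<alpha>) powr (1 - \<alpha>) * Gamma (y + \<alpha>)"
    using assms pos by (subst (asm) ln_le_cancel_iff) auto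
  also have "(y + \<alpha>) powr (1 - \<alpha>) \<le> (2 * y) powr (1 - \<alpha>)"
    using assms by (intro powr_mono2) auto
  also have "\<dots> = 2 powr (1 - \<alpha>) * y powr (1 - \<alpha>)"
    using assms by (simp add: powr_mult)
  also have "2 powr (1 - \<alpha>) \<le> (2 powr 1 :: real)"
    using assms by (intro powr_mono) auto
  finally have "y * Gamma y \<le> 2 * y powr (1 - \<alpha>) * Gamma (y + \<alpha>)"
    using pos by (simp add: mult_right_mono)
  moreover have "y powr (1 - \<alpha>) = y * y powr (- \<alpha>)"
    using assms by (simp add: powr_diff powr_minus field_simps)
  ultimately have "y * Gamma y \<le> y * (2 * y powr (- \<alpha>) * Gamma (y + \<alpha>))"
    by (simp add: algebra_simps)
  then have "Gamma y \<le> 2 * y powr (- \<alpha>) * Gamma (y + \<alpha>)"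
    using assms by (subst (asm) mult_le_cancel_left_pos) auto
  then show ?thesis using pos by (simp add: divide_le_eq)
qed

text \<open>With y = \<alpha> k + 1, the ratio of consecutive terms is at most 2 |z| y^(-\<alpha>)
  in modulus, by \<open>Gamma_ratio_le\<close>, and tends to 0.\<close>

lemma mittag_leffler_summable:
  assumes "0 < \<alpha>" "\<alpha> \<le> 1"
  shows "summable (\<lambda>k. z ^ k / Gamma (\<alpha> * real k + 1))"
proof -
  have "((\<lambda>k. \<bar>z\<bar> * (2 * (\<alpha> * real k + 1) powr (- \<alpha>))) \<longlongrightarrow> \<bar>z\<bar> * (2 * 0)) sequentially"
  proof (intro tendsto_intros tendsto_neg_powr)
    show "filterlim (\<lambda>k. \<alpha> * real k + 1) at_top sequentially"
      using assms by (intro filterlim_at_top_add_at_top filterlim_tendsto_add_at_top[of _ 0]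
        filterlim_tendsto_pos_mult_at_top[OF tendsto_const] filterlim_real_sequentially
        filterlim_tendsto_add_at_top[OF tendsto_const, of _ _ 1, simplified add.commute[of 1]]) auto
  qed (use assms in auto)
  then have "\<forall>\<^sub>F k in sequentially. \<bar>z\<bar> * (2 * (\<alpha> * real k + 1) powr (- \<alpha>)) < 1 / 2"
    by (rule order_tendstoD) simp
  then obtain n0 where n0: "\<And>k. k \<ge> n0 \<Longrightarrow> \<bar>z\<bar> * (2 * (\<alpha> * real k + 1) powr (- \<alpha>)) < 1 / 2"
    by (auto simp: eventually_sequentially)
  show ?thesis
  proof (rule summable_ratio_test[of "1/2" n0])
    fix k assume k: "k \<ge> n0"
    define y where "y = \<alpha> * real k + 1"
    have y: "y \<ge> 1" using assms by (simp add: y_def)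
    have e: "\<alpha> * real (Suc k) + 1 = y + \<alpha>" by (simp add: y_def algebra_simps)
    have pos: "Gamma y > 0" "Gamma (y + \<alpha>) > 0" using y assms by (auto intro: Gamma_real_pos)
    have "\<bar>z\<bar> * (Gamma y / Gamma (y + \<alpha>)) \<le> \<bar>z\<bar> * (2 * y powr (- \<alpha>))"
      using Gamma_ratio_le[OF y assms] by (intro mult_left_mono) auto
    also have "\<dots> \<le> 1 / 2" using n0[OF k] by (simp add: y_def)
    finally have "(\<bar>z\<bar> * (Gamma y / Gamma (y + \<alpha>))) * (\<bar>z\<bar> ^ k / Gamma y) \<le> 1 / 2 * (\<bar>z\<bar> ^ k / Gamma y)"
      using pos by (intro mult_right_mono) auto
    then have "\<bar>z\<bar> ^ Suc k / Gamma (y + \<alpha>) \<le> 1 / 2 * (\<bar>z\<bar> ^ k / Gamma y)"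
      using pos by (simp add: field_simps)
    then show "norm (z ^ Suc k / Gamma (\<alpha> * real (Suc k) + 1)) \<le> 1 / 2 * norm (z ^ k / Gamma (\<alpha> * real k + 1))"
      using pos unfolding e y_def[symmetric] by (simp add: power_abs abs_mult)
  qed simp
qed

lemma Gamma_mittag_pos: "0 < \<alpha> \<Longrightarrow> Gamma (\<alpha> * real k + 1) > 0"
  by (intro Gamma_real_pos) (simp add: add_nonneg_pos)

lemma mittag_leffler_mono:
  assumes "0 < \<alpha>" "\<alpha> \<le> 1" "0 \<le> y" "y \<le> z"
  shows "mittag_leffler \<alpha> y \<le> mittag_leffler \<alpha> z"
  unfolding mittag_leffler_def
  by (intro suminf_le mittag_leffler_summable divide_right_mono power_mono assms
      less_imp_le[OF Gamma_mittag_pos])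

lemma mittag_leffler_ge_1:
  assumes "0 < \<alpha>" "\<alpha> \<le> 1" "0 \<le> z"
  shows "mittag_leffler \<alpha> z \<ge> 1"
proof -
  have "mittag_leffler \<alpha> 0 = (\<Sum>k. if k = 0 then 1 else 0)"
    unfolding mittag_leffler_def by (intro arg_cong[of _ _ suminf]) auto
  also have "\<dots> = 1" using suminf_finite[of "{0}" "\<lambda>k. if k = 0 then 1 else (0::real)"] by simp
  finally show ?thesis using mittag_leffler_mono[of \<alpha> 0 z] assms by simp
qed

text \<open>I^\<alpha> sends the k-th term of the series to 1/\<xi> times the next one. The sum is
  shifted by one place, and the inequality drops the head, which is 1. Nonnegative terms reduce the
  exchange of sum and integral to summability of the integrals.\<close>

lemma (in psi_setup) mittag_leffler_kernel_integral:
  fixes \<alpha> \<xi> :: real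
  assumes "0 < \<alpha>" "\<alpha> \<le> 1" "0 < \<xi>" "t \<ge> a"
  defines "w \<equiv> \<lambda>s. mittag_leffler \<alpha> (\<xi> * (\<psi> s - \<psi> a) powr \<alpha>)"
  shows "set_integrable lborel {a..t} (\<lambda>s. psi_kernel \<psi> \<psi>' \<alpha> t s * w s)"
    and "(LINT s:{a..t}|lborel. psi_kernel \<psi> \<psi>' \<alpha> t s * w s) \<le> Gamma \<alpha> / \<xi> * w t"
proof -
  define y where "y = (\<lambda>s. \<psi> s - \<psi> a)"
  define c where "c = (\<lambda>k. Gamma (\<alpha> * real k + 1))"
  define K where "K = (\<lambda>s. indicator {a..t} s * psi_kernel \<psi> \<psi>' \<alpha> t s)"
  define f where "f = (\<lambda>k s. K s * ((\<xi> * y s powr \<alpha>) ^ k / c k))"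
  \<comment> \<open>The same terms with one real power, as \<open>kernel_power_integral\<close>
    wants them. At s = a and k = 0 they differ, since \<open>0 powr 0\<close> is 0 while a zeroth
    natural power is 1.\<close>
  define g where "g = (\<lambda>k s. \<xi> ^ k / c k * (K s * y s powr (\<alpha> * real k + 1 - 1)))"
  define T where "T = (\<lambda>k. (\<xi> * y t powr \<alpha>) ^ k / c k)"
  have c: "c k > 0" for k unfolding c_def by (rule Gamma_mittag_pos[OF assms(1)])
  have K: "K s \<ge> 0" for s
    using kernel_nonneg[of s] by (auto simp: K_def indicator_def)
  have y: "y s > 0" if "s > a" for s using psi_less[of a s] that by (simp add: y_def)
  have y0: "y t \<ge> 0" using psi_le_iff[of a t] assms by (simp add: y_def)
  have fg: "f k s = g k s" if "s \<noteq> a" for k s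
  proof (cases "s \<in> {a..t}")
    case True
    then have "(y s powr \<alpha>) ^ k = y s powr (\<alpha> * real k)"
      using y[of s] that by (simp add: powr_powr flip: powr_realpow)
    then show ?thesis by (simp add: f_def g_def power_mult_distrib)
  qed (auto simp: f_def g_def K_def)
  have g: "integrable lborel (g k)" "integral\<^sup>L lborel (g k) = Gamma \<alpha> / \<xi> * T (Suc k)" for k
  proof -
    have q: "\<alpha> * real k + 1 > 0" using assms by (simp add: add_nonneg_pos)
    note I = kernel_power_integral[OF assms(4,1) q]
    have E: "(\<lambda>s. K s * y s powr (\<alpha> * real k + 1 - 1)) = (\<lambda>s. indicator {a..t} s *\<^sub>R
        (psi_kernel \<psi> \<psi>' \<alpha> t s * (\<psi> s - \<psi> a) powr (\<alpha> * real k + 1 - 1)))"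
      by (auto simp: K_def y_def mult_ac)
    have "integrable lborel (\<lambda>s. K s * y s powr (\<alpha> * real k + 1 - 1))"
      unfolding E using I(1) by (simp only: set_integrable_def)
    then show "integrable lborel (g k)"
      unfolding g_def by (rule integrable_mult_right)
    have "(\<integral>s. K s * y s powr (\<alpha> * real k + 1 - 1) \<partial>lborel) = Beta (\<alpha> * real k + 1) \<alpha> * y t powr (\<alpha> + (\<alpha> * real k + 1) - 1)"
      unfolding E using I(2) by (simp only: set_lebesgue_integral_def y_def)
    note I2 = this
    have pw: "(y t powr \<alpha>) ^ Suc k = y t powr (\<alpha> + (\<alpha> * real k + 1) - 1)"
      using y0 assms(1) by (cases "y t = 0") (simp_all add: powr_powr algebra_simps flip: powr_realpow powr_add)
    have cc: "c (Suc k) = Gamma (\<alpha> * real k + 1 + \<alpha>)" by (simp add: c_def algebra_simps)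
    have "integral\<^sup>L lborel (g k) = \<xi> ^ k / c k * (Beta (\<alpha> * real k + 1) \<alpha> * (y t powr \<alpha>) ^ Suc k)"
      unfolding g_def integral_mult_right_zero I2 pw ..
    also have "\<dots> = Gamma \<alpha> / \<xi> * T (Suc k)"
    proof -
      have "Beta (\<alpha> * real k + 1) \<alpha> = c k * Gamma \<alpha> / c (Suc k)"
        unfolding Beta_def cc[symmetric] c_def ..
      then show ?thesis
        using c[of k] assms(3) unfolding T_def by (simp add: power_mult_distrib field_simps)
    qed
    finally show "integral\<^sup>L lborel (g k) = Gamma \<alpha> / \<xi> * T (Suc k)" .
  qed
  have meas: "f k \<in> borel_measurable lborel" for k
  proof -
    have "K \<in> borel_measurable borel"
      using borel_measurable_integrable[OF kernel_integrable[OF assms(1), of t, unfolded set_integrable_def]]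
      by (simp add: K_def[abs_def])
    moreover have "(\<lambda>s. indicator {a..t} s *\<^sub>R y s) \<in> borel_measurable borel"
      using set_measurable_continuous_on[of "{a..t}" y]
        continuous_on_diff[OF continuous_on_subset[OF cont] continuous_on_const, of "{a..t}"]
      by (simp add: set_borel_measurable_def y_def[abs_def])
    ultimately have "(\<lambda>s. K s * ((\<xi> * (indicator {a..t} s *\<^sub>R y s) powr \<alpha>) ^ k / c k)) \<in> borel_measurable borel"
      by measurable
    also have "(\<lambda>s. K s * ((\<xi> * (indicator {a..t} s *\<^sub>R y s) powr \<alpha>) ^ k / c k)) = f k"
      by (auto simp: f_def K_def indicator_def fun_eq_iff)
    finally show ?thesis by simp
  qed
  have AE: "AE s in lborel. g k s = f k s" for k
    using AE_lborel_singleton[of a] by eventually_elim (simp add: fg)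
  have f: "integrable lborel (f k)" for k
    by (rule integrable_cong_AE_imp[OF g(1) meas AE])
  have fi: "integral\<^sup>L lborel (f k) = Gamma \<alpha> / \<xi> * T (Suc k)" for k
    using integral_cong_AE[OF borel_measurable_integrable[OF g(1)] meas AE] g(2) by simp
  have f0: "f k s \<ge> 0" for k s
    using c[of k] K[of s] assms(3) by (auto simp: f_def intro!: mult_nonneg_nonneg)
  have T: "summable T"
    unfolding T_def c_def by (rule mittag_leffler_summable[OF assms(1,2)])
  have T': "summable (\<lambda>k. Gamma \<alpha> / \<xi> * T (Suc k))"
    using T by (intro summable_mult) (simp add: summable_Suc_iff)
  have s1: "AE s in lborel. summable (\<lambda>k. norm (f k s))"
  proof (intro AE_I2)
    have "(\<lambda>k. norm (f k s)) = (\<lambda>k. f k s)" for s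
      using f0 by (simp add: fun_eq_iff)
    then show "summable (\<lambda>k. norm (f k s))" for s
      using summable_mult[OF mittag_leffler_summable[OF assms(1,2)], of "K s" "\<xi> * y s powr \<alpha>"]
      by (simp add: f_def c_def)
  qed
  have s2: "summable (\<lambda>k. \<integral>s. norm (f k s) \<partial>lborel)"
    using T' f0 by (simp add: fi)
  have eq: "indicator {a..t} s *\<^sub>R (psi_kernel \<psi> \<psi>' \<alpha> t s * w s) = (\<Sum>k. f k s)" for s
    using suminf_mult[OF mittag_leffler_summable[OF assms(1,2)], of "K s" "\<xi> * y s powr \<alpha>"]
    by (simp add: f_def w_def K_def c_def y_def mittag_leffler_def mult_ac)
  show "set_integrable lborel {a..t} (\<lambda>s. psi_kernel \<psi> \<psi>' \<alpha> t s * w s)"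
    unfolding set_integrable_def eq by (rule integrable_suminf[OF f s1 s2])
  have "(LINT s:{a..t}|lborel. psi_kernel \<psi> \<psi>' \<alpha> t s * w s) = (\<Sum>k. Gamma \<alpha> / \<xi> * T (Suc k))"
    unfolding set_lebesgue_integral_def eq integral_suminf[OF f s1 s2] fi ..
  also have "\<dots> = Gamma \<alpha> / \<xi> * (\<Sum>k. T (Suc k))"
    using T by (intro suminf_mult) (simp add: summable_Suc_iff)
  also have "(\<Sum>k. T (Suc k)) = suminf T - T 0"
    using suminf_split_head[OF T] by simp
  also have "Gamma \<alpha> / \<xi> * (suminf T - T 0) \<le> Gamma \<alpha> / \<xi> * suminf T"
    using assms(1,3) Gamma_real_pos[of \<alpha>] by (intro mult_left_mono) (auto simp: T_def c_def)
  also have "suminf T = w t" by (simp add: T_def w_def mittag_leffler_def y_def c_def)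
  finally show "(LINT s:{a..t}|lborel. psi_kernel \<psi> \<psi>' \<alpha> t s * w s) \<le> Gamma \<alpha> / \<xi> * w t" .
qed

section \<open>Arbitrary norms on a Euclidean space\<close>

locale vector_norm =
  fixes N :: "'a::euclidean_space \<Rightarrow> real"
  assumes is_norm: "is_norm N"
begin

lemma N_zero [simp]: "N x = 0 \<longleftrightarrow> x = 0"
  and N_scale: "N (c *\<^sub>R x) = \<bar>c\<bar> * N x"
  and N_triangle: "N (x + y) \<le> N x + N y"
  using is_norm by (auto simp: is_norm_def)

lemma N_0 [simp]: "N 0 = 0"
  by simp

lemma N_minus: "N (- x) = N x"
  using N_scale[of "-1" x] by simp

lemma N_nonneg: "N x \<ge> 0"
  using N_triangle[of x "- x"] N_minus[of x] by simp

lemma N_diff_commute: "N (x - y) = N (y - x)"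
  using N_minus[of "x - y"] by simp

lemma N_triangle_diff: "\<bar>N x - N y\<bar> \<le> N (x - y)"
  using N_triangle[of "x - y" y] N_triangle[of "y - x" x] N_diff_commute[of x y] by simp

lemma N_triangle3: "N (x - z) \<le> N (x - y) + N (y - z)"
  using N_triangle[of "x - y" "y - z"] by simp

lemma N_sum: "finite A \<Longrightarrow> N (\<Sum>i\<in>A. f i) \<le> (\<Sum>i\<in>A. N (f i))"
proof (induction rule: finite_induct)
  case (insert i A)
  then show ?case using N_triangle[of "f i" "sum f A"] by simp
qed simp

lemma N_le_norm: "N x \<le> (\<Sum>b\<in>Basis. N b) * norm x"
proof -
  have "N x \<le> (\<Sum>b\<in>Basis. N ((x \<bullet> b) *\<^sub>R b))"
    using N_sum[of Basis "\<lambda>b. (x \<bullet> b) *\<^sub>R b"] by (simp add: euclidean_representation)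
  also have "\<dots> \<le> (\<Sum>b\<in>Basis. norm x * N b)"
    using N_nonneg by (intro sum_mono) (simp add: N_scale Basis_le_norm mult_right_mono)
  finally show ?thesis by (simp add: sum_distrib_left mult.commute)
qed

lemma N_continuous: "continuous_on A N"
proof -
  define B where "B = (\<Sum>b\<in>(Basis::'a set). N b)"
  have B: "B \<ge> 0" unfolding B_def by (intro sum_nonneg N_nonneg)
  have "B-lipschitz_on A N"
    using N_triangle_diff N_le_norm B
    by (intro lipschitz_onI) (auto simp: dist_norm B_def intro: order_trans)
  then show ?thesis by (rule lipschitz_on_continuous_on)
qed

text \<open>N attains a positive minimum on the Euclidean unit sphere. The bound turns estimates in
  N into uniform convergence in the Euclidean norm.\<close>

lemma norm_le_N: "\<exists>B>0. \<forall>x. norm x \<le> B * N x"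
proof -
  define S where "S = sphere (0::'a) 1"
  have "\<exists>x\<in>S. \<forall>y\<in>S. N x \<le> N y"
    by (intro continuous_attains_inf N_continuous) (auto simp: S_def)
  then obtain x where x: "x \<in> S" "\<And>y. y \<in> S \<Longrightarrow> N x \<le> N y" by blast
  have pos: "N x > 0" using x(1) N_nonneg[of x] N_zero[of x] by (auto simp: S_def less_le)
  have "norm y \<le> 1 / N x * N y" for y
  proof (cases "y = 0")
    case False
    then have "N x \<le> N ((1 / norm y) *\<^sub>R y)" by (intro x) (auto simp: S_def)
    then show ?thesis using False pos by (simp add: N_scale field_simps)
  qed (use N_nonneg pos in auto)
  then show ?thesis using pos by (intro exI[of _ "1 / N x"]) auto
qed

text \<open>A finite-dimensional Hahn-Banach argument: a hyperplane separates v from the open N-ball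
  of radius \<open>N v\<close>, and its normal is rescaled. Pairing with e replaces N of an integral
  by a real integral.\<close>

lemma support_functional: "\<exists>e. e \<bullet> v = N v \<and> (\<forall>x. e \<bullet> x \<le> N x)"
proof (cases "v = 0")
  case True
  then show ?thesis using N_nonneg by (intro exI[of _ 0]) auto
next
  case False
  then have Nv: "N v > 0" using N_nonneg[of v] N_zero[of v] by (simp add: less_le)
  define C where "C = {x. N x < N v}"
  have "convex C"
  proof (rule convexI)
    fix x y :: 'a and p q :: real assume *: "x \<in> C" "y \<in> C" "0 \<le> p" "0 \<le> q" "p + q = 1"
    have "N (p *\<^sub>R x + q *\<^sub>R y) \<le> p * N x + q * N y"
      using N_triangle[of "p *\<^sub>R x" "q *\<^sub>R y"] * by (simp add: N_scale)
    also have "\<dots> < N v"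
      using * by (intro convex_bound_lt) (auto simp: C_def)
    finally show "p *\<^sub>R x + q *\<^sub>R y \<in> C" by (simp add: C_def)
  qed
  then obtain e b where e: "e \<noteq> 0" "\<And>x. x \<in> C \<Longrightarrow> e \<bullet> x \<le> b" "b \<le> e \<bullet> v"
    using separating_hyperplane_sets[of C "{v}"] Nv by (fastforce simp: C_def)
  have le: "(e \<bullet> x) * N v \<le> (e \<bullet> v) * N x" for x
  proof -
    have *: "r * (e \<bullet> x) \<le> e \<bullet> v" if "r > 0" "r * N x < N v" for r
      using e(2)[of "r *\<^sub>R x"] e(3) that by (simp add: C_def N_scale)
    show ?thesis
    proof (rule ccontr)
      assume "\<not> ?thesis"
      then have lt: "(e \<bullet> v) * N x < (e \<bullet> x) * N v" by simp
      have ev: "e \<bullet> v \<ge> 0" using e(2)[of 0] e(3) Nv by (simp add: C_def)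
      then have ex: "e \<bullet> x > 0"
        using lt Nv mult_nonneg_nonneg[OF ev N_nonneg[of x]] by (smt (verit) mult_nonpos_nonneg)
      \<comment> \<open>The midpoint between (e \<bullet> v) / (e \<bullet> x) and N v / N x: then r
        x lies in C, yet on the wrong side of the hyperplane.\<close>
      define r where "r = ((e \<bullet> v) + (e \<bullet> x) * N v / N x) / (2 * (e \<bullet> x))"
      show False
      proof (cases "N x = 0")
        case True
        then show ?thesis using ex by simp
      next
        case False
        then have Nx: "N x > 0" using N_nonneg[of x] by (simp add: less_le del: N_zero)
        have "e \<bullet> v < (e \<bullet> x) * N v / N x" using lt Nx by (simp add: field_simps)
        moreover have "r * (e \<bullet> x) = ((e \<bullet> v) + (e \<bullet> x) * N v / N x) / 2"
          using ex by (simp add: r_def)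
        ultimately have r: "e \<bullet> v < r * (e \<bullet> x)" "r * (e \<bullet> x) < (e \<bullet> x) * N v / N x"
          by simp_all
        from r(2) have "r * N x < N v" using ex Nx by (simp add: field_simps)
        moreover have "r > 0" using r(1) ev ex
          by (smt (verit) mult_nonpos_nonneg)
        ultimately show False using *[of r] r(1) by simp
      qed
    qed
  qed
  have "e \<bullet> v > 0"
    using le[of e] e(1) Nv N_nonneg[of e] N_zero[of e]
    by (smt (verit) inner_gt_zero_iff mult_nonpos_nonneg mult_pos_pos)
  then show ?thesis
    using le by (intro exI[of _ "(N v / (e \<bullet> v)) *\<^sub>R e"]) (auto simp: field_simps)
qed

end

text \<open>The functional e equals N at the integral and is at most N under the integral sign, so
  the weight bound can be integrated as a real inequality. Each fractional integration costs a
  factor 1/\<xi>.\<close>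

lemma (in psi_setup) RL_integral_weight_bound:
  fixes \<alpha> \<xi> :: real and N :: "real ^ 'n::finite \<Rightarrow> real"
  assumes "is_norm N" "0 < \<alpha>" "\<alpha> \<le> 1" "0 < \<xi>" "t \<ge> a" "0 \<le> C"
    and g: "continuous_on {a..t} g"
    and bound: "\<And>s. s \<in> {a..t} \<Longrightarrow> N (g s) \<le> C * mittag_leffler \<alpha> (\<xi> * (\<psi> s - \<psi> a) powr \<alpha>)"
  shows "N (psi_RL_integral a \<alpha> \<psi> \<psi>' g t) \<le> C / \<xi> * mittag_leffler \<alpha> (\<xi> * (\<psi> t - \<psi> a) powr \<alpha>)"
proof -
  interpret vector_norm N by unfold_locales fact
  define w where "w s = mittag_leffler \<alpha> (\<xi> * (\<psi> s - \<psi> a) powr \<alpha>)" for s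
  define v where "v = psi_RL_integral a \<alpha> \<psi> \<psi>' g t"
  note W = mittag_leffler_kernel_integral[OF assms(2-5), folded w_def]
  have Gp: "Gamma \<alpha> > 0" using assms by (intro Gamma_real_pos)
  obtain e where e: "e \<bullet> v = N v" "\<And>x. e \<bullet> x \<le> N x" using support_functional by blast
  have I: "set_integrable lborel {a..t} (\<lambda>s. psi_kernel \<psi> \<psi>' \<alpha> t s *\<^sub>R g s)"
    by (rule kernel_cont_integrable[OF assms(2) g])
  have I2: "set_integrable lborel {a..t} (\<lambda>s. psi_kernel \<psi> \<psi>' \<alpha> t s * (e \<bullet> g s))"
    using kernel_cont_integrable[OF assms(2), of t "\<lambda>s. e \<bullet> g s"]
      continuous_on_inner[OF continuous_on_const g] by simp
  have "Gamma \<alpha> * N v = e \<bullet> (LINT s:{a..t}|lborel. psi_kernel \<psi> \<psi>' \<alpha> t s *\<^sub>R g s)"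
    unfolding e(1)[symmetric] using Gp assms(2) by (simp add: v_def psi_RL_integral_def less_imp_neq[THEN not_sym])
  also have "\<dots> = (LINT s:{a..t}|lborel. psi_kernel \<psi> \<psi>' \<alpha> t s * (e \<bullet> g s))"
    using integral_inner_right[of e lborel "\<lambda>s. indicator {a..t} s *\<^sub>R psi_kernel \<psi> \<psi>' \<alpha> t s *\<^sub>R g s"] I
    by (simp add: set_lebesgue_integral_def set_integrable_def mult_ac)
  also have "\<dots> \<le> (LINT s:{a..t}|lborel. C * (psi_kernel \<psi> \<psi>' \<alpha> t s * w s))"
  proof (rule set_integral_mono[OF I2])
    show "set_integrable lborel {a..t} (\<lambda>s. C * (psi_kernel \<psi> \<psi>' \<alpha> t s * w s))" using W(1) by auto
    fix s assume s: "s \<in> {a..t}"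
    have "e \<bullet> g s \<le> C * w s" using e(2)[of "g s"] bound[OF s] by (simp add: w_def)
    then have "psi_kernel \<psi> \<psi>' \<alpha> t s * (e \<bullet> g s) \<le> psi_kernel \<psi> \<psi>' \<alpha> t s * (C * w s)"
      using kernel_nonneg[of s] s by (intro mult_left_mono) auto
    then show "psi_kernel \<psi> \<psi>' \<alpha> t s * (e \<bullet> g s) \<le> C * (psi_kernel \<psi> \<psi>' \<alpha> t s * w s)"
      by (simp add: mult_ac)
  qed
  also have "\<dots> = C * (LINT s:{a..t}|lborel. psi_kernel \<psi> \<psi>' \<alpha> t s * w s)" by simp
  also have "\<dots> \<le> C * (Gamma \<alpha> / \<xi> * w t)" using W(2) assms by (intro mult_left_mono) auto
  finally have "Gamma \<alpha> * N v \<le> Gamma \<alpha> * (C / \<xi> * w t)" by (simp add: mult_ac)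
  then have "N v \<le> C / \<xi> * w t" using Gp by (rule mult_left_le_imp_le)
  then show ?thesis by (simp only: v_def w_def)
qed

subsection \<open>Fixed points of weighted contractions\<close>

lemma continuous_on_atLeastI:
  fixes x :: "real \<Rightarrow> 'b::topological_space"
  assumes "\<And>S. S > a \<Longrightarrow> continuous_on {a..S} x"
  shows "continuous_on {a..} x"
  unfolding continuous_on_def
proof
  fix t assume t: "t \<in> {a..}"
  have "at t within {a..} = at t within {a..t + 1}"
    by (rule at_within_nhd[of t "{..<t + 1}"]) auto
  then show "(x \<longlongrightarrow> x t) (at t within {a..})"
    using assms[of "t + 1"] t by (auto simp: continuous_on_def)
qed

context vector_norm
begin

text \<open>Each bound C can be fed back into \<open>contr\<close>, which improves it to q C; hence
  q^n C bounds the distance for every n.\<close>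

lemma weighted_contraction_unique:
  assumes q: "0 \<le> q" "q < 1"
    and contr: "\<And>C t. 0 \<le> C \<Longrightarrow> t \<ge> a \<Longrightarrow> (\<And>s. s \<ge> a \<Longrightarrow> N (x s - y s) \<le> C * w s)
      \<Longrightarrow> N (x t - y t) \<le> q * C * w t"
    and "0 \<le> C" and C: "\<And>s. s \<ge> (a::real) \<Longrightarrow> N (x s - y s) \<le> C * w s"
    and "t \<ge> a"
  shows "x t = y t"
proof -
  have "\<forall>t\<ge>a. N (x t - y t) \<le> q ^ n * C * w t" for n
  proof (induction n)
    case (Suc n)
    then show ?case
      using contr[of "q ^ n * C"] q \<open>0 \<le> C\<close> by (auto simp: mult.assoc)
  qed (use C in auto)
  then have "N (x t - y t) \<le> q ^ n * (C * w t)" for n using \<open>t \<ge> a\<close> by (simp add: mult.assoc)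
  moreover have "(\<lambda>n. q ^ n * (C * w t)) \<longlonglongrightarrow> 0 * (C * w t)"
    using q by (intro tendsto_intros LIMSEQ_realpow_zero)
  ultimately have "N (x t - y t) \<le> 0"
    by (intro LIMSEQ_le_const[of "\<lambda>n. q ^ n * (C * w t)" 0]) auto
  then have "N (x t - y t) = 0" using N_nonneg by (intro antisym)
  then show ?thesis by (simp only: N_zero right_minus_eq)
qed

text \<open>Picard iteration from 0. The weighted distance is handled through explicit bounds C, so
  it need not be finite for all pairs of continuous functions. Since w is increasing, geometric
  decay in the weighted distance is uniform on bounded intervals.\<close>

lemma weighted_contraction_fixed_point:
  fixes T :: "(real \<Rightarrow> 'a) \<Rightarrow> real \<Rightarrow> 'a"
  assumes q: "0 \<le> q" "q < 1" and d: "0 \<le> d"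
    and w: "\<And>t. t \<ge> a \<Longrightarrow> 0 \<le> w t" "\<And>s t. a \<le> s \<Longrightarrow> s \<le> t \<Longrightarrow> w s \<le> w t"
    and T_cont: "\<And>x. continuous_on {a..} x \<Longrightarrow> continuous_on {a..} (T x)"
    and contr: "\<And>x y C t. continuous_on {a..} x \<Longrightarrow> continuous_on {a..} y \<Longrightarrow> 0 \<le> C \<Longrightarrow> t \<ge> a
      \<Longrightarrow> (\<And>s. s \<ge> a \<Longrightarrow> N (x s - y s) \<le> C * w s) \<Longrightarrow> N (T x t - T y t) \<le> q * C * w t"
    and start: "\<And>t. t \<ge> a \<Longrightarrow> N (T (\<lambda>_. 0) t) \<le> d * w t"
  shows "\<exists>x. continuous_on {a..} x \<and> (\<forall>t\<ge>a. N (x t) \<le> d / (1 - q) * w t) \<and> (\<forall>t\<ge>a. T x t = x t)"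
proof -
  define u where "u = (\<lambda>n. (T ^^ n) (\<lambda>_. 0))"
  have u0: "u 0 = (\<lambda>_. 0)" and uS: "u (Suc n) = T (u n)" for n by (simp_all add: u_def)
  have uc: "continuous_on {a..} (u n)" for n
    by (induction n) (auto simp: u0 uS T_cont)
  have step: "\<forall>t\<ge>a. N (u (Suc n) t - u n t) \<le> q ^ n * d * w t" for n
  proof (induction n)
    case 0
    then show ?case using start by (simp add: u0 uS)
  next
    case (Suc n)
    have "N (T (u (Suc n)) t - T (u n) t) \<le> q * (q ^ n * d) * w t" if "t \<ge> a" for t
      using Suc q d by (intro contr uc that) auto
    then show ?case by (simp add: uS mult.assoc)
  qed
  \<comment> \<open>The coefficient is the finite geometric sum of q^n up to q^(n+k-1), kept exact
    so that the induction closes.\<close>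
  have dist_u: "N (u (n + k) t - u n t) \<le> (q ^ n - q ^ (n + k)) / (1 - q) * d * w t" if "t \<ge> a" for n k t
  proof (induction k)
    case (Suc k)
    have "N (u (n + Suc k) t - u n t) \<le> N (u (Suc (n + k)) t - u (n + k) t) + N (u (n + k) t - u n t)"
      using N_triangle3[of "u (Suc (n + k)) t" "u n t" "u (n + k) t"] by simp
    also have "\<dots> \<le> q ^ (n + k) * d * w t + (q ^ n - q ^ (n + k)) / (1 - q) * d * w t"
      using step[of "n + k"] Suc that by (intro add_mono) auto
    also have "\<dots> = (q ^ (n + k) + (q ^ n - q ^ (n + k)) / (1 - q)) * (d * w t)"
      by (simp add: algebra_simps)
    also have "q ^ (n + k) + (q ^ n - q ^ (n + k)) / (1 - q) = (q ^ n - q ^ (n + Suc k)) / (1 - q)"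
      using q by (simp add: field_simps)
    finally show ?case by (simp add: mult.assoc)
  qed simp
  obtain B where B: "B > 0" "\<And>v. norm v \<le> B * N v" using norm_le_N by blast
  \<comment> \<open>The limit of the iterates as a telescoping series, to which the Weierstrass test
    applies.\<close>
  define x where "x = (\<lambda>t. \<Sum>n. u (Suc n) t - u n t)"
  have unif: "uniform_limit {a..S} u x sequentially" for S
  proof -
    have "uniform_limit {a..S} (\<lambda>n t. \<Sum>i<n. u (Suc i) t - u i t) (\<lambda>t. \<Sum>i. u (Suc i) t - u i t) sequentially"
    proof (rule Weierstrass_m_test)
      show "summable (\<lambda>n. q ^ n * (B * d * w S))"
        using q by (intro summable_mult2 summable_geometric) auto
      fix n t assume t: "t \<in> {a..S}"
      have "norm (u (Suc n) t - u n t) \<le> B * N (u (Suc n) t - u n t)" by (rule B)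
      also have "\<dots> \<le> B * (q ^ n * d * w t)" using step t B(1) by (intro mult_left_mono) auto
      also have "\<dots> \<le> B * (q ^ n * d * w S)"
        using w(2)[of t S] t B(1) q d by (intro mult_left_mono) auto
      finally show "norm (u (Suc n) t - u n t) \<le> q ^ n * (B * d * w S)" by (simp add: mult_ac)
    qed
    moreover have "(\<lambda>n t. \<Sum>i<n. u (Suc i) t - u i t) = u"
      using sum_lessThan_telescope[of "\<lambda>i. u i _"] by (intro ext) (simp add: u0)
    ultimately show ?thesis by (simp add: x_def)
  qed
  have xc: "continuous_on {a..} x"
    by (rule continuous_on_atLeastI, rule uniform_limit_theorem[OF _ unif])
      (auto intro!: always_eventually continuous_on_subset[OF uc])
  have lim: "(\<lambda>n. u n t) \<longlonglongrightarrow> x t" if "t \<ge> a" for t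
    by (rule tendsto_uniform_limitI[OF unif[of t]]) (use that in auto)
  have close: "N (x t - u n t) \<le> q ^ n / (1 - q) * d * w t" if t: "t \<ge> a" for n t
  proof (rule LIMSEQ_le_const2)
    show "(\<lambda>k. N (u (k + n) t - u n t)) \<longlonglongrightarrow> N (x t - u n t)"
      by (intro continuous_on_tendsto_compose[OF N_continuous[of UNIV]] tendsto_intros
          LIMSEQ_ignore_initial_segment lim t) auto
    have "N (u (k + n) t - u n t) \<le> q ^ n / (1 - q) * d * w t" for k
    proof -
      have "(q ^ n - q ^ (n + k)) / (1 - q) * d * w t \<le> q ^ n / (1 - q) * d * w t"
        using q d w(1)[OF t] by (intro mult_right_mono divide_right_mono) auto
      then show ?thesis using dist_u[OF t, of n k] by (simp add: add.commute)
    qed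
    then show "\<exists>M. \<forall>k\<ge>M. N (u (k + n) t - u n t) \<le> q ^ n / (1 - q) * d * w t" by blast
  qed
  have "T x t = x t" if t: "t \<ge> a" for t
  proof -
    \<comment> \<open>T x and x are both compared with the iterate number n + 1; each comparison
      contributes one q^(n+1) / (1 - q).\<close>
    let ?e = "\<lambda>n. q ^ Suc n * (2 / (1 - q) * d * w t)"
    have "N (T x t - x t) \<le> ?e n" for n
    proof -
      have "N (T x t - T (u n) t) \<le> q * (q ^ n / (1 - q) * d) * w t"
        using q d close by (intro contr xc uc t) (auto simp: mult.assoc)
      moreover have "N (T (u n) t - x t) \<le> q ^ Suc n / (1 - q) * d * w t"
        using close[OF t, of "Suc n"] by (simp add: uS N_diff_commute[of _ "x t"])
      ultimately have "N (T x t - x t) \<le> q * (q ^ n / (1 - q) * d) * w t + q ^ Suc n / (1 - q) * d * w t"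
        using N_triangle3[of "T x t" "x t" "T (u n) t"] by linarith
      then show ?thesis by (simp add: mult_ac)
    qed
    moreover have "?e \<longlonglongrightarrow> 0 * (2 / (1 - q) * d * w t)"
      using q by (intro tendsto_mult_right LIMSEQ_Suc LIMSEQ_realpow_zero)
    ultimately have "N (T x t - x t) \<le> 0"
      by (intro LIMSEQ_le_const[of ?e 0]) auto
    then have "N (T x t - x t) = 0" using N_nonneg by (intro antisym)
    then show ?thesis by (simp only: N_zero right_minus_eq)
  qed
  moreover have "N (x t) \<le> d / (1 - q) * w t" if "t \<ge> a" for t
    using close[OF that, of 0] by (simp add: u0)
  ultimately show ?thesis using xc by blast
qed

end

subsection \<open>The integrodifferential equation\<close>

theorem theorem4:
  fixes a \<alpha> \<beta> \<gamma> L \<xi> M \<delta> :: real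
    and \<psi> \<psi>' :: "real \<Rightarrow> real"
    and N :: "real ^ 'n::finite \<Rightarrow> real"
    and f :: "real \<Rightarrow> real ^ 'n \<Rightarrow> real ^ 'n \<Rightarrow> real ^ 'n"
    and k :: "real \<Rightarrow> real \<Rightarrow> real ^ 'n \<Rightarrow> real ^ 'n"
    and x0 :: "real ^ 'n"
    and f0 :: "real \<Rightarrow> real ^ 'n"
  assumes "0 < \<alpha>" "\<alpha> \<le> 1" "0 \<le> \<beta>" "\<beta> \<le> 1" "\<gamma> = \<alpha> + \<beta> * (1 - \<alpha>)"
    and "is_norm N"
    and "mono_on {a..} \<psi>" "\<And>t. t > a \<Longrightarrow> \<psi> t > 0"
    and "\<And>t. t \<ge> a \<Longrightarrow> (\<psi> has_real_derivative \<psi>' t) (at t within {a..})"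
    and "continuous_on {a..} \<psi>'" "\<And>t. t \<ge> a \<Longrightarrow> \<psi>' t \<noteq> 0"
    and "L > 0" "\<xi> > 0" "M \<ge> 0" "\<delta> > 1" "\<xi> = L * \<delta>"
    and "continuous_on ({a..} \<times> UNIV \<times> UNIV) (\<lambda>(t, u, v). f t u v)"
    and "continuous_on {(t, s, u). a \<le> s \<and> s \<le> t} (\<lambda>(t, s, u). k t s u)"
    and "\<And>t u u' v v'. t \<ge> a \<Longrightarrow> N (f t u v - f t u' v') \<le> M * (N (u - u') + N (v - v'))"
    and "\<And>t s u u'. a \<le> s \<Longrightarrow> s \<le> t \<Longrightarrow> N (k t s u - k t s u') \<le> L * N (u - u')"
    and "\<And>s. f0 s = f s 0 (psi_RL_integral a \<alpha> \<psi> \<psi>' (\<lambda>\<sigma>. k s \<sigma> 0) s)"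
    and "bdd_above ((\<lambda>t. 1 / mittag_leffler \<alpha> (\<xi> * (\<psi> t - \<psi> a) powr \<alpha>) *
           N (((\<psi> t - \<psi> a) powr (\<gamma> - 1) / Gamma \<gamma>) *\<^sub>R x0
              + psi_RL_integral a \<alpha> \<psi> \<psi>' f0 t)) ` {a<..})"
    and "M / \<xi> * (1 + 1 / \<delta>) < 1"
  shows "\<exists>!x. x \<in> C_xi N a \<alpha> \<psi> \<xi> \<and> integrodiff_solution a \<alpha> \<beta> \<psi> \<psi>' f k x0 x"
proof -
  interpret psi_setup a \<psi> \<psi>' by unfold_locales fact+
  interpret vector_norm N by unfold_locales fact
  note par = assms(1-4) and pos = assms(12-14)
  note f_cont = assms(17) and k_cont = assms(18) and f_lip = assms(19) and k_lip = assms(20)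
  define \<theta> where "\<theta> = (1 - \<beta>) * (1 - \<alpha>)"
  define w where "w t = mittag_leffler \<alpha> (\<xi> * (\<psi> t - \<psi> a) powr \<alpha>)" for t
  define q where "q = M / \<xi> * (1 + 1 / \<delta>)"
  define J where "J x t = psi_RL_integral a \<alpha> \<psi> \<psi>' (\<lambda>s. k t s (x s)) t" for x t
  define F where "F x t = f t (x t) (J x t)" for x t
  \<comment> \<open>For t > a this is \<Psi>^\<gamma>(t, a) x0 in both cases that can occur:
    \<gamma> = 1, or x0 = 0.\<close>
  define c where "c = (if \<theta> = 0 then x0 else 0)"
  define T where "T x t = c + psi_RL_integral a \<alpha> \<psi> \<psi>' (F x) t" for x t
  have \<theta>: "\<theta> \<ge> 0" and \<gamma>\<theta>: "\<gamma> = 1 - \<theta>" and \<gamma>0: "\<gamma> > 0"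
  proof -
    show "\<theta> \<ge> 0" using par by (simp add: \<theta>_def)
    show "\<gamma> = 1 - \<theta>" by (simp add: \<theta>_def assms(5) algebra_simps)
    show "\<gamma> > 0" unfolding assms(5) using par by (intro add_pos_nonneg mult_nonneg_nonneg) auto
  qed
  have L\<xi>: "L / \<xi> = 1 / \<delta>" using assms(12,15,16) by simp
  have q: "0 \<le> q" "q < 1" using assms(13-15,23) by (auto simp: q_def)
  have y0: "0 \<le> \<xi> * (\<psi> t - \<psi> a) powr \<alpha>" for t using pos(2) by simp
  have w1: "w t \<ge> 1" for t unfolding w_def by (rule mittag_leffler_ge_1[OF par(1,2) y0])
  have w_mono: "w s \<le> w t" if "a \<le> s" "s \<le> t" for s t
    unfolding w_def using that pos(2) par
    by (intro mittag_leffler_mono y0 mult_left_mono powr_mono2) (auto simp: psi_le_iff)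
  have k_cont': "continuous_on {(t, s). a \<le> s \<and> s \<le> t} (\<lambda>(t, s). k t s (x s))"
    if "continuous_on {a..} x" for x
  proof -
    have "continuous_on {(t, s). a \<le> s \<and> s \<le> t} (\<lambda>p. x (snd p))"
      by (rule continuous_on_compose2[OF that]) (auto intro!: continuous_intros)
    then have "continuous_on {(t, s). a \<le> s \<and> s \<le> t} (\<lambda>p. (fst p, snd p, x (snd p)))"
      by (intro continuous_intros)
    from continuous_on_compose2[OF k_cont this] show ?thesis by (simp add: case_prod_unfold image_subset_iff)
  qed
  have k_sec: "continuous_on {a..t} (\<lambda>s. k t s (x s))" if "continuous_on {a..} x" for x t
  proof -
    have "continuous_on {a..t} (\<lambda>s. (t, s))" by (intro continuous_intros)
    from continuous_on_compose2[OF k_cont'[OF that] this] show ?thesis by (simp add: image_subset_iff)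
  qed
  have J_cont: "continuous_on {a..} (J x)" if "continuous_on {a..} x" for x
    unfolding J_def[abs_def] by (rule RL_continuous[OF par(1) k_cont'[OF that]])
  have F_cont: "continuous_on {a..} (F x)" if "continuous_on {a..} x" for x
  proof -
    have "continuous_on {a..} (\<lambda>t. (t, x t, J x t))"
      by (intro continuous_intros that J_cont)
    from continuous_on_compose2[OF f_cont this] show ?thesis by (simp add: F_def[abs_def] image_subset_iff)
  qed
  have RLF: "continuous_on {a..} (psi_RL_integral a \<alpha> \<psi> \<psi>' (F x))" if "continuous_on {a..} x" for x
    using RL_continuous1[OF less_imp_le[OF par(1)] F_cont[OF that]] .
  have T_cont: "continuous_on {a..} (T x)" if "continuous_on {a..} x" for x
    unfolding T_def[abs_def] by (intro continuous_intros RLF that)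
  have contr: "N (T x t - T y t) \<le> q * C * w t"
    if x: "continuous_on {a..} x" and y: "continuous_on {a..} y" and C: "0 \<le> C" and t: "t \<ge> a"
      and xy: "\<And>s. s \<ge> a \<Longrightarrow> N (x s - y s) \<le> C * w s" for x y C t
  proof -
    have J: "N (J x s - J y s) \<le> L * C / \<xi> * w s" if s: "s \<ge> a" for s
    proof -
      have ex: "psi_RL_exists a \<alpha> \<psi> \<psi>' (\<lambda>r. k s r (z r)) s" if "continuous_on {a..} z" for z
        unfolding psi_RL_exists_def using kernel_cont_integrable[OF par(1) k_sec[OF that]] by blast
      have "N (psi_RL_integral a \<alpha> \<psi> \<psi>' (\<lambda>r. k s r (x r) - k s r (y r)) s) \<le> L * C / \<xi> * w s"
        unfolding w_def
      proof (rule RL_integral_weight_bound[OF assms(6) par(1,2) pos(2) s])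
        fix r assume r: "r \<in> {a..s}"
        have "N (k s r (x r) - k s r (y r)) \<le> L * N (x r - y r)" using k_lip r by auto
        also have "\<dots> \<le> L * (C * w r)" using xy r pos by (intro mult_left_mono) auto
        finally show "N (k s r (x r) - k s r (y r)) \<le> L * C * mittag_leffler \<alpha> (\<xi> * (\<psi> r - \<psi> a) powr \<alpha>)"
          by (simp add: w_def mult.assoc)
      qed (use C pos in \<open>auto intro!: continuous_intros k_sec x y\<close>)
      then show ?thesis unfolding J_def RL_diff(2)[OF ex[OF x] ex[OF y]] .
    qed
    have "N (psi_RL_integral a \<alpha> \<psi> \<psi>' (\<lambda>s. F x s - F y s) t) \<le> M * (C + L * C / \<xi>) / \<xi> * w t"
      unfolding w_def
    proof (rule RL_integral_weight_bound[OF assms(6) par(1,2) pos(2) t])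
      fix s assume s: "s \<in> {a..t}"
      have "N (F x s - F y s) \<le> M * (N (x s - y s) + N (J x s - J y s))"
        unfolding F_def using f_lip s by auto
      also have "\<dots> \<le> M * (C * w s + L * C / \<xi> * w s)"
        using xy J s pos by (intro mult_left_mono add_mono) auto
      finally show "N (F x s - F y s) \<le> M * (C + L * C / \<xi>) * mittag_leffler \<alpha> (\<xi> * (\<psi> s - \<psi> a) powr \<alpha>)"
        by (simp add: w_def algebra_simps)
    qed (use C pos in \<open>auto intro!: continuous_intros continuous_on_subset[OF F_cont[OF x]] continuous_on_subset[OF F_cont[OF y]]\<close>)
    moreover have "psi_RL_integral a \<alpha> \<psi> \<psi>' (\<lambda>s. F x s - F y s) t = T x t - T y t"
      unfolding T_def
      using RL_diff(2)[OF RL_exists_cont[OF less_imp_le[OF par(1)] F_cont[OF x]]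
          RL_exists_cont[OF less_imp_le[OF par(1)] F_cont[OF y]]] by simp
    moreover have "M * (C + L * C / \<xi>) / \<xi> = q * C"
      unfolding q_def L\<xi>[symmetric] by (simp add: field_simps)
    ultimately show ?thesis by simp
  qed
  have F0: "F (\<lambda>_. 0) = f0" by (simp add: fun_eq_iff F_def J_def assms(21))
  have f0: "continuous_on {a..} (psi_RL_integral a \<alpha> \<psi> \<psi>' f0)"
    using RLF[of "\<lambda>_. 0"] unfolding F0 by simp
  obtain D where D: "\<And>t. t > a \<Longrightarrow>
      N (((\<psi> t - \<psi> a) powr (\<gamma> - 1) / Gamma \<gamma>) *\<^sub>R x0 + psi_RL_integral a \<alpha> \<psi> \<psi>' f0 t) \<le> D * w t"
  proof -
    from assms(22) obtain D where "\<And>t. t > a \<Longrightarrow> 1 / w t *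
        N (((\<psi> t - \<psi> a) powr (\<gamma> - 1) / Gamma \<gamma>) *\<^sub>R x0 + psi_RL_integral a \<alpha> \<psi> \<psi>' f0 t) \<le> D"
      by (auto simp: bdd_above_def w_def)
    moreover have "w t > 0" for t using w1[of t] by simp
    ultimately have "\<And>t. t > a \<Longrightarrow>
        N (((\<psi> t - \<psi> a) powr (\<gamma> - 1) / Gamma \<gamma>) *\<^sub>R x0 + psi_RL_integral a \<alpha> \<psi> \<psi>' f0 t) \<le> D * w t"
      by (simp add: divide_le_eq)
    then show thesis using that by blast
  qed
  have x0: "x0 = 0" if "\<theta> \<noteq> 0"
  proof -
    have G: "Gamma \<gamma> > 0" using \<gamma>0 by (rule Gamma_real_pos)
    have "bounded (psi_RL_integral a \<alpha> \<psi> \<psi>' f0 ` {a..a + 1})"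
      by (intro compact_imp_bounded compact_continuous_image continuous_on_subset[OF f0]) auto
    then obtain B where B: "\<And>t. t \<in> {a..a + 1} \<Longrightarrow> norm (psi_RL_integral a \<alpha> \<psi> \<psi>' f0 t) \<le> B"
      unfolding bounded_iff by blast
    define S where "S = (\<Sum>b\<in>(Basis :: (real ^ 'n) set). N b)"
    have S: "S \<ge> 0" unfolding S_def by (intro sum_nonneg N_nonneg)
    \<comment> \<open>On (a, a + 1) the weighted bound and the fractional integral of f0 are
      bounded, so (\<psi> t - \<psi> a)^(\<gamma>-1) N x0 is at most this E. Multiplying by the
      power with exponent \<theta> = 1 - \<gamma> > 0 and letting t tend to \<open>a\<close> forces
      x0 = 0.\<close>
    define E where "E = Gamma \<gamma> * (\<bar>D\<bar> * w (a + 1) + S * B)"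
    have "N x0 \<le> E * (\<psi> t - \<psi> a) powr \<theta>" if t: "t \<in> {a<..<a + 1}" for t
    proof -
      let ?v = "((\<psi> t - \<psi> a) powr (\<gamma> - 1) / Gamma \<gamma>) *\<^sub>R x0" and ?r = "psi_RL_integral a \<alpha> \<psi> \<psi>' f0 t"
      have p: "\<psi> t - \<psi> a > 0" using psi_less t by simp
      have "N ?v \<le> N (?v + ?r) + N ?r"
        using N_triangle[of "?v + ?r" "- ?r"] by (simp add: N_minus)
      also have "N (?v + ?r) \<le> D * w t" using D t by simp
      also have "D * w t \<le> \<bar>D\<bar> * w (a + 1)"
        using w_mono[of t "a + 1"] t w1[of t] by (intro mult_mono) auto
      also have "N ?r \<le> S * norm ?r" unfolding S_def by (rule N_le_norm)
      also have "\<dots> \<le> S * B" using B[of t] t S by (intro mult_left_mono) auto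
      finally have "(\<psi> t - \<psi> a) powr (\<gamma> - 1) * N x0 \<le> E"
        using G by (simp add: N_scale E_def divide_le_eq mult_ac)
      then have "(\<psi> t - \<psi> a) powr \<theta> * ((\<psi> t - \<psi> a) powr (\<gamma> - 1) * N x0) \<le> (\<psi> t - \<psi> a) powr \<theta> * E"
        by (intro mult_left_mono) auto
      moreover have "(\<psi> t - \<psi> a) powr \<theta> * (\<psi> t - \<psi> a) powr (\<gamma> - 1) = 1"
        using p by (simp add: \<gamma>\<theta> flip: powr_add)
      ultimately have "1 * N x0 \<le> (\<psi> t - \<psi> a) powr \<theta> * E" by (simp only: mult.assoc[symmetric])
      then show ?thesis by (simp add: mult.commute)
    qed
    then have ev: "\<forall>\<^sub>F t in at_right a. N x0 \<le> E * (\<psi> t - \<psi> a) powr \<theta>"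
      unfolding eventually_at_right_field by (intro exI[of _ "a + 1"]) auto
    have "continuous_on {a..} (\<lambda>t. E * (\<psi> t - \<psi> a) powr \<theta>)"
      using \<theta> that by (intro continuous_intros continuous_on_powr' cont) (auto simp: psi_le_iff)
    then have "((\<lambda>t. E * (\<psi> t - \<psi> a) powr \<theta>) \<longlongrightarrow> 0) (at a within {a..})"
      by (auto simp: continuous_on_def dest: bspec[of _ _ a])
    then have "((\<lambda>t. E * (\<psi> t - \<psi> a) powr \<theta>) \<longlongrightarrow> 0) (at_right a)"
      by (rule tendsto_within_subset) auto
    from tendsto_lowerbound[OF this ev] have "N x0 \<le> 0" by simp
    then have "N x0 = 0" using N_nonneg by (intro antisym)
    then show ?thesis by simp
  qed
  \<comment> \<open>The supremum in the hypothesis runs over t > a only; at \<open>a\<close> the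
    value of T 0 is c, whence the maximum with N c.\<close>
  have start: "N (T (\<lambda>_. 0) t) \<le> max \<bar>D\<bar> (N c) * w t" if "t \<ge> a" for t
  proof (cases "t = a")
    case True
    have "N c * 1 \<le> max \<bar>D\<bar> (N c) * w t"
      using w1[of t] N_nonneg[of c] by (intro mult_mono) auto
    then show ?thesis unfolding T_def True RL_at_start[OF par(1)] by simp
  next
    case False
    then have t: "t > a" using that by simp
    have "((\<psi> t - \<psi> a) powr (\<gamma> - 1) / Gamma \<gamma>) *\<^sub>R x0 = c"
      using x0 psi_less[of a t] t by (auto simp: c_def \<gamma>\<theta>)
    then have "N (T (\<lambda>_. 0) t) \<le> D * w t" using D[OF t] by (simp add: T_def F0)
    also have "\<dots> \<le> max \<bar>D\<bar> (N c) * w t" using w1[of t] by (intro mult_right_mono) auto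
    finally show ?thesis .
  qed
  have right_lim: "(x \<longlongrightarrow> x a) (at_right a)" if "continuous_on {a..} x" for x :: "real \<Rightarrow> real ^ 'n"
  proof -
    have "(x \<longlongrightarrow> x a) (at a within {a..})" using that by (auto simp: continuous_on_def)
    then show ?thesis by (rule tendsto_within_subset) auto
  qed
  have sol_iff: "integrodiff_solution a \<alpha> \<beta> \<psi> \<psi>' f k x0 x \<longleftrightarrow> (\<forall>t\<ge>a. T x t = x t)"
    if x: "continuous_on {a..} x" for x
  proof -
    have sol: "integrodiff_solution a \<alpha> \<beta> \<psi> \<psi>' f k x0 x \<longleftrightarrow>
      has_psi_Hilfer a \<alpha> \<beta> \<psi> \<psi>' x (F x) \<and> (psi_RL_integral a \<theta> \<psi> \<psi>' x \<longlongrightarrow> x0) (at_right a)"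
      by (simp add: integrodiff_solution_def F_def[abs_def] J_def \<gamma>\<theta> flip: assms(5))
    show ?thesis
    proof
      assume "integrodiff_solution a \<alpha> \<beta> \<psi> \<psi>' f k x0 x"
      then have H: "has_psi_Hilfer a \<alpha> \<beta> \<psi> \<psi>' x (F x)" and init: "(psi_RL_integral a \<theta> \<psi> \<psi>' x \<longlongrightarrow> x0) (at_right a)"
        using sol by auto
      \<comment> \<open>Only for \<theta> = 0 does the initial condition carry information: there it
        reads x(a) = x0.\<close>
      have "(if \<theta> = 0 then x a else 0) = c"
      proof (cases "\<theta> = 0")
        case True
        then have "(x \<longlongrightarrow> x0) (at_right a)" using init by (simp add: psi_RL_integral_def[abs_def])
        then show ?thesis
          using tendsto_unique[OF _ right_lim[OF x]] True by (simp add: c_def)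
      qed (simp add: c_def)
      then show "\<forall>t\<ge>a. T x t = x t"
        using Hilfer_integral_equation[OF par x F_cont[OF x] H] by (simp add: T_def \<theta>_def)
    next
      assume fix_x: "\<forall>t\<ge>a. T x t = x t"
      have "has_psi_Hilfer a \<alpha> \<beta> \<psi> \<psi>' x (F x)"
        by (rule has_psi_Hilfer_RL[where c = c, OF par _ F_cont[OF x]]) (use fix_x in \<open>auto simp: c_def \<theta>_def T_def\<close>)
      moreover have "(psi_RL_integral a \<theta> \<psi> \<psi>' x \<longlongrightarrow> x0) (at_right a)"
      proof -
        \<comment> \<open>For \<theta> > 0 both sides are 0, the right one by the argument above;
          continuity of the fractional integral then gives the limit.\<close>
        have "psi_RL_integral a \<theta> \<psi> \<psi>' x a = x0"
        proof (cases "\<theta> = 0")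
          case True
          have "x a = T x a" using fix_x by simp
          then show ?thesis using True by (simp add: T_def RL_at_start[OF par(1)] c_def psi_RL_integral_def[of a 0])
        next
          case False
          then show ?thesis using RL_at_start[of \<theta> x] \<theta> x0 by simp
        qed
        then show ?thesis using right_lim[OF RL_continuous1[OF \<theta> x]] by simp
      qed
      ultimately show "integrodiff_solution a \<alpha> \<beta> \<psi> \<psi>' f k x0 x" using sol by simp
    qed
  qed
  have C_iff: "x \<in> C_xi N a \<alpha> \<psi> \<xi> \<longleftrightarrow>
      x \<in> extensional {a..} \<and> continuous_on {a..} x \<and> (\<exists>C\<ge>0. \<forall>t\<ge>a. N (x t) \<le> C * w t)" for x
  proof -
    have w0: "w t > 0" for t using w1[of t] by simp
    have "bdd_above ((\<lambda>t. N (x t) / w t) ` {a..}) \<longleftrightarrow> (\<exists>C\<ge>0. \<forall>t\<ge>a. N (x t) \<le> C * w t)"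
    proof
      assume "bdd_above ((\<lambda>t. N (x t) / w t) ` {a..})"
      then obtain C where "\<And>t. t \<ge> a \<Longrightarrow> N (x t) / w t \<le> C" by (auto simp: bdd_above_def)
      then have "N (x t) / w t \<le> max C 0" if "t \<ge> a" for t using that by fastforce
      then show "\<exists>C\<ge>0. \<forall>t\<ge>a. N (x t) \<le> C * w t"
        using w0 by (intro exI[of _ "max C 0"]) (auto simp: divide_le_eq)
    next
      assume "\<exists>C\<ge>0. \<forall>t\<ge>a. N (x t) \<le> C * w t"
      then obtain C where "\<And>t. t \<ge> a \<Longrightarrow> N (x t) \<le> C * w t" by blast
      then show "bdd_above ((\<lambda>t. N (x t) / w t) ` {a..})"
        using w0 by (intro bdd_aboveI2[of _ _ C]) (auto simp: divide_le_eq)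
    qed
    then show ?thesis by (simp add: C_xi_def w_def)
  qed
  show ?thesis
  proof (rule ex_ex1I)
    have "\<exists>x. continuous_on {a..} x \<and> (\<forall>t\<ge>a. N (x t) \<le> max \<bar>D\<bar> (N c) / (1 - q) * w t) \<and> (\<forall>t\<ge>a. T x t = x t)"
    proof (rule weighted_contraction_fixed_point[OF q])
      show "0 \<le> w t" for t using w1[of t] by simp
    qed (use T_cont contr start w_mono in auto)
    then obtain x where x: "continuous_on {a..} x" "\<And>t. t \<ge> a \<Longrightarrow> N (x t) \<le> max \<bar>D\<bar> (N c) / (1 - q) * w t"
      "\<And>t. t \<ge> a \<Longrightarrow> T x t = x t"
      by blast
    \<comment> \<open>The fixed point is arbitrary to the left of \<open>a\<close>, so it is
      restricted to become a member of C_xi.\<close>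
    define z where "z = restrict x {a..}"
    have z: "z t = x t" if "t \<ge> a" for t using that by (simp add: z_def)
    have zc: "continuous_on {a..} z" using x(1) by (rule continuous_on_eq) (simp add: z)
    have "T z t = z t" if t: "t \<ge> a" for t
    proof -
      \<comment> \<open>The contraction estimate with constant 0 expresses that T sees only the
        values on the half-line from \<open>a\<close>.\<close>
      have "N (T z t - T x t) \<le> q * 0 * w t" by (rule contr[OF zc x(1) _ t]) (auto simp: z)
      then have "N (T z t - T x t) = 0" using N_nonneg[of "T z t - T x t"] by simp
      then show ?thesis using x(3)[OF t] z[OF t] by simp
    qed
    moreover have "max \<bar>D\<bar> (N c) / (1 - q) \<ge> 0" using q by simp
    then have "z \<in> C_xi N a \<alpha> \<psi> \<xi>"
      unfolding C_iff using zc x(2) z by (auto simp: z_def)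
    ultimately show "\<exists>x. x \<in> C_xi N a \<alpha> \<psi> \<xi> \<and> integrodiff_solution a \<alpha> \<beta> \<psi> \<psi>' f k x0 x"
      using sol_iff[OF zc] by blast
  next
    fix x y
    assume *: "x \<in> C_xi N a \<alpha> \<psi> \<xi> \<and> integrodiff_solution a \<alpha> \<beta> \<psi> \<psi>' f k x0 x"
      "y \<in> C_xi N a \<alpha> \<psi> \<xi> \<and> integrodiff_solution a \<alpha> \<beta> \<psi> \<psi>' f k x0 y"
    then have c: "continuous_on {a..} x" "continuous_on {a..} y" by (auto simp: C_iff)
    have fx: "T x t = x t" "T y t = y t" if "t \<ge> a" for t
      using * sol_iff c that by auto
    obtain C1 C2 where C: "C1 \<ge> 0" "C2 \<ge> 0" "\<And>t. t \<ge> a \<Longrightarrow> N (x t) \<le> C1 * w t" "\<And>t. t \<ge> a \<Longrightarrow> N (y t) \<le> C2 * w t"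
      using * unfolding C_iff by blast
    have "x t = y t" if "t \<ge> a" for t
    proof (rule weighted_contraction_unique[OF q, of a x y w "C1 + C2" t])
      show "N (x s - y s) \<le> (C1 + C2) * w s" if "s \<ge> a" for s
        using N_triangle[of "x s" "- y s"] C(3,4)[OF that] by (simp add: N_minus algebra_simps)
      show "N (x t - y t) \<le> q * C * w t"
        if "0 \<le> C" "t \<ge> a" "\<And>s. s \<ge> a \<Longrightarrow> N (x s - y s) \<le> C * w s" for C t
        using contr[OF c that] fx[OF that(2)] by simp
    qed (use C that in auto)
    then show "x = y"
      using * by (intro extensionalityI[of x "{a..}" y]) (auto simp: C_iff)
  qed
qed

end
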